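(* Fix a finite time $T>0$. Suppose that (A1) and (A2) of the context hold, that $v_I\in L^\infty(\mathbb{R}_+,\omega)$, and that i) $f$ is Lipschitz on $(0,T)$, ii) $\beta$ satisfies (A3) together with $\beta_{\min}>\breve\zeta$, where $$\breve\zeta:=\zeta(0)+\zeta_{\rm Lip}\left(\int_0^\infty|v_I(a)|\,\rho_I(a)\,da+\int_0^T|\partial_t f(s)|\,ds\right).$$ Then there exists a unique solution $(\rho,v)\in C([0,T];L^1(\mathbb{R}_+))\times X_T$ of the fully coupled system $$\varepsilon\partial_t\rho+\partial_a\rho+\zeta(v)\rho=0,\quad \rho(t,0)=\beta(t)(1-\mu_0(t)),\quad \rho(0,a)=\rho_I(a),$$ $$\varepsilon\partial_t v+\partial_a v=\frac{1}{\mu_0(t)}\left(\varepsilon\partial_t f+\int_0^\infty\zeta(v(t,\tilde a))\,v(t,\tilde a)\,\rho(t,\tilde a)\,d\tilde a\right),\quad v(t,0)=0,\quad v(0,a)=v_I(a),$$ for $t\in(0,T)$, $a>0$, where $\mu_0(t)=\int_0^\infty\rho(t,a)\,da$.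
   Context: $\mathbb{R}_+=[0,\infty)$; $\varepsilon>0$ is fixed; $\omega(a)=1/(1+a)$. $X_T$ is the set of $u\in L^\infty_{loc}((0,T)\times\mathbb{R}_+)$ with $\|u\|_{X_T}:=\sup_{t\in(0,T)}\|u(t,\cdot)\,\omega\|_{L^\infty(\mathbb{R}_+)}<\infty$; $L^\infty(\mathbb{R}_+,\omega)$ is the set of $v$ with $v\omega\in L^\infty(\mathbb{R}_+)$. (A1) $\zeta:\mathbb{R}\to\mathbb{R}$ is Lipschitz, $\zeta(u)\ge\zeta_{\min}>0$ and $|\zeta'(u)|\le\zeta_{\rm Lip}$ for all $u$. (A2) $\rho_I\in L^\infty(\mathbb{R}_+)$, $\rho_I\ge0$ a.e., $0<\int_0^\infty\rho_I\,da<1$, and $0<\int_0^\infty a^p\rho_I(a)\,da<\infty$ for $p=1,2$. (A3) $\beta$ is a continuous function of $t$ with $0<\beta_{\min}\le\beta(t)\le\beta_{\max}$. Solutions are understood in the sense of characteristics: with $z(t,a)=\zeta(v(t,a))$ and $g(t)$ the right-hand side of the equation for $v$, $\rho(t,a)=\beta(t-\varepsilon a)(1-\mu_0(t-\varepsilon a))\exp(-\int_0^a z(t-\varepsilon(a-s),s)\,ds)$ if $a<t/\varepsilon$, $\rho(t,a)=\rho_I(a-t/\varepsilon)\exp(-\frac1\varepsilon\int_0^t z(s,a+(s-t)/\varepsilon)\,ds)$ if $a\ge t/\varepsilon$; $v(t,a)=\frac1\varepsilon\int_{t-\varepsilon a}^t g(s)\,ds$ if $a<t/\varepsilon$, $v(t,a)=v_I(a-t/\varepsilon)+\frac1\varepsilon\int_0^t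 g(s)\,ds$ if $a\ge t/\varepsilon$. *)

theory Defs
  imports "HOL-Probability.Essential_Supremum"
begin

text \<open>
  Elements of spaces of classes modulo null sets are represented by functions, with the Lebesgue
  measure throughout.  \<open>\<rho> t a\<close> and \<open>v t a\<close> are curried in time \<open>t\<close> and age \<open>a\<close>.
\<close>

definition Linf :: "'a::euclidean_space set \<Rightarrow> ('a \<Rightarrow> real) \<Rightarrow> bool" where
  "Linf S u \<longleftrightarrow> u \<in> borel_measurable (lebesgue_on S) \<and>
     esssup (lebesgue_on S) (\<lambda>x. ereal \<bar>u x\<bar>) < \<infinity>"

definition Linf_loc :: "'a::euclidean_space set \<Rightarrow> ('a \<Rightarrow> real) \<Rightarrow> bool" where
  "Linf_loc S u \<longleftrightarrow> u \<in> borel_measurable (lebesgue_on S) \<and> (\<forall>K. compact K \<and> K \<subseteq> S \<longrightarrow> Linf K u)"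

definition omega :: "real \<Rightarrow> real" where
  "omega a = 1 / (1 + a)"

definition Linf_omega :: "(real \<Rightarrow> real) \<Rightarrow> bool" where
  "Linf_omega v \<longleftrightarrow> Linf {0..} (\<lambda>a. v a * omega a)"

definition XT_norm :: "real \<Rightarrow> (real \<Rightarrow> real \<Rightarrow> real) \<Rightarrow> ereal" where
  "XT_norm T u = (SUP t\<in>{0<..<T}. esssup (lebesgue_on {0..}) (\<lambda>a. ereal \<bar>u t a * omega a\<bar>))"

definition XT :: "real \<Rightarrow> (real \<Rightarrow> real \<Rightarrow> real) \<Rightarrow> bool" where
  "XT T u \<longleftrightarrow> Linf_loc ({0<..<T} \<times> {0..}) (\<lambda>(t, a). u t a) \<and> XT_norm T u < \<infinity>"

definition C_L1 :: "real \<Rightarrow> (real \<Rightarrow> real \<Rightarrow> real) \<Rightarrow> bool" where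
  "C_L1 T \<rho> \<longleftrightarrow>
     (\<forall>t\<in>{0..T}. integrable (lebesgue_on {0..}) (\<rho> t)) \<and>
     (\<forall>t\<in>{0..T}. ((\<lambda>s. LINT a|lebesgue_on {0..}. \<bar>\<rho> s a - \<rho> t a\<bar>) \<longlongrightarrow> 0) (at t within {0..T}))"

text \<open>
  A Lipschitz function need not be differentiable everywhere; the bound on \<open>\<zeta>'\<close> is only required
  where \<open>\<zeta>'\<close> exists, i.e. almost everywhere.
\<close>

definition A1 :: "(real \<Rightarrow> real) \<Rightarrow> real \<Rightarrow> real \<Rightarrow> bool" where
  "A1 \<zeta> \<zeta>min \<zeta>Lip \<longleftrightarrow>
     (\<exists>L. L-lipschitz_on UNIV \<zeta>) \<and> 0 < \<zeta>min \<and> (\<forall>u. \<zeta>min \<le> \<zeta> u) \<and>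
     (\<forall>u. \<zeta> differentiable (at u) \<longrightarrow> \<bar>deriv \<zeta> u\<bar> \<le> \<zeta>Lip)"

definition A2 :: "(real \<Rightarrow> real) \<Rightarrow> bool" where
  "A2 \<rho>I \<longleftrightarrow>
     Linf {0..} \<rho>I \<and> (AE a in lebesgue_on {0..}. 0 \<le> \<rho>I a) \<and>
     integrable (lebesgue_on {0..}) \<rho>I \<and>
     0 < (LINT a|lebesgue_on {0..}. \<rho>I a) \<and> (LINT a|lebesgue_on {0..}. \<rho>I a) < 1 \<and>
     (\<forall>p\<in>{1, 2::nat}. integrable (lebesgue_on {0..}) (\<lambda>a. a ^ p * \<rho>I a) \<and>
        0 < (LINT a|lebesgue_on {0..}. a ^ p * \<rho>I a))"

definition A3 :: "real \<Rightarrow> (real \<Rightarrow> real) \<Rightarrow> real \<Rightarrow> real \<Rightarrow> bool" where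
  "A3 T \<beta> \<beta>min \<beta>max \<longleftrightarrow>
     continuous_on {0..T} \<beta> \<and> 0 < \<beta>min \<and> (\<forall>t\<in>{0..T}. \<beta>min \<le> \<beta> t \<and> \<beta> t \<le> \<beta>max)"

definition mu0 :: "(real \<Rightarrow> real \<Rightarrow> real) \<Rightarrow> real \<Rightarrow> real" where
  "mu0 \<rho> t = (LINT a|lebesgue_on {0..}. \<rho> t a)"

definition zeta_breve ::
  "(real \<Rightarrow> real) \<Rightarrow> real \<Rightarrow> (real \<Rightarrow> real) \<Rightarrow> (real \<Rightarrow> real) \<Rightarrow> (real \<Rightarrow> real) \<Rightarrow> real \<Rightarrow> real" where
  "zeta_breve \<zeta> \<zeta>Lip vI \<rho>I f T =
     \<zeta> 0 + \<zeta>Lip * ((LINT a|lebesgue_on {0..}. \<bar>vI a\<bar> * \<rho>I a)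
       + (LINT s|lebesgue_on {0<..<T}. \<bar>deriv f s\<bar>))"

text \<open>The right-hand side of the equation for \<open>v\<close>.\<close>

definition v_source ::
  "real \<Rightarrow> (real \<Rightarrow> real) \<Rightarrow> (real \<Rightarrow> real) \<Rightarrow> (real \<Rightarrow> real \<Rightarrow> real) \<Rightarrow> (real \<Rightarrow> real \<Rightarrow> real) \<Rightarrow> real \<Rightarrow> real"
where
  "v_source \<epsilon> f \<zeta> \<rho> v t =
     1 / mu0 \<rho> t * (\<epsilon> * deriv f t + (LINT a|lebesgue_on {0..}. \<zeta> (v t a) * v t a * \<rho> t a))"

text \<open>The right-hand sides of the representation formulas along characteristics.\<close>

definition rho_char ::
  "real \<Rightarrow> (real \<Rightarrow> real) \<Rightarrow> (real \<Rightarrow> real) \<Rightarrow> (real \<Rightarrow> real) \<Rightarrow>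
   (real \<Rightarrow> real \<Rightarrow> real) \<Rightarrow> (real \<Rightarrow> real \<Rightarrow> real) \<Rightarrow> real \<Rightarrow> real \<Rightarrow> real" where
  "rho_char \<epsilon> \<beta> \<zeta> \<rho>I \<rho> v t a =
     (if a < t / \<epsilon>
      then \<beta> (t - \<epsilon> * a) * (1 - mu0 \<rho> (t - \<epsilon> * a)) *
           exp (- (LINT s|lebesgue_on {0..a}. \<zeta> (v (t - \<epsilon> * (a - s)) s)))
      else \<rho>I (a - t / \<epsilon>) *
           exp (- (1 / \<epsilon>) * (LINT s|lebesgue_on {0..t}. \<zeta> (v s (a + (s - t) / \<epsilon>)))))"

definition v_char ::
  "real \<Rightarrow> (real \<Rightarrow> real) \<Rightarrow> (real \<Rightarrow> real) \<Rightarrow> real \<Rightarrow> real \<Rightarrow> real" where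
  "v_char \<epsilon> vI g t a =
     (if a < t / \<epsilon>
      then 1 / \<epsilon> * (LINT s|lebesgue_on {t - \<epsilon> * a..t}. g s)
      else vI (a - t / \<epsilon>) + 1 / \<epsilon> * (LINT s|lebesgue_on {0..t}. g s))"

text \<open>
  Solutions in the sense of characteristics.  The conditions on \<open>mu0\<close> and the two integrability
  conditions only say that the right-hand side of the equation for \<open>v\<close> and its time integrals are
  meaningful (a quotient by zero and a non-existing integral would be 0 in HOL).  The integrals
  of \<open>\<zeta> \<circ> v\<close> in \<open>rho_char\<close> exist for almost every characteristic, since \<open>v\<close> is in \<open>XT\<close>; their values do
  not change, for almost every \<open>a\<close>, if \<open>v\<close> is modified on a null set of \<open>(t, a)\<close>.
\<close>

definition char_solution ::
  "real \<Rightarrow> real \<Rightarrow> (real \<Rightarrow> real) \<Rightarrow> (real \<Rightarrow> real) \<Rightarrow> (real \<Rightarrow> real) \<Rightarrow> (real \<Rightarrow> real) \<Rightarrow> (real \<Rightarrow> real) \<Rightarrow>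
   (real \<Rightarrow> real \<Rightarrow> real) \<Rightarrow> (real \<Rightarrow> real \<Rightarrow> real) \<Rightarrow> bool" where
  "char_solution \<epsilon> T \<zeta> \<beta> f \<rho>I vI \<rho> v \<longleftrightarrow>
     C_L1 T \<rho> \<and> XT T v \<and>
     (\<forall>t\<in>{0<..<T}. mu0 \<rho> t \<noteq> 0) \<and>
     (\<forall>t\<in>{0<..<T}. integrable (lebesgue_on {0..}) (\<lambda>a. \<zeta> (v t a) * v t a * \<rho> t a)) \<and>
     integrable (lebesgue_on {0<..<T}) (v_source \<epsilon> f \<zeta> \<rho> v) \<and>
     (\<forall>t\<in>{0..T}. AE a in lebesgue_on {0..}. \<rho> t a = rho_char \<epsilon> \<beta> \<zeta> \<rho>I \<rho> v t a) \<and>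
     (\<forall>t\<in>{0<..<T}. AE a in lebesgue_on {0..}. v t a = v_char \<epsilon> vI (v_source \<epsilon> f \<zeta> \<rho> v) t a)"

end

theory Submission
  imports Defs
begin

text \<open>
  Label a characteristic by \<open>x = t - \<epsilon> a\<close> and let \<open>\<epsilon> G' = g\<close>, \<open>G 0 = 0\<close>, where \<open>g\<close> is the source
  of \<open>v\<close>.  Then \<open>v = G t - G x\<close> on the characteristics born at time \<open>x > 0\<close>, \<open>v = G t + v_I (- x / \<epsilon>)\<close> on
  the initial ones, and the system reduces to two Volterra equations for the continuous functions
  \<open>\<mu>\<^sub>0\<close> and \<open>G\<close>:
  \<open>\<mu>\<^sub>0 t = \<integral> \<rho>\<close> and \<open>G t = \<integral>\<^sub>0\<^sup>t (\<partial>\<^sub>t f + k / \<epsilon>) / \<mu>\<^sub>0\<close> with \<open>k = \<integral> \<zeta> v v \<rho>\<close>.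
  Since \<open>\<zeta> \<ge> 0\<close>, survival factors are at most 1 and Lipschitz in \<open>G\<close>, so after truncating \<open>G\<close>, \<open>k\<close> and \<open>\<mu>\<^sub>0\<close>
  (from above in the birth rate, from below in the denominator) the equations have a solution by
  contraction in a weighted norm.

  The truncations are inactive.  The bound \<open>\<mu>\<^sub>0 \<bar>g\<bar> \<le> \<epsilon> \<bar>\<partial>\<^sub>t f\<bar> + \<integral> \<zeta> v \<bar>v\<bar> \<rho>\<close> survives truncation and yields
  \<open>\<integral> \<bar>v\<bar> \<rho> \<le> P := \<integral> \<bar>v_I\<bar> \<rho>_I + \<integral> \<bar>\<partial>\<^sub>t f\<bar>\<close>; as \<open>\<zeta>_Lip P < \<beta>_min\<close>, the mass balance keeps \<open>\<mu>\<^sub>0\<close> away from 0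
  and below 1.  Finally \<open>G \<mu>\<^sub>0\<close> is the sum of \<open>\<integral> v \<rho>\<close> and an integral linear in \<open>G\<close>, so Gronwall's
  inequality bounds \<open>G\<close>, hence \<open>k\<close>, independently of the truncation levels.  Uniqueness is Gronwall's
  inequality for the difference of two solutions of the Volterra equations.
\<close>

section \<open>Lipschitz functions on the line\<close>

text \<open>The condition on \<open>\<beta>min\<close> involves \<open>\<zeta>Lip\<close> itself, so
  the a priori bound needs \<open>\<zeta>Lip\<close> as a Lipschitz constant of \<zeta>, while (A1)
  bounds \<zeta>' only where it exists. This, and the measurability of \<open>deriv f\<close>, calls
  for almost everywhere differentiability of Lipschitz functions. The contraction argument works
  with any Lipschitz constant \<open>L\<close>. The bound P does not depend on the mass because of a
  cancellation: the source feeds the first absolute moment with at most \<epsilon> |f'| plus the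
  integral of \<zeta>(v) |v| \<rho>, and the latter is exactly what mortality removes from that
  moment. Newborns add nothing, as v = 0 at age 0. Through v_I the velocity grows linearly in age,
  so \<zeta>(v) v grows quadratically; the second moment of \<rho>_I then gives integrable majorants
  that depend only on bounds for G and for the birth rate. A competing solution comes with no lower
  bound for its mass near the final time and no bound for its source, only integrability; it is
  therefore compared on shorter intervals, and agreement is extended by continuity.\<close>

definition dquot :: "(real \<Rightarrow> real) \<Rightarrow> real \<Rightarrow> real \<Rightarrow> real" where
  "dquot f h x = (f (x + h) - f x) / h"

lemma continuous_dquot:
  "continuous_on UNIV f \<Longrightarrow> continuous_on UNIV (dquot f h)"
  unfolding dquot_def
  by (cases "h = 0") (auto intro!: continuous_intros intro: continuous_on_compose2[of UNIV f])

lemma open_dquot_less: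
  assumes "continuous_on UNIV f"
  shows "open {x. \<exists>h. 0 < \<bar>h\<bar> \<and> \<bar>h\<bar> < d \<and> dquot f h x < p}"
proof -
  have "{x. \<exists>h. 0 < \<bar>h\<bar> \<and> \<bar>h\<bar> < d \<and> dquot f h x < p}
      = (\<Union>h\<in>{h. 0 < \<bar>h\<bar> \<and> \<bar>h\<bar> < d}. {x. dquot f h x < p})" by auto
  then show ?thesis
    by (auto intro!: open_UN open_Collect_less continuous_dquot assms continuous_intros)
qed

lemma open_dquot_greater:
  assumes "continuous_on UNIV f"
  shows "open {x. \<exists>h. 0 < \<bar>h\<bar> \<and> \<bar>h\<bar> < d \<and> p < dquot f h x}"
proof -
  have "{x. \<exists>h. 0 < \<bar>h\<bar> \<and> \<bar>h\<bar> < d \<and> p < dquot f h x}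
      = (\<Union>h\<in>{h. 0 < \<bar>h\<bar> \<and> \<bar>h\<bar> < d}. {x. p < dquot f h x})" by auto
  then show ?thesis
    by (auto intro!: open_UN open_Collect_less continuous_dquot assms continuous_intros)
qed

definition osc_set :: "(real \<Rightarrow> real) \<Rightarrow> real \<Rightarrow> real \<Rightarrow> real set" where
  "osc_set f p q = {x. \<forall>n::nat. (\<exists>h. 0 < \<bar>h\<bar> \<and> \<bar>h\<bar> < 1 / Suc n \<and> dquot f h x < p) \<and>
                        (\<exists>h. 0 < \<bar>h\<bar> \<and> \<bar>h\<bar> < 1 / Suc n \<and> q < dquot f h x)}"

lemma osc_setD:
  assumes "x \<in> osc_set f p q" "0 < d"
  shows "\<exists>h. 0 < \<bar>h\<bar> \<and> \<bar>h\<bar> < d \<and> dquot f h x < p"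
    and "\<exists>h. 0 < \<bar>h\<bar> \<and> \<bar>h\<bar> < d \<and> q < dquot f h x"
proof -
  obtain n :: nat where n: "1 / Suc n < d"
    using reals_Archimedean[OF \<open>0 < d\<close>] by (auto simp: inverse_eq_divide)
  obtain h where "0 < \<bar>h\<bar>" "\<bar>h\<bar> < 1 / Suc n" "dquot f h x < p"
    using assms(1) unfolding osc_set_def by blast
  then show "\<exists>h. 0 < \<bar>h\<bar> \<and> \<bar>h\<bar> < d \<and> dquot f h x < p"
    using n by (meson order.strict_trans)
  obtain h where "0 < \<bar>h\<bar>" "\<bar>h\<bar> < 1 / Suc n" "q < dquot f h x"
    using assms(1) unfolding osc_set_def by blast
  then show "\<exists>h. 0 < \<bar>h\<bar> \<and> \<bar>h\<bar> < d \<and> q < dquot f h x"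
    using n by (meson order.strict_trans)
qed

lemma osc_set_borel:
  assumes "continuous_on UNIV f"
  shows "osc_set f p q \<in> sets borel"
proof -
  have "osc_set f p q = (\<Inter>n::nat. {x. \<exists>h. 0 < \<bar>h\<bar> \<and> \<bar>h\<bar> < 1 / Suc n \<and> dquot f h x < p} \<inter>
        {x. \<exists>h. 0 < \<bar>h\<bar> \<and> \<bar>h\<bar> < 1 / Suc n \<and> q < dquot f h x})"
    unfolding osc_set_def by auto
  also have "\<dots> \<in> sets borel"
    by (intro sets.countable_INT'[OF countableI_type UNIV_not_empty] image_subsetI sets.Int borel_open open_dquot_less open_dquot_greater assms)
  finally show ?thesis .
qed

text \<open>Vitali's covering theorem is applied to closed balls: segments issuing from
  \<open>x\<close> in either direction are balls about their midpoints.\<close>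

lemma cball_segment:
  fixes x h :: real
  shows "cball (x + h / 2) (\<bar>h\<bar> / 2) = {min x (x + h)..max x (x + h)}"
  by (cases "h \<ge> 0") (auto simp: cball_eq_atLeastAtMost min_def max_def field_simps)

text \<open>Whatever the sign of \<open>h\<close>, slope times length is the increase of
  \<open>f\<close> over the segment; bounds on slopes thus compare Stieltjes and Lebesgue
  measure.\<close>

lemma dquot_cball:
  assumes "h \<noteq> 0"
  shows "dquot f h x * \<bar>h\<bar> = f (max x (x + h)) - f (min x (x + h))"
  using assms by (cases "h > 0") (auto simp: dquot_def min_def max_def field_simps)

lemma dquot_lipschitz:
  assumes "L-lipschitz_on UNIV f"
  shows "\<bar>dquot f h x\<bar> \<le> L"
  using lipschitz_onD[OF assms, of "x + h" x] lipschitz_on_nonneg[OF assms]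
  by (cases "h = 0") (simp_all add: dquot_def dist_real_def abs_divide divide_le_eq)

text \<open>Along a fixed sequence of steps the derivative is a limit of continuous functions, which
  gives access to measurability and dominated convergence.\<close>

lemma dquot_tendsto_deriv:
  assumes "f differentiable (at x)"
  shows "(\<lambda>n. dquot f (1 / Suc n) x) \<longlonglongrightarrow> deriv f x"
proof -
  have "(f has_field_derivative deriv f x) (at x)"
    using assms DERIV_deriv_iff_real_differentiable by blast
  then have "((\<lambda>h. dquot f h x) \<longlongrightarrow> deriv f x) (at 0)"
    unfolding DERIV_def dquot_def .
  moreover have "filterlim (\<lambda>n. 1 / real (Suc n)) (at 0) sequentially"
    unfolding filterlim_at using LIMSEQ_inverse_real_of_nat by (auto simp: inverse_eq_divide)
  ultimately show ?thesis by (rule filterlim_compose)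
qed

text \<open>If the lower and upper limits of the quotient differed, two rationals strictly between
  them would place \<open>x\<close> in an \<open>osc_set\<close>. The Lipschitz bound makes their
  common value finite.\<close>

lemma differentiable_osc_set:
  assumes "\<And>p q. p \<in> \<rat> \<Longrightarrow> q \<in> \<rat> \<Longrightarrow> p < q \<Longrightarrow> x \<notin> osc_set f p q"
    and L: "L-lipschitz_on UNIV f"
  shows "f differentiable (at x)"
proof -
  let ?q = "\<lambda>h. ereal (dquot f h x)"
  have ev: "\<forall>\<^sub>F h in at 0. \<bar>dquot f h x\<bar> \<le> L"
    using dquot_lipschitz[OF L] by simp
  have le: "Liminf (at 0) ?q \<le> Limsup (at 0) ?q"
    by (intro Liminf_le_Limsup) simp
  have "\<not> Liminf (at 0) ?q < Limsup (at 0) ?q"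
  proof
    assume "Liminf (at 0) ?q < Limsup (at 0) ?q"
    then obtain p' where p': "Liminf (at 0) ?q < ereal p'" "ereal p' < Limsup (at 0) ?q"
      using ereal_dense2 by blast
    obtain q' where q': "ereal p' < ereal q'" "ereal q' < Limsup (at 0) ?q"
      using ereal_dense2[OF p'(2)] by blast
    obtain a where a: "a \<in> \<rat>" "p' < a" "a < q'" using Rats_dense_in_real[of p' q'] q' by auto
    obtain b where b: "b \<in> \<rat>" "a < b" "b < q'" using Rats_dense_in_real[of a q'] a by auto
    have f1: "\<exists>\<^sub>F h in at 0. dquot f h x < a"
    proof (rule ccontr)
      assume "\<not> ?thesis"
      then have "\<forall>\<^sub>F h in at 0. ereal a \<le> ?q h" by (simp add: frequently_def not_less)
      then have "ereal a \<le> Liminf (at 0) ?q" by (rule Liminf_bounded)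
      with p'(1) a(2) show False by (meson ereal_less_eq(3) leD less_eq_real_def order_trans)
    qed
    have f2: "\<exists>\<^sub>F h in at 0. b < dquot f h x"
    proof (rule ccontr)
      assume "\<not> ?thesis"
      then have "\<forall>\<^sub>F h in at 0. ?q h \<le> ereal b" by (simp add: frequently_def not_less)
      then have "Limsup (at 0) ?q \<le> ereal b" by (rule Limsup_bounded)
      with q'(2) b(3) show False by (meson ereal_less_eq(3) leD less_eq_real_def order_trans)
    qed
    have "x \<in> osc_set f a b"
      unfolding osc_set_def
    proof (safe)
      fix n :: nat
      have "(0::real) < 1 / Suc n" by simp
      then show "\<exists>h. 0 < \<bar>h\<bar> \<and> \<bar>h\<bar> < 1 / Suc n \<and> dquot f h x < a"
        using f1 by (auto simp: frequently_at dist_real_def)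
      show "\<exists>h. 0 < \<bar>h\<bar> \<and> \<bar>h\<bar> < 1 / Suc n \<and> b < dquot f h x"
        using f2 \<open>(0::real) < 1 / Suc n\<close> by (auto simp: frequently_at dist_real_def)
    qed
    with assms(1)[OF a(1) b(1) b(2)] show False by simp
  qed
  with le have eq: "Liminf (at 0) ?q = Limsup (at 0) ?q" by simp
  have "Limsup (at 0) ?q \<le> ereal L" "ereal (- L) \<le> Liminf (at 0) ?q"
    by (rule Limsup_bounded Liminf_bounded; use ev in \<open>eventually_elim; auto\<close>)+
  then obtain D where D: "Limsup (at 0) ?q = ereal D"
    using eq by (cases "Limsup (at 0) ?q") auto
  have "(?q \<longlongrightarrow> ereal D) (at 0)"
    using Liminf_eq_Limsup[of "at (0::real)" ?q "ereal D"] eq D by simp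
  then have "((\<lambda>h. dquot f h x) \<longlongrightarrow> D) (at 0)" by simp
  then have "(f has_field_derivative D) (at x)"
    unfolding DERIV_def dquot_def .
  then show ?thesis by (metis differentiable_def has_field_derivative_imp_has_derivative)
qed

text \<open>
  Cover the set first by short intervals of slope below \<open>p\<close> inside an open set of almost the same
  measure, then by intervals of slope above \<open>q\<close> inside the first ones, both times by Vitali's
  theorem, and compare the Stieltjes measures of the two coverings.
\<close>

lemma osc_set_null:
  assumes mono: "mono f" and cont: "continuous_on UNIV f" and pq: "p < q"
  shows "osc_set f p q \<inter> ball 0 N \<in> null_sets lborel"
proof (cases "0 < p")
  case False
  \<comment> \<open>Quotients of a monotone function are nonnegative, so none lies below
    \<open>p \<le> 0\<close>.\<close>
  have "dquot f h x \<ge> 0" if "h \<noteq> 0" for h x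
    using that monoD[OF mono, of x "x + h"] monoD[OF mono, of "x + h" x]
    by (cases "h > 0") (auto simp: dquot_def divide_nonpos_neg)
  then have "osc_set f p q = {}"
    using False osc_setD(1)[of _ f p q 1] by (metis abs_0 equals0I less_irrefl less_le_trans not_less zero_less_one)
  then show ?thesis by simp
next
  case True
  define A where "A = osc_set f p q \<inter> ball 0 N"
  have A[measurable]: "A \<in> sets borel" unfolding A_def using osc_set_borel[OF cont] by auto
  have Afin: "emeasure lborel A < \<infinity>"
    unfolding A_def by (rule order.strict_trans1[OF emeasure_mono emeasure_lborel_ball_finite]) auto
  \<comment> \<open>The Stieltjes measure of \<open>f\<close>; continuity of \<open>f\<close>
    excludes atoms, so closed segments carry exactly the increase of \<open>f\<close>.\<close>
  define \<nu> where "\<nu> = interval_measure f"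
  have \<nu>sets[simp]: "sets \<nu> = sets borel" by (simp add: \<nu>_def)
  have \<nu>: "emeasure \<nu> {a..b} = ennreal (f b - f a)" if "a \<le> b" for a b
  proof -
    have fm: "\<And>x y. x \<le> y \<Longrightarrow> f x \<le> f y" using mono by (auto dest: monoD)
    show ?thesis unfolding \<nu>_def
      by (rule emeasure_interval_measure_Icc[OF that fm cont])
  qed
  have main: "ennreal q * emeasure lborel A \<le> ennreal p * (emeasure lborel A + ennreal e)" if "e > 0" for e
  proof -
    obtain U where U: "open U" "A \<subseteq> U" "emeasure lebesgue (U - A) < ennreal e"
    proof (rule sets_lebesgue_outer_open[of A e])
      show "A \<in> sets lebesgue" using A by (simp add: sets_completionI_sets)
    qed (use \<open>e > 0\<close> in auto)
    have Um: "emeasure lborel U \<le> emeasure lborel A + ennreal e"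
    proof -
      have "emeasure lborel U = emeasure lborel A + emeasure lborel (U - A)"
        using U(1,2) by (subst plus_emeasure) (auto intro!: arg_cong[where f="emeasure lborel"])
      moreover have "emeasure lborel (U - A) \<le> ennreal e"
        using U(1,3) by (simp add: emeasure_completion)
      ultimately show ?thesis by (simp add: add_left_mono)
    qed
    define seg where "seg = (\<lambda>(x::real,h). cball (x + h / 2) (\<bar>h\<bar> / 2))"
    have seg: "seg (x,h) = {min x (x + h)..max x (x + h)}" for x h
      unfolding seg_def using cball_segment by simp
    define K1 where "K1 = {(x,h). h \<noteq> 0 \<and> seg (x,h) \<subseteq> U \<and> dquot f h x < p}"
    obtain C1 where C1: "countable C1" "C1 \<subseteq> K1"
       "pairwise (\<lambda>i j. disjnt (seg i) (seg j)) C1" "negligible (A - (\<Union>i \<in> C1. seg i))"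
    proof (rule Vitali_covering_theorem_cballs[of K1 "\<lambda>(x,h). \<bar>h\<bar> / 2" A "\<lambda>(x,h). x + h / 2"])
      show "0 < (case i of (x,h) \<Rightarrow> \<bar>h\<bar> / 2)" if "i \<in> K1" for i using that by (auto simp: K1_def)
      show "\<exists>i. i \<in> K1 \<and> x \<in> cball (case i of (x, h) \<Rightarrow> x + h / 2) (case i of (x, h) \<Rightarrow> \<bar>h\<bar> / 2)
             \<and> (case i of (x, h) \<Rightarrow> \<bar>h\<bar> / 2) < d" if x: "x \<in> A" and d: "0 < d" for x d
      proof -
        obtain r where r: "r > 0" "cball x r \<subseteq> U" using U(1,2) x by (meson open_contains_cball subsetD)
        obtain h where h: "0 < \<bar>h\<bar>" "\<bar>h\<bar> < min r d" "dquot f h x < p"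
          using osc_setD(1)[of x f p q "min r d"] x r d unfolding A_def by auto
        have "seg (x,h) \<subseteq> cball x r" unfolding seg using h by (auto simp: dist_real_def)
        then have "(x,h) \<in> K1" using r h unfolding K1_def by auto
        moreover have "x \<in> seg (x,h)" unfolding seg by auto
        ultimately show ?thesis using h unfolding seg_def by (intro exI[of _ "(x,h)"]) auto
      qed
    qed (auto simp: seg_def case_prod_unfold)
    \<comment> \<open>Only interiors are kept, so that the second covering can again be taken inside
      an open set; the endpoints lost are countably many.\<close>
    define V where "V = (\<Union>i\<in>C1. interior (seg i))"
    have V: "open V" unfolding V_def by auto
    define K2 where "K2 = {(x,h). h \<noteq> 0 \<and> seg (x,h) \<subseteq> V \<and> q < dquot f h x}"
    obtain C2 where C2: "countable C2" "C2 \<subseteq> K2"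
       "pairwise (\<lambda>i j. disjnt (seg i) (seg j)) C2" "negligible (A \<inter> V - (\<Union>i \<in> C2. seg i))"
    proof (rule Vitali_covering_theorem_cballs[of K2 "\<lambda>(x,h). \<bar>h\<bar> / 2" "A \<inter> V" "\<lambda>(x,h). x + h / 2"])
      show "0 < (case i of (x,h) \<Rightarrow> \<bar>h\<bar> / 2)" if "i \<in> K2" for i using that by (auto simp: K2_def)
      show "\<exists>i. i \<in> K2 \<and> x \<in> cball (case i of (x, h) \<Rightarrow> x + h / 2) (case i of (x, h) \<Rightarrow> \<bar>h\<bar> / 2)
             \<and> (case i of (x, h) \<Rightarrow> \<bar>h\<bar> / 2) < d" if x: "x \<in> A \<inter> V" and d: "0 < d" for x d
      proof -
        obtain r where r: "r > 0" "cball x r \<subseteq> V" using V x by (meson IntD2 open_contains_cball)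
        obtain h where h: "0 < \<bar>h\<bar>" "\<bar>h\<bar> < min r d" "q < dquot f h x"
          using osc_setD(2)[of x f p q "min r d"] x r d unfolding A_def by auto
        have "seg (x,h) \<subseteq> cball x r" unfolding seg using h by (auto simp: dist_real_def)
        then have "(x,h) \<in> K2" using r h unfolding K2_def by auto
        moreover have "x \<in> seg (x,h)" unfolding seg by auto
        ultimately show ?thesis using h unfolding seg_def by (intro exI[of _ "(x,h)"]) auto
      qed
    qed (auto simp: seg_def case_prod_unfold)
    have sm[simp]: "seg i \<in> sets borel" for i by (cases i) (simp add: seg)
    have disj: "disjoint_family_on seg C1" "disjoint_family_on seg C2"
      using C1(3) C2(3) by (auto simp: disjoint_family_on_def pairwise_def disjnt_def)
    have segl: "emeasure lborel (seg (x,h)) = ennreal \<bar>h\<bar>" for x h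
      unfolding seg by (simp add: min_def max_def)
    have seg\<nu>: "emeasure \<nu> (seg (x,h)) = ennreal (dquot f h x * \<bar>h\<bar>)" if "h \<noteq> 0" for x h
      unfolding seg using dquot_cball[OF that, of f x] by (subst \<nu>) auto
    have "negligible (A - (\<Union>i\<in>C2. seg i))"
    proof (rule negligible_subset)
      show "negligible ((A - (\<Union>i \<in> C1. seg i)) \<union> (A \<inter> V - (\<Union>i \<in> C2. seg i)) \<union> (\<Union>i\<in>C1. frontier (seg i)))"
        using C1(1) by (intro negligible_Un C1(4) C2(4) negligible_countable_Union)
          (auto simp: seg_def intro!: negligible_convex_frontier)
      show "A - (\<Union>i\<in>C2. seg i) \<subseteq> (A - (\<Union>i \<in> C1. seg i)) \<union> (A \<inter> V - (\<Union>i \<in> C2. seg i)) \<union> (\<Union>i\<in>C1. frontier (seg i))"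
        unfolding V_def frontier_def by (auto dest: closure_subset[THEN subsetD])
    qed
    moreover have "A - (\<Union>i\<in>C2. seg i) \<in> sets lborel"
      using C2(1) A by (auto intro!: sets.countable_UN' sets.Diff)
    ultimately have n2: "A - (\<Union>i\<in>C2. seg i) \<in> null_sets lborel"
      by (simp add: negligible_iff_null_sets null_sets_completion_iff)
    have "ennreal q * emeasure lborel A \<le> ennreal q * emeasure lborel (\<Union>i\<in>C2. seg i)"
    proof (rule mult_left_mono)
      have "emeasure lborel A \<le> emeasure lborel ((\<Union>i\<in>C2. seg i) \<union> (A - (\<Union>i\<in>C2. seg i)))"
        using C2(1) by (intro emeasure_mono) (auto intro!: sets.countable_UN')
      also have "\<dots> = emeasure lborel (\<Union>i\<in>C2. seg i)"
        using C2(1) by (intro emeasure_Un_null_set n2) (auto intro!: sets.countable_UN')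
      finally show "emeasure lborel A \<le> emeasure lborel (\<Union>i\<in>C2. seg i)" .
    qed simp
    also have "\<dots> = (\<integral>\<^sup>+i. ennreal q * emeasure lborel (seg i) \<partial>count_space C2)"
      using C2(1) disj(2) by (subst emeasure_UN_countable) (auto simp: nn_integral_cmult)
    also have "\<dots> \<le> (\<integral>\<^sup>+i. emeasure \<nu> (seg i) \<partial>count_space C2)"
    proof (intro nn_integral_mono)
      fix i assume "i \<in> space (count_space C2)"
      then obtain x h where "i = (x,h)" "h \<noteq> 0" "q < dquot f h x" using C2(2) unfolding K2_def by auto
      then show "ennreal q * emeasure lborel (seg i) \<le> emeasure \<nu> (seg i)"
        using True pq by (simp add: segl seg\<nu> ennreal_mult[symmetric] ennreal_leI mult_right_mono)
    qed
    also have "\<dots> = emeasure \<nu> (\<Union>i\<in>C2. seg i)"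
      using C2(1) disj(2) by (subst emeasure_UN_countable) auto
    also have "\<dots> \<le> emeasure \<nu> (\<Union>i\<in>C1. seg i)"
    proof (rule emeasure_mono)
      show "(\<Union>i\<in>C2. seg i) \<subseteq> (\<Union>i\<in>C1. seg i)"
      proof (rule UN_least)
        fix i assume "i \<in> C2"
        then have "seg i \<subseteq> V" using C2(2) unfolding K2_def by blast
        also have "V \<subseteq> (\<Union>i\<in>C1. seg i)" unfolding V_def by (intro UN_mono interior_subset order_refl)
        finally show "seg i \<subseteq> (\<Union>i\<in>C1. seg i)" .
      qed
    qed (use C1(1) in \<open>auto intro!: sets.countable_UN'\<close>)
    also have "\<dots> = (\<integral>\<^sup>+i. emeasure \<nu> (seg i) \<partial>count_space C1)"
      using C1(1) disj(1) by (subst emeasure_UN_countable) auto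
    also have "\<dots> \<le> (\<integral>\<^sup>+i. ennreal p * emeasure lborel (seg i) \<partial>count_space C1)"
    proof (intro nn_integral_mono)
      fix i assume "i \<in> space (count_space C1)"
      then obtain x h where "i = (x,h)" "h \<noteq> 0" "dquot f h x < p" using C1(2) unfolding K1_def by auto
      then show "emeasure \<nu> (seg i) \<le> ennreal p * emeasure lborel (seg i)"
        using True by (simp add: segl seg\<nu> ennreal_mult[symmetric] ennreal_leI mult_right_mono)
    qed
    also have "\<dots> = ennreal p * emeasure lborel (\<Union>i\<in>C1. seg i)"
      using C1(1) disj(1) by (subst emeasure_UN_countable) (auto simp: nn_integral_cmult)
    also have "\<dots> \<le> ennreal p * emeasure lborel U"
      using C1(2) U(1) unfolding K1_def by (intro mult_left_mono emeasure_mono) auto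
    also have "\<dots> \<le> ennreal p * (emeasure lborel A + ennreal e)"
      using Um by (intro mult_left_mono) auto
    finally show ?thesis .
  qed
  define m where "m = measure lborel A"
  have mA: "emeasure lborel A = ennreal m" using Afin unfolding m_def
    by (simp add: emeasure_eq_ennreal_measure less_top)
  have m0: "0 \<le> m" by (simp add: m_def)
  have "q * m \<le> p * (m + e)" if "e > 0" for e
    using main[OF that] that True pq m0 by (simp add: mA ennreal_mult[symmetric] ennreal_plus[symmetric] del: ennreal_plus)
  note qm = this
  have "(q - p) * m \<le> 0 + e" if "e > 0" for e
  proof -
    have "q * m \<le> p * (m + e / p)" using that True by (intro qm) auto
    also have "\<dots> = p * m + e" using True by (simp add: distrib_left)
    finally show ?thesis by (simp add: left_diff_distrib)
  qed
  then have "(q - p) * m \<le> 0" by (rule field_le_epsilon)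
  with pq m0 have "m = 0" by (simp add: mult_le_0_iff)
  with mA show ?thesis unfolding A_def[symmetric] by (auto intro: null_setsI)
qed

text \<open>Adding \<open>L * x\<close> makes the function monotone without changing
  differentiability. The exceptional set is then a countable union of null sets, over rational pairs
  \<open>p < q\<close> and balls that ensure finite measure.\<close>

lemma lipschitz_AE_differentiable:
  fixes f :: "real \<Rightarrow> real"
  assumes L: "L-lipschitz_on UNIV f"
  shows "AE x in lborel. f differentiable (at x)"
proof -
  define F where "F = (\<lambda>x. f x + L * x)"
  have FL: "(L + \<bar>L\<bar>)-lipschitz_on UNIV F"
    unfolding F_def by (intro lipschitz_on_add[OF L]) (auto intro!: lipschitz_onI simp: dist_real_def abs_mult right_diff_distrib[symmetric])
  have Fm: "mono F"
  proof (rule monoI)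
    fix x y :: real assume "x \<le> y"
    then show "F x \<le> F y" using lipschitz_onD[OF L, of x y] by (auto simp: F_def dist_real_def abs_if algebra_simps split: if_splits)
  qed
  have Fc: "continuous_on UNIV F" using FL by (rule lipschitz_on_continuous_on)
  define I where "I = {(p,q). p \<in> \<rat> \<and> q \<in> \<rat> \<and> p < (q::real)}"
  have "countable I" by (rule countable_subset[of _ "\<rat> \<times> \<rat>"]) (auto simp: I_def countable_rat)
  then have "(\<Union>n::nat. \<Union>i\<in>I. osc_set F (fst i) (snd i) \<inter> ball 0 (real n)) \<in> null_sets lborel"
    by (intro null_sets_UN null_sets_UN') (auto simp: I_def intro!: osc_set_null Fm Fc)
  then have "AE x in lborel. x \<notin> (\<Union>n::nat. \<Union>i\<in>I. osc_set F (fst i) (snd i) \<inter> ball 0 (real n))"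
    by (rule AE_not_in)
  then show ?thesis
  proof eventually_elim
    fix x assume x: "x \<notin> (\<Union>n::nat. \<Union>i\<in>I. osc_set F (fst i) (snd i) \<inter> ball 0 (real n))"
    obtain n :: nat where "\<bar>x\<bar> < n" using reals_Archimedean2 by blast
    then have "x \<in> ball 0 (real n)" by (simp add: dist_real_def)
    then have "x \<notin> osc_set F p q" if "p \<in> \<rat>" "q \<in> \<rat>" "p < q" for p q
      using x that unfolding I_def by fastforce
    then have "F differentiable (at x)" by (rule differentiable_osc_set[OF _ FL])
    then have "(\<lambda>x. F x - L * x) differentiable (at x)"
      by (intro derivative_intros) auto
    then show "f differentiable (at x)" by (simp add: F_def)
  qed
qed


text \<open>This rests on the fundamental theorem for Lipschitz functions: difference quotients are
  integrated over \<open>{a..b}\<close>; their limit is bounded by \<open>c\<close> almost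
  everywhere, while the integrals reduce to averages of \<open>f\<close> near the two endpoints. It
  turns the bound on \<zeta>' in (A1) into a Lipschitz constant.\<close>

lemma lipschitz_deriv_bound:
  fixes f :: "real \<Rightarrow> real"
  assumes L: "L-lipschitz_on UNIV f"
    and D: "\<And>x. f differentiable (at x) \<Longrightarrow> \<bar>deriv f x\<bar> \<le> c"
  shows "\<bar>f y - f x\<bar> \<le> c * \<bar>y - x\<bar>"
proof -
  have cont: "continuous_on UNIV f" using L by (rule lipschitz_on_continuous_on)
  have c0: "0 \<le> c"
  proof -
    have "\<not> (AE x in lborel. False :: bool)" using emeasure_lborel_UNIV by (simp add: AE_iff_measurable[OF _ refl])
    then obtain x where "f differentiable (at x)" using lipschitz_AE_differentiable[OF L] by (metis (mono_tags, lifting) eventually_mono)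
    with D[of x] show ?thesis by (meson abs_ge_zero order_trans)
  qed
  have key: "\<bar>f b - f a\<bar> \<le> c * (b - a)" if ab: "a \<le> b" for a b
  proof -
    define q where "q = (\<lambda>n x. dquot f (1 / Suc n) x)"
    have qc: "continuous_on UNIV (q n)" for n unfolding q_def by (rule continuous_dquot[OF cont])
    have qL: "\<bar>q n x\<bar> \<le> L" for n x
      unfolding q_def by (rule dquot_lipschitz[OF L])
    have [measurable]: "q n \<in> borel_measurable borel" for n
      by (rule borel_measurable_continuous_onI[OF qc])
    have AEd: "AE x in lborel. (\<lambda>n. q n x) \<longlonglongrightarrow> deriv f x \<and> \<bar>deriv f x\<bar> \<le> c"
      using lipschitz_AE_differentiable[OF L]
    proof eventually_elim
      fix x assume d: "f differentiable (at x)"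
      then have "(\<lambda>n. q n x) \<longlonglongrightarrow> deriv f x"
        unfolding q_def by (rule dquot_tendsto_deriv)
      with D[OF d] show "(\<lambda>n. q n x) \<longlonglongrightarrow> deriv f x \<and> \<bar>deriv f x\<bar> \<le> c" by simp
    qed
    \<comment> \<open>A \<open>lim\<close> of Borel functions is Borel, so the integrals below make
      sense without knowing that \<open>deriv f\<close> is measurable.\<close>
    define g where "g = (\<lambda>x. lim (\<lambda>n. q n x))"
    have [measurable]: "g \<in> borel_measurable borel" unfolding g_def by measurable
    have AEg: "AE x in lborel. (\<lambda>n. q n x) \<longlonglongrightarrow> g x \<and> \<bar>g x\<bar> \<le> c"
      using AEd by eventually_elim (auto simp: g_def limI)
    have lim1: "(\<lambda>n. LBINT x:{a..b}. q n x) \<longlonglongrightarrow> (LBINT x:{a..b}. g x)"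
      unfolding set_lebesgue_integral_def
    proof (rule integral_dominated_convergence[where w="\<lambda>x. indicator {a..b} x * L"])
      show "AE x in lborel. (\<lambda>n. indicator {a..b} x *\<^sub>R q n x) \<longlonglongrightarrow> indicator {a..b} x *\<^sub>R g x"
        using AEg by eventually_elim (auto intro!: tendsto_intros)
      show "integrable lborel (\<lambda>x. indicator {a..b} x * L)"
        by (intro integrable_mult_left integrable_real_indicator) (auto simp: emeasure_lborel_Icc_eq)
    qed (use qL in \<open>auto simp: indicator_def\<close>)
    have "\<bar>LBINT x:{a..b}. g x\<bar> \<le> (LBINT x:{a..b}. c)"
      unfolding set_lebesgue_integral_def
    proof (rule integral_abs_bound[THEN order_trans], rule integral_mono_AE)
      show ic: "integrable lborel (\<lambda>x. indicat_real {a..b} x *\<^sub>R c)"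
        by (intro integrable_scaleR_left integrable_real_indicator) (auto simp: emeasure_lborel_Icc_eq)
      show "integrable lborel (\<lambda>x. \<bar>indicat_real {a..b} x *\<^sub>R g x\<bar>)"
      proof (rule Bochner_Integration.integrable_bound[OF ic])
        show "AE x in lborel. norm \<bar>indicat_real {a..b} x *\<^sub>R g x\<bar> \<le> norm (indicat_real {a..b} x *\<^sub>R c)"
          using AEg by eventually_elim (auto simp: indicator_def)
      qed measurable
      show "AE x in lborel. \<bar>indicat_real {a..b} x *\<^sub>R g x\<bar> \<le> indicat_real {a..b} x *\<^sub>R c"
        using AEg by eventually_elim (auto simp: indicator_def)
    qed
    also have "\<dots> = c * (b - a)" using ab by (simp add: set_lebesgue_integral_def)
    finally have gb: "\<bar>LBINT x:{a..b}. g x\<bar> \<le> c * (b - a)" .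
    have fint: "f integrable_on {u..v}" for u v
      by (intro integrable_continuous_real continuous_on_subset[OF cont]) auto
    \<comment> \<open>After the shift the two integrals of \<open>f\<close> overlap; cancelling the
      overlap leaves two short integrals at the ends of \<open>{a..b}\<close>.\<close>
    have qi: "(LBINT x:{a..b}. q n x) = Suc n * (integral {b..b + 1 / Suc n} f - integral {a..a + 1 / Suc n} f)" for n
    proof -
      let ?h = "1 / real (Suc n)"
      have sh: "integral {a..b} (\<lambda>x. f (x + ?h)) = integral {a + ?h..b + ?h} f"
        using integral_shift_Icc_real[of a b f ?h] by (simp add: o_def add.commute)
      have "(LBINT x:{a..b}. q n x) = integral {a..b} (q n)"
        by (rule set_borel_integral_eq_integral(2)) (auto intro!: borel_integrable_atLeastAtMost' continuous_on_subset[OF qc])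
      also have "\<dots> = Suc n * (integral {a..b} (\<lambda>x. f (x + ?h)) - integral {a..b} f)"
      proof (rule integral_unique)
        have "((\<lambda>x. Suc n * (f (x + ?h) - f x)) has_integral
            Suc n * (integral {a..b} (\<lambda>x. f (x + ?h)) - integral {a..b} f)) {a..b}"
          by (intro has_integral_mult_right has_integral_diff integrable_integral integrable_continuous_real
              continuous_intros continuous_on_compose2[OF cont] fint) auto
        then show "(q n has_integral Suc n * (integral {a..b} (\<lambda>x. f (x + ?h)) - integral {a..b} f)) {a..b}"
          by (rule has_integral_eq[rotated]) (simp add: q_def dquot_def del: of_nat_Suc)
      qed
      finally have q1: "(LBINT x:{a..b}. q n x) = Suc n * (integral {a..b} (\<lambda>x. f (x + ?h)) - integral {a..b} f)" .
      have comb: "integral {a + ?h..b + ?h} f = integral {a..b} f + integral {b..b + ?h} f - integral {a..a + ?h} f"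
      proof -
        have "integral {a..a + ?h} f + integral {a + ?h..b + ?h} f = integral {a..b + ?h} f"
          using ab by (intro Henstock_Kurzweil_Integration.integral_combine fint) auto
        moreover have "integral {a..b} f + integral {b..b + ?h} f = integral {a..b + ?h} f"
          using ab by (intro Henstock_Kurzweil_Integration.integral_combine fint) auto
        ultimately show ?thesis by linarith
      qed
      show ?thesis using q1 comb unfolding sh by simp
    qed
    have avg: "(\<lambda>n. Suc n * integral {u..u + 1 / Suc n} f) \<longlonglongrightarrow> f u" for u
    proof (rule LIMSEQ_I)
      fix e :: real assume "e > 0"
      have "(\<lambda>n. \<bar>L\<bar> / Suc n) \<longlonglongrightarrow> 0"
        using tendsto_mult_right_zero[OF LIMSEQ_inverse_real_of_nat, of "\<bar>L\<bar>"] by (simp add: divide_inverse)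
      then obtain N where N: "\<And>n. n \<ge> N \<Longrightarrow> \<bar>L\<bar> / Suc n < e"
        using LIMSEQ_D[OF _ \<open>e > 0\<close>, of "\<lambda>n. \<bar>L\<bar> / Suc n" 0] by auto
      show "\<exists>no. \<forall>n\<ge>no. norm (Suc n * integral {u..u + 1 / Suc n} f - f u) < e"
      proof (intro exI allI impI)
        fix n assume n: "N \<le> n"
        let ?h = "1 / real (Suc n)"
        have "norm (integral {u..u + ?h} (\<lambda>x. f x - f u)) \<le> integral {u..u + ?h} (\<lambda>x. \<bar>L\<bar> * ?h)"
        proof (rule Henstock_Kurzweil_Integration.integral_norm_bound_integral)
          show "norm (f x - f u) \<le> \<bar>L\<bar> * ?h" if "x \<in> {u..u + ?h}" for x
          proof -
            have "\<bar>f x - f u\<bar> \<le> L * \<bar>x - u\<bar>" using lipschitz_onD[OF L, of x u] by (simp add: dist_real_def)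
            also have "\<dots> \<le> \<bar>L\<bar> * ?h" using that by (intro mult_mono) auto
            finally show ?thesis by simp
          qed
        qed (auto intro!: integrable_continuous_real continuous_intros continuous_on_subset[OF cont])
        also have "\<dots> = \<bar>L\<bar> * ?h * ?h" by simp
        also have "integral {u..u + ?h} (\<lambda>x. f x - f u) = integral {u..u + ?h} f - ?h * f u"
          by (subst Henstock_Kurzweil_Integration.integral_diff) (auto intro!: fint)
        finally have "Suc n * norm (integral {u..u + ?h} f - ?h * f u) \<le> Suc n * (\<bar>L\<bar> * ?h * ?h)"
          by (intro mult_left_mono) auto
        then have "\<bar>Suc n * (integral {u..u + ?h} f - ?h * f u)\<bar> \<le> \<bar>L\<bar> * ?h"
          by (simp add: abs_mult del: of_nat_Suc)
        moreover have "Suc n * (integral {u..u + ?h} f - ?h * f u) = Suc n * integral {u..u + ?h} f - f u"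
          by (simp add: right_diff_distrib del: of_nat_Suc)
        ultimately show "norm (Suc n * integral {u..u + ?h} f - f u) < e" using N[OF n] by simp
      qed
    qed
    have "(\<lambda>n. LBINT x:{a..b}. q n x) \<longlonglongrightarrow> f b - f a"
      unfolding qi right_diff_distrib by (intro tendsto_diff avg)
    then have "(LBINT x:{a..b}. g x) = f b - f a" using lim1 LIMSEQ_unique by blast
    with gb show ?thesis by simp
  qed
  show ?thesis using key[of x y] key[of y x] by (cases "x \<le> y") auto
qed

text \<open>
  Where \<open>f\<close> is not differentiable, \<open>deriv f\<close> is an arbitrary value; this happens only on a null set.
\<close>

lemma lipschitz_deriv_borel:
  fixes f :: "real \<Rightarrow> real"
  assumes L: "L-lipschitz_on {a<..<b} f"
  obtains D where "D \<in> borel_measurable borel" "\<And>x. \<bar>D x\<bar> \<le> L"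
    "AE x in lborel. x \<in> {a<..<b} \<longrightarrow> D x = deriv f x"
proof (cases "a < b")
  case False
  then show ?thesis using lipschitz_on_nonneg[OF L] by (intro that[of "\<lambda>_. 0"]) auto
next
  case ab: True
  obtain F where F: "L-lipschitz_on {a..b} F" "\<And>x. x \<in> {a<..<b} \<Longrightarrow> F x = f x"
    using lipschitz_extend_closure[OF L] ab by auto
  \<comment> \<open>Constant continuation beyond the endpoints gives a Lipschitz function on the
    whole line whose derivative inside the interval is that of \<open>f\<close>.\<close>
  define H where "H = (\<lambda>x. F (max a (min b x)))"
  have H: "L-lipschitz_on UNIV H"
  proof (rule lipschitz_onI)
    fix x y :: real
    have "dist (H x) (H y) \<le> L * dist (max a (min b x)) (max a (min b y))"
      unfolding H_def using ab by (intro lipschitz_onD[OF F(1)]) auto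
    also have "\<dots> \<le> L * dist x y"
      using lipschitz_on_nonneg[OF L] by (intro mult_left_mono) (auto simp: dist_real_def max_def min_def)
    finally show "dist (H x) (H y) \<le> L * dist x y" .
  qed (rule lipschitz_on_nonneg[OF L])
  have Hf: "deriv H x = deriv f x" if "x \<in> {a<..<b}" for x
  proof (rule deriv_cong_ev)
    have "\<forall>\<^sub>F y in nhds x. y \<in> {a<..<b}" using that by (intro eventually_nhds_in_open) auto
    then show "\<forall>\<^sub>F y in nhds x. H y = f y"
      by eventually_elim (auto simp: H_def F(2) max_def min_def)
  qed simp
  define q where "q = (\<lambda>n x. dquot H (1 / Suc n) x)"
  have [measurable]: "q n \<in> borel_measurable borel" for n
    unfolding q_def by (intro borel_measurable_continuous_onI continuous_dquot lipschitz_on_continuous_on[OF H])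
  have qL: "\<bar>q n x\<bar> \<le> L" for n x
    unfolding q_def by (rule dquot_lipschitz[OF H])
  \<comment> \<open>The outer clamp keeps the bound \<open>L\<close> at points where the sequence
    has no limit and \<open>lim\<close> is an arbitrary value.\<close>
  define D where "D = (\<lambda>x. max (- L) (min L (lim (\<lambda>n. q n x))))"
  show ?thesis
  proof
    show "D \<in> borel_measurable borel" unfolding D_def by measurable
    show "\<bar>D x\<bar> \<le> L" for x using lipschitz_on_nonneg[OF L] by (auto simp: D_def)
    show "AE x in lborel. x \<in> {a<..<b} \<longrightarrow> D x = deriv f x"
      using lipschitz_AE_differentiable[OF H]
    proof eventually_elim
      fix x assume d: "H differentiable (at x)"
      then have lim: "(\<lambda>n. q n x) \<longlonglongrightarrow> deriv H x"
        unfolding q_def by (rule dquot_tendsto_deriv)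
      have "\<bar>deriv H x\<bar> \<le> L"
        by (rule LIMSEQ_le_const2[OF tendsto_rabs[OF lim]]) (use qL in auto)
      then show "x \<in> {a<..<b} \<longrightarrow> D x = deriv f x"
        using limI[OF lim] Hf[of x] by (auto simp: D_def)
    qed
  qed
qed

section \<open>Volterra equations and translations of integrable functions\<close>

text \<open>For barrier arguments. The set where \<open>u \<le> c\<close> is compact, and its last
  point \<open>s\<close> lies before \<open>b\<close>; beyond it \<open>u\<close> exceeds
  \<open>c\<close>, so continuity from the right forces \<open>u s = c\<close>.\<close>

lemma last_passage:
  fixes u :: "real \<Rightarrow> real"
  assumes "continuous_on {a..b} u" "u a \<le> c" "c < u b" "a \<le> b"
  obtains s where "a \<le> s" "s < b" "u s = c" "\<And>t. s < t \<Longrightarrow> t \<le> b \<Longrightarrow> c < u t"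
proof -
  let ?S = "{t \<in> {a..b}. u t \<in> {..c}}"
  have "closed ?S"
    using continuous_closed_preimage[OF assms(1), of "{..c}"] by (simp add: vimage_def Int_def conj_commute)
  then have "compact ({a..b} \<inter> ?S)" by (intro compact_Int_closed) auto
  moreover have "{a..b} \<inter> ?S = ?S" by auto
  ultimately have "compact ?S" by simp
  moreover have "?S \<noteq> {}" using assms by force
  ultimately obtain s where s: "s \<in> ?S" "\<And>t. t \<in> ?S \<Longrightarrow> t \<le> s"
    using compact_attains_sup[of ?S] by blast
  have gt: "c < u t" if "s < t" "t \<le> b" for t
    using s(1) s(2)[of t] that by (cases "u t \<le> c") auto
  have sb: "s < b" using s(1) assms(3) by (auto simp: less_le)
  have "u s = c"
  proof (rule antisym)
    show "u s \<le> c" using s by simp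
    have "(u \<longlongrightarrow> u s) (at s within {a..b})"
      using assms(1) s(1) by (auto simp: continuous_on_def)
    then have "(u \<longlongrightarrow> u s) (at s within {s..b})"
      by (rule tendsto_within_subset) (use s(1) in auto)
    then have "(u \<longlongrightarrow> u s) (at_right s)"
      using at_within_Icc_at_right[OF sb] by simp
    moreover have "\<forall>\<^sub>F t in at_right s. c \<le> u t"
      unfolding eventually_at_right[OF sb] using gt sb by (auto intro!: exI[of _ b] less_imp_le)
    ultimately show "c \<le> u s" by (rule tendsto_lowerbound) (simp add: trivial_limit_at_right_real)
  qed
  then show ?thesis using that[of s] s(1) sb gt by auto
qed

text \<open>Over \<open>n\<close> equal pieces the errors sum to
  \<open>C * (b - a)\<^sup>2 / n\<close>, which tends to 0. No derivative of \<open>u\<close> is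
  involved.\<close>

lemma nonincreasing_quadratic_error:
  fixes u :: "real \<Rightarrow> real"
  assumes "a \<le> b" and step: "\<And>s t. a \<le> s \<Longrightarrow> s \<le> t \<Longrightarrow> t \<le> b \<Longrightarrow> u t - u s \<le> C * (t - s)\<^sup>2"
  shows "u b \<le> u a"
proof -
  have bound: "u b - u a \<le> C * (b - a)\<^sup>2 * (1 / Suc n)" for n
  proof -
    define h where "h = (b - a) / Suc n"
    have h0: "0 \<le> h" using assms(1) by (simp add: h_def)
    have hn: "Suc n * h = b - a" by (simp add: h_def del: of_nat_Suc)
    have "u b - u a = (\<Sum>i<Suc n. u (a + real (Suc i) * h) - u (a + real i * h))"
      using sum_lessThan_telescope[of "\<lambda>i. u (a + real i * h)" "Suc n"] hn by (simp del: of_nat_Suc)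
    also have "\<dots> \<le> (\<Sum>i<Suc n. C * h\<^sup>2)"
    proof (rule sum_mono)
      fix i assume "i \<in> {..<Suc n}"
      then have "real (Suc i) * h \<le> Suc n * h" using h0 by (intro mult_right_mono) auto
      then have "a + real (Suc i) * h \<le> b" unfolding hn by simp
      then have "u (a + real (Suc i) * h) - u (a + real i * h)
          \<le> C * ((a + real (Suc i) * h) - (a + real i * h))\<^sup>2"
        using h0 by (intro step) (auto intro: mult_right_mono)
      then show "u (a + real (Suc i) * h) - u (a + real i * h) \<le> C * h\<^sup>2" by (simp add: algebra_simps)
    qed
    also have "\<dots> = C * (b - a)\<^sup>2 * (1 / Suc n)"
      by (simp add: h_def power2_eq_square del: of_nat_Suc)
    finally show ?thesis .
  qed
  have "(\<lambda>n. C * (b - a)\<^sup>2 * (1 / real (Suc n))) \<longlonglongrightarrow> C * (b - a)\<^sup>2 * 0"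
    using LIMSEQ_inverse_real_of_nat by (intro tendsto_intros) (simp add: inverse_eq_divide)
  then have "u b - u a \<le> C * (b - a)\<^sup>2 * 0"
    by (rule LIMSEQ_le_const) (use bound in blast)
  then show ?thesis by simp
qed

text \<open>By the integral inequality the right-hand side, multiplied by
  \<open>exp (- C * t)\<close>, has nonpositive derivative.\<close>

lemma gronwall:
  fixes u :: "real \<Rightarrow> real"
  assumes cont: "continuous_on {0..T} u" and C: "0 \<le> C"
    and le: "\<And>t. t \<in> {0..T} \<Longrightarrow> u t \<le> A + C * integral {0..t} u"
    and t: "t \<in> {0..T}"
  shows "u t \<le> A * exp (C * t)"
proof -
  define \<phi> where "\<phi> = (\<lambda>x. exp (- C * x) * (A + C * integral {0..x} u))"
  have "\<phi> t \<le> \<phi> 0"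
  proof (rule DERIV_nonpos_imp_decreasing_open[of 0 t \<phi>])
    show "0 \<le> t" using t by simp
    show "continuous_on {0..t} \<phi>" unfolding \<phi>_def
      by (intro continuous_intros indefinite_integral_continuous_1 integrable_continuous_real
          continuous_on_subset[OF cont]) (use t in auto)
    fix x assume x: "0 < x" "x < t"
    have "((\<lambda>x. integral {0..x} u) has_real_derivative u x) (at x within {0..T})"
      using x t by (intro integral_has_real_derivative cont) auto
    then have d: "((\<lambda>x. integral {0..x} u) has_real_derivative u x) (at x)"
      using x t by (subst (asm) at_within_interior) auto
    have "(\<phi> has_real_derivative (- C * exp (- C * x) * (A + C * integral {0..x} u) + exp (- C * x) * (C * u x))) (at x)"
      unfolding \<phi>_def by (auto intro!: derivative_eq_intros d simp: algebra_simps)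
    moreover have "- C * exp (- C * x) * (A + C * integral {0..x} u) + exp (- C * x) * (C * u x)
        = C * exp (- C * x) * (u x - (A + C * integral {0..x} u))" by (simp add: algebra_simps)
    moreover have "\<dots> \<le> 0"
      using le[of x] x t C by (intro mult_nonneg_nonpos mult_nonneg_nonneg) auto
    ultimately show "\<exists>y. (\<phi> has_real_derivative y) (at x) \<and> y \<le> 0" by metis
  qed
  then have "A + C * integral {0..t} u \<le> A * exp (C * t)"
    by (simp add: \<phi>_def exp_minus field_simps)
  with le[OF t] show ?thesis by simp
qed

text \<open>Contraction in the norm weighted by \<open>exp (- k * t)\<close>: integrating
  \<open>exp (k * s)\<close> up to \<open>t\<close> gains a factor \<open>1 / k\<close>, so all of
  \<open>{0..T}\<close> is covered at once.\<close>

lemma volterra_fixed_point: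
  fixes \<Psi> :: "(real \<Rightarrow> 'b::banach) \<Rightarrow> real \<Rightarrow> 'b"
  assumes T: "0 \<le> T"
    and cont: "\<And>u. continuous_on {0..T} u \<Longrightarrow> continuous_on {0..T} (\<Psi> u)"
    and lip: "\<And>u w t. continuous_on {0..T} u \<Longrightarrow> continuous_on {0..T} w \<Longrightarrow> t \<in> {0..T} \<Longrightarrow>
        norm (\<Psi> u t - \<Psi> w t) \<le> C * integral {0..t} (\<lambda>s. norm (u s - w s))"
  obtains u where "continuous_on {0..T} u" "\<And>t. t \<in> {0..T} \<Longrightarrow> \<Psi> u t = u t"
proof -
  \<comment> \<open>Any positive \<open>k \<ge> 2 * \<bar>C\<bar>\<close> gives the contraction
    factor 1/2; the summand 1 keeps \<open>k\<close> positive when \<open>C = 0\<close>.\<close>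
  define k where "k = 2 * \<bar>C\<bar> + 1"
  have k: "0 < k" "2 * \<bar>C\<bar> \<le> k" by (auto simp: k_def)
  \<comment> \<open>Clamping time turns continuous functions on the interval into bounded continuous
    functions on the line, which form a complete space.\<close>
  define cl where "cl = (\<lambda>t::real. max 0 (min T t))"
  have cl: "cl t \<in> {0..T}" for t using T by (auto simp: cl_def)
  have cl_id: "cl t = t" if "t \<in> {0..T}" for t using that by (auto simp: cl_def)
  have cl_cont: "continuous_on UNIV cl" unfolding cl_def by (intro continuous_intros)
  define up where "up = (\<lambda>(w::real \<Rightarrow>\<^sub>C 'b) s. exp (k * s) *\<^sub>R apply_bcontfun w s)"
  have up_cont: "continuous_on S (up w)" for w S unfolding up_def by (intro continuous_intros) simp
  define down where "down = (\<lambda>u t. exp (- k * cl t) *\<^sub>R \<Psi> u (cl t))"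
  have down_bc: "down u \<in> bcontfun" if "continuous_on {0..T} u" for u
  proof -
    have c: "continuous_on {0..T} (\<lambda>t. exp (- k * t) *\<^sub>R \<Psi> u t)"
      by (intro continuous_intros cont that)
    then have "bounded ((\<lambda>t. exp (- k * t) *\<^sub>R \<Psi> u t) ` {0..T})"
      by (intro compact_imp_bounded compact_continuous_image) auto
    then have "bounded (range (down u))"
      by (rule bounded_subset) (use cl in \<open>auto simp: down_def\<close>)
    moreover have "continuous_on UNIV (down u)"
      unfolding down_def using cl by (intro continuous_on_compose2[OF c cl_cont]) auto
    ultimately show ?thesis by (simp add: bcontfun_def)
  qed
  define \<Theta> where "\<Theta> = (\<lambda>w. Bcontfun (down (up w)))"
  have \<Theta>: "apply_bcontfun (\<Theta> w) = down (up w)" for w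
    unfolding \<Theta>_def by (rule Bcontfun_inverse[OF down_bc[OF up_cont]])
  have contr: "dist (\<Theta> v) (\<Theta> w) \<le> 1 / 2 * dist v w" for v w
  proof (rule dist_bound)
    fix t
    define x where "x = cl t"
    have x: "x \<in> {0..T}" unfolding x_def by (rule cl)
    have ex: "((\<lambda>s. exp (k * s)) has_integral (exp (k * x) / k - exp (k * 0) / k)) {0..x}"
      using x k by (intro fundamental_theorem_of_calculus)
        (auto intro!: derivative_eq_intros simp: has_real_derivative_iff_has_vector_derivative[symmetric])
    have "integral {0..x} (\<lambda>s. norm (up v s - up w s)) \<le> integral {0..x} (\<lambda>s. dist v w * exp (k * s))"
    proof (rule integral_le)
      show "(\<lambda>s. norm (up v s - up w s)) integrable_on {0..x}"
        by (intro integrable_continuous_real continuous_intros up_cont)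
      show "(\<lambda>s. dist v w * exp (k * s)) integrable_on {0..x}"
        by (intro integrable_continuous_real continuous_intros)
      fix s
      have "norm (up v s - up w s) = exp (k * s) * dist (apply_bcontfun v s) (apply_bcontfun w s)"
        unfolding up_def by (simp add: scaleR_diff_right[symmetric] dist_norm)
      also have "\<dots> \<le> exp (k * s) * dist v w" by (intro mult_left_mono dist_bounded) auto
      finally show "norm (up v s - up w s) \<le> dist v w * exp (k * s)" by (simp add: mult.commute)
    qed
    also have "\<dots> = dist v w * ((exp (k * x) - 1) / k)"
      using integral_unique[OF has_integral_mult_right[OF ex, of "dist v w"]] by (simp add: diff_divide_distrib)
    also have "\<dots> \<le> dist v w * (exp (k * x) / k)"
      using k by (intro mult_left_mono divide_right_mono) auto
    finally have I: "integral {0..x} (\<lambda>s. norm (up v s - up w s)) \<le> dist v w * (exp (k * x) / k)" .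
    have I0: "0 \<le> integral {0..x} (\<lambda>s. norm (up v s - up w s))"
      by (rule integral_nonneg) (auto intro!: integrable_continuous_real continuous_intros up_cont)
    have "dist (down (up v) t) (down (up w) t) = exp (- k * x) * norm (\<Psi> (up v) x - \<Psi> (up w) x)"
      unfolding down_def x_def by (simp add: scaleR_diff_right[symmetric] dist_norm)
    also have "\<dots> \<le> exp (- k * x) * (C * integral {0..x} (\<lambda>s. norm (up v s - up w s)))"
      by (intro mult_left_mono lip up_cont x) auto
    also have "\<dots> \<le> exp (- k * x) * (\<bar>C\<bar> * (dist v w * (exp (k * x) / k)))"
      using I I0 by (intro mult_left_mono mult_mono) auto
    also have "\<dots> = \<bar>C\<bar> / k * dist v w" by (simp add: exp_minus field_simps)
    also have "\<dots> \<le> 1 / 2 * dist v w" using k by (intro mult_right_mono) (auto simp: field_simps)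
    finally show "dist (apply_bcontfun (\<Theta> v) t) (apply_bcontfun (\<Theta> w) t) \<le> 1 / 2 * dist v w"
      unfolding \<Theta> .
  qed
  obtain w where w: "\<Theta> w = w"
    using banach_fix_type[of "1/2" \<Theta>] contr by auto
  show ?thesis
  proof
    show "continuous_on {0..T} (up w)" by (rule up_cont)
    fix t assume t: "t \<in> {0..T}"
    have "apply_bcontfun w t = exp (- k * t) *\<^sub>R \<Psi> (up w) t"
      using \<Theta>[of w] t unfolding w down_def by (simp add: cl_id)
    then show "\<Psi> (up w) t = up w t" by (simp add: up_def exp_minus)
  qed
qed

text \<open>A majorant of product form settles the integrability of all sections and of the pair at
  once; exchanging label and time then reduces to measurability and a pointwise bound.\<close>

lemma Fubini_product_bound:
  fixes f :: "real \<Rightarrow> real \<Rightarrow> real"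
  assumes [measurable]: "case_prod f \<in> borel_measurable (borel \<Otimes>\<^sub>M borel)"
    and B: "integrable lborel B" and C: "integrable lborel C"
    and bd: "\<And>x y. \<bar>f x y\<bar> \<le> B x * C y"
  shows "integrable lborel (\<lambda>x. \<integral>y. f x y \<partial>lborel)"
    and "(\<integral>x. (\<integral>y. f x y \<partial>lborel) \<partial>lborel) = (\<integral>y. (\<integral>x. f x y \<partial>lborel) \<partial>lborel)"
proof -
  have [measurable]: "B \<in> borel_measurable borel" "C \<in> borel_measurable borel"
    using B C by (auto dest: borel_measurable_integrable)
  have iy: "integrable lborel (\<lambda>y. f x y)" for x
    by (rule Bochner_Integration.integrable_bound[OF integrable_mult_right[OF C, of "B x"]])
      (use bd in \<open>auto intro: order_trans[OF _ abs_ge_self]\<close>)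
  have i: "integrable (lborel \<Otimes>\<^sub>M lborel) (case_prod f)"
  proof (rule lborel_pair.Fubini_integrable)
    show "integrable lborel (\<lambda>x. \<integral>y. norm (case (x, y) of (x, y) \<Rightarrow> f x y) \<partial>lborel)"
    proof (rule Bochner_Integration.integrable_bound[OF integrable_mult_left[OF B, of "\<integral>y. C y \<partial>lborel"]])
      show "AE x in lborel. norm (\<integral>y. norm (case (x, y) of (x, y) \<Rightarrow> f x y) \<partial>lborel) \<le> norm (B x * (\<integral>y. C y \<partial>lborel))"
      proof (rule AE_I2)
        fix x
        have "(\<integral>y. \<bar>f x y\<bar> \<partial>lborel) \<le> (\<integral>y. B x * C y \<partial>lborel)"
          by (rule integral_mono) (use iy bd C in auto)
        then show "norm (\<integral>y. norm (case (x, y) of (x, y) \<Rightarrow> f x y) \<partial>lborel) \<le> norm (B x * (\<integral>y. C y \<partial>lborel))"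
          by simp
      qed
    qed measurable
  qed (use iy in auto)
  show "integrable lborel (\<lambda>x. \<integral>y. f x y \<partial>lborel)"
    using lborel_pair.integrable_fst[OF i] .
  show "(\<integral>x. (\<integral>y. f x y \<partial>lborel) \<partial>lborel) = (\<integral>y. (\<integral>x. f x y \<partial>lborel) \<partial>lborel)"
    using lborel_pair.Fubini_integral[OF i] by simp
qed

section \<open>Continuity of translations in the mean\<close>

lemma integrable_translate: "integrable lborel (\<lambda>x::real. f (x + h)) \<longleftrightarrow> integrable lborel f"
  for f :: "real \<Rightarrow> real"
  using lborel_integrable_real_affine_iff[of 1 f h] by (simp add: add.commute)

lemma integral_translate: "(\<integral>x. f (x + h) \<partial>lborel) = (\<integral>x. f x \<partial>lborel)"
  for f :: "real \<Rightarrow> real"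
  using lborel_integral_real_affine[of 1 f h] by (simp add: add.commute)

text \<open>The modulus of continuity of \<open>f\<close> in L1.\<close>

definition translation_osc :: "(real \<Rightarrow> real) \<Rightarrow> real \<Rightarrow> real" where
  "translation_osc f h = (\<integral>x. \<bar>f (x + h) - f x\<bar> \<partial>lborel)"

lemma translation_osc_nonneg: "0 \<le> translation_osc f h"
  by (simp add: translation_osc_def)

text \<open>By translation invariance the approximation errors at \<open>x + h\<close> and at
  \<open>x\<close> have the same integral, whence the factor 2.\<close>

lemma translation_osc_approx:
  assumes f: "integrable lborel f" and g: "integrable lborel g"
  shows "translation_osc f h \<le> 2 * (\<integral>x. \<bar>f x - g x\<bar> \<partial>lborel) + translation_osc g h"
proof -
  have i1: "integrable lborel (\<lambda>x. \<bar>f x - g x\<bar>)" using f g by auto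
  have i2: "integrable lborel (\<lambda>x. \<bar>f (x + h) - g (x + h)\<bar>)"
    using i1 integrable_translate[of "\<lambda>x. \<bar>f x - g x\<bar>" h] by simp
  have i3: "integrable lborel (\<lambda>x. \<bar>g (x + h) - g x\<bar>)" "integrable lborel (\<lambda>x. \<bar>f (x + h) - f x\<bar>)"
    using f g integrable_translate[of f h] integrable_translate[of g h] by auto
  have "translation_osc f h \<le> (\<integral>x. \<bar>f (x + h) - g (x + h)\<bar> + (\<bar>g (x + h) - g x\<bar> + \<bar>f x - g x\<bar>) \<partial>lborel)"
    unfolding translation_osc_def using i1 i2 i3 by (intro integral_mono) auto
  also have "\<dots> = (\<integral>x. \<bar>f (x + h) - g (x + h)\<bar> \<partial>lborel) + (translation_osc g h + (\<integral>x. \<bar>f x - g x\<bar> \<partial>lborel))"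
    unfolding translation_osc_def using i1 i2 i3 by simp
  also have "(\<integral>x. \<bar>f (x + h) - g (x + h)\<bar> \<partial>lborel) = (\<integral>x. \<bar>f x - g x\<bar> \<partial>lborel)"
    by (rule integral_translate)
  finally show ?thesis by simp
qed

text \<open>
  For open \<open>U\<close> the product of the indicators of \<open>U\<close> and of its translate by \<open>h\<close> converges pointwise
  everywhere to the indicator of \<open>U\<close> as \<open>h\<close> tends to 0.
\<close>

lemma translation_osc_open:
  assumes U: "open U" "emeasure lborel U < \<infinity>" and h: "h \<longlonglongrightarrow> 0"
  shows "(\<lambda>n. translation_osc (indicator U) (h n)) \<longlonglongrightarrow> 0"
proof -
  let ?I = "indicator U :: real \<Rightarrow> real"
  have [measurable]: "U \<in> sets borel" using U(1) by auto
  have i: "integrable lborel ?I" using U by (intro integrable_real_indicator) auto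
  have ip: "integrable lborel (\<lambda>x. ?I x * ?I (x + d))" for d
    by (rule Bochner_Integration.integrable_bound[OF i]) (auto simp: indicator_def)
  have it: "integrable lborel (\<lambda>x. ?I (x + d))" for d using i by (simp add: integrable_translate)
  \<comment> \<open>For sets the modulus is the measure of a symmetric difference, so it suffices to
    follow the overlap integral.\<close>
  have eq: "translation_osc ?I d = 2 * ((\<integral>x. ?I x \<partial>lborel) - (\<integral>x. ?I x * ?I (x + d) \<partial>lborel))" for d
  proof -
    have "translation_osc ?I d = (\<integral>x. ?I (x + d) + ?I x - 2 * (?I x * ?I (x + d)) \<partial>lborel)"
      unfolding translation_osc_def by (intro Bochner_Integration.integral_cong) (auto simp: indicator_def)
    also have "\<dots> = (\<integral>x. ?I (x + d) \<partial>lborel) + (\<integral>x. ?I x \<partial>lborel) - 2 * (\<integral>x. ?I x * ?I (x + d) \<partial>lborel)"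
      using i ip it by simp
    finally show ?thesis using integral_translate[of ?I d] by simp
  qed
  have "(\<lambda>n. \<integral>x. ?I x * ?I (x + h n) \<partial>lborel) \<longlonglongrightarrow> (\<integral>x. ?I x \<partial>lborel)"
  proof (rule integral_dominated_convergence[OF _ _ i])
    show "AE x in lborel. (\<lambda>n. ?I x * ?I (x + h n)) \<longlonglongrightarrow> ?I x"
    proof (rule AE_I2)
      fix x
      show "(\<lambda>n. ?I x * ?I (x + h n)) \<longlonglongrightarrow> ?I x"
      proof (cases "x \<in> U")
        case True
        have "(\<lambda>n. x + h n) \<longlonglongrightarrow> x" using tendsto_add[OF tendsto_const h, of x] by simp
        then have "\<forall>\<^sub>F n in sequentially. x + h n \<in> U" using U(1) True by (rule topological_tendstoD)
        then have "\<forall>\<^sub>F n in sequentially. ?I x * ?I (x + h n) = ?I x"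
          by eventually_elim (auto simp: True)
        then show ?thesis by (rule tendsto_eventually)
      qed simp
    qed
  qed (auto simp: indicator_def)
  then show ?thesis unfolding eq by (auto intro!: tendsto_eq_intros)
qed

text \<open>Induction on integrable functions: the base case passes from open to measurable sets by
  outer regularity, and \<open>approx\<close> closes the class under limits in the mean.\<close>

lemma translation_osc_tendsto:
  assumes "integrable lborel f" "h \<longlonglongrightarrow> 0"
  shows "(\<lambda>n. translation_osc f (h n)) \<longlonglongrightarrow> 0"
proof -
  have approx: "(\<lambda>n. translation_osc f (h n)) \<longlonglongrightarrow> 0"
    if f: "integrable lborel f"
      and ex: "\<And>e. e > 0 \<Longrightarrow> \<exists>g. integrable lborel g \<and> (\<integral>x. \<bar>f x - g x\<bar> \<partial>lborel) < e \<and> (\<lambda>n. translation_osc g (h n)) \<longlonglongrightarrow> 0" for f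
  proof (rule LIMSEQ_I)
    fix e :: real assume "e > 0"
    obtain g where g: "integrable lborel g" "(\<integral>x. \<bar>f x - g x\<bar> \<partial>lborel) < e / 4" "(\<lambda>n. translation_osc g (h n)) \<longlonglongrightarrow> 0"
      using ex[of "e / 4"] \<open>e > 0\<close> by auto
    obtain N where N: "\<And>n. n \<ge> N \<Longrightarrow> norm (translation_osc g (h n) - 0) < e / 2"
      using LIMSEQ_D[OF g(3), of "e / 2"] \<open>e > 0\<close> by auto
    show "\<exists>no. \<forall>n\<ge>no. norm (translation_osc f (h n) - 0) < e"
    proof (intro exI allI impI)
      fix n assume "N \<le> n"
      then show "norm (translation_osc f (h n) - 0) < e"
        using N[of n] g(2) translation_osc_approx[OF f g(1), of "h n"] translation_osc_nonneg[of f "h n"] by simp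
    qed
  qed
  show ?thesis using assms(1)
  proof (induct rule: integrable_induct)
    case (base A c)
    have A: "A \<in> sets borel" using base by simp
    have iA: "integrable lborel (indicator A :: real \<Rightarrow> real)" using base by (intro integrable_real_indicator) auto
    have "(\<lambda>n. translation_osc (indicator A) (h n)) \<longlonglongrightarrow> 0"
    proof (rule approx[OF iA])
      fix e :: real assume e: "e > 0"
      obtain U where U: "open U" "A \<subseteq> U" "emeasure lebesgue (U - A) < ennreal e"
      proof (rule sets_lebesgue_outer_open[of A e])
        show "A \<in> sets lebesgue" using A by (simp add: sets_completionI_sets)
      qed (use e in auto)
      have UA: "emeasure lborel (U - A) < ennreal e"
        using U A by (simp add: emeasure_completion)
      have "emeasure lborel U = emeasure lborel A + emeasure lborel (U - A)"
        using U(1,2) A by (subst plus_emeasure) (auto intro!: arg_cong[where f="emeasure lborel"])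
      then have Uf: "emeasure lborel U < \<infinity>" using base(2) order.strict_trans[OF UA ennreal_less_top] by simp
      have iU: "integrable lborel (indicator U :: real \<Rightarrow> real)" using U Uf by (intro integrable_real_indicator) auto
      have "(\<integral>x. \<bar>indicator A x - indicator U x\<bar> \<partial>lborel) = (\<integral>x. indicat_real (U - A) x \<partial>lborel)"
        using U(2) by (intro Bochner_Integration.integral_cong) (auto simp: indicator_def)
      also have "\<dots> = measure lborel (U - A)" using U A by simp
      also have "\<dots> < e" using UA e order.strict_trans[OF UA ennreal_less_top] by (simp add: measure_def enn2real_less_iff)
      finally show "\<exists>g. integrable lborel g \<and> (\<integral>x. \<bar>indicator A x - g x\<bar> \<partial>lborel) < e \<and> (\<lambda>n. translation_osc g (h n)) \<longlonglongrightarrow> 0"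
        using iU translation_osc_open[OF U(1) Uf assms(2)] by blast
    qed
    moreover have "translation_osc (\<lambda>x. indicator A x *\<^sub>R c) d = \<bar>c\<bar> * translation_osc (indicator A) d" for d
    proof -
      have "\<bar>indicator A (x + d) *\<^sub>R c - indicator A x *\<^sub>R c\<bar> = \<bar>c\<bar> * \<bar>indicator A (x + d) - indicator A x\<bar>" for x
        by (simp add: abs_mult[symmetric] algebra_simps)
      then show ?thesis unfolding translation_osc_def by simp
    qed
    ultimately show ?case by (auto intro!: tendsto_mult_right_zero)
  next
    case (add f g)
    show ?case
    proof (rule Lim_null_comparison[OF _ tendsto_add_zero[OF add(2) add(4)]])
      have "translation_osc (\<lambda>x. f x + g x) d \<le> translation_osc f d + translation_osc g d" for d
      proof -
        have i: "integrable lborel (\<lambda>x. \<bar>f (x + d) - f x\<bar>)" "integrable lborel (\<lambda>x. \<bar>g (x + d) - g x\<bar>)"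
          "integrable lborel (\<lambda>x. \<bar>f (x + d) + g (x + d) - (f x + g x)\<bar>)"
          using add integrable_translate[of f d] integrable_translate[of g d] by auto
        then show ?thesis unfolding translation_osc_def
          by (subst Bochner_Integration.integral_add[symmetric]) (auto intro!: integral_mono Bochner_Integration.integrable_add simp del: Bochner_Integration.integral_add)
      qed
      then show "\<forall>\<^sub>F n in sequentially. norm (translation_osc (\<lambda>x. f x + g x) (h n)) \<le> translation_osc f (h n) + translation_osc g (h n)"
        by (simp add: translation_osc_nonneg)
    qed
  next
    case (lim f s)
    show ?case
    proof (rule approx[OF lim(5)])
      fix e :: real assume e: "e > 0"
      have "(\<lambda>i. \<integral>x. \<bar>f x - s i x\<bar> \<partial>lborel) \<longlonglongrightarrow> (\<integral>x. 0 \<partial>(lborel::real measure))"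
      proof (rule integral_dominated_convergence[where w="\<lambda>x. 3 * \<bar>f x\<bar>"])
        show "AE x in lborel. (\<lambda>i. \<bar>f x - s i x\<bar>) \<longlonglongrightarrow> 0"
        proof (rule AE_I2)
          fix x
          have "(\<lambda>i. \<bar>f x - s i x\<bar>) \<longlonglongrightarrow> \<bar>f x - f x\<bar>" by (intro tendsto_intros lim(3)) simp
          then show "(\<lambda>i. \<bar>f x - s i x\<bar>) \<longlonglongrightarrow> 0" by simp
        qed
        show "AE x in lborel. norm \<bar>f x - s i x\<bar> \<le> 3 * \<bar>f x\<bar>" for i
        proof (rule AE_I2)
          fix x show "norm \<bar>f x - s i x\<bar> \<le> 3 * \<bar>f x\<bar>" using lim(4)[of x i] by simp
        qed
      qed (use lim in auto)
      then have "\<forall>\<^sub>F i in sequentially. (\<integral>x. \<bar>f x - s i x\<bar> \<partial>lborel) < e" using e by (intro order_tendstoD(2)[where y=0]) auto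
      then obtain i where "(\<integral>x. \<bar>f x - s i x\<bar> \<partial>lborel) < e" by (auto simp: eventually_sequentially)
      then show "\<exists>g. integrable lborel g \<and> (\<integral>x. \<bar>f x - g x\<bar> \<partial>lborel) < e \<and> (\<lambda>n. translation_osc g (h n)) \<longlonglongrightarrow> 0"
        using lim(1,2) by blast
    qed
  qed
qed

section \<open>Moments of the density along characteristics\<close>

lemma set_integrable_bounded_borel:
  fixes g :: "real \<Rightarrow> real"
  assumes [measurable]: "g \<in> borel_measurable borel" and b: "\<And>s. s \<in> {a..b} \<Longrightarrow> \<bar>g s\<bar> \<le> C"
  shows "set_integrable lborel {a..b} g"
  unfolding set_integrable_def
proof (rule Bochner_Integration.integrable_bound)
  show "integrable lborel (\<lambda>x. indicat_real {a..b} x *\<^sub>R C)"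
    by (intro integrable_scaleR_left integrable_real_indicator) (auto simp: emeasure_lborel_Icc_eq)
  show "AE x in lborel. norm (indicat_real {a..b} x *\<^sub>R g x) \<le> norm (indicat_real {a..b} x *\<^sub>R C)"
    using b by (auto simp: indicator_def intro: order_trans[OF _ abs_ge_self])
qed measurable

lemma abs_exp_minus_diff_le:
  fixes a b :: real
  assumes "0 \<le> a" "0 \<le> b"
  shows "\<bar>exp (- a) - exp (- b)\<bar> \<le> \<bar>a - b\<bar>"
proof -
  have *: "exp (- a) - exp (- b) \<le> b - a" if "0 \<le> a" "a \<le> b" for a b :: real
  proof -
    have "exp (- a) - exp (- b) = exp (- a) * (1 - exp (- (b - a)))"
      by (simp add: algebra_simps exp_add[symmetric])
    also have "\<dots> \<le> 1 * (b - a)"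
    proof (rule mult_mono)
      show "1 - exp (- (b - a)) \<le> b - a" using exp_ge_add_one_self[of "- (b - a)"] by linarith
    qed (use that in auto)
    finally show ?thesis by simp
  qed
  show ?thesis
    using *[of a b] *[of b a] assms by (cases "a \<le> b") (auto simp: abs_if)
qed

text \<open>Admits the integrands 1, \<open>\<bar>u\<bar>\<close>, \<open>\<zeta> u\<close>,
  \<open>\<zeta> u * u\<close> and \<open>\<zeta> u * \<bar>u\<bar>\<close>; quadratic because
  \<zeta> itself may grow linearly. The local Lipschitz constant \<open>A'\<close> is kept apart
  from \<open>A\<close> since it vanishes for the mass.\<close>

definition quad_growth :: "(real \<Rightarrow> real) \<Rightarrow> real \<Rightarrow> real \<Rightarrow> bool" where
  "quad_growth \<phi> A A' \<longleftrightarrow> 0 \<le> A \<and> 0 \<le> A' \<and> \<phi> \<in> borel_measurable borel \<and>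
     (\<forall>u. \<bar>\<phi> u\<bar> \<le> A * (1 + \<bar>u\<bar>)\<^sup>2) \<and> (\<forall>u w. \<bar>\<phi> u - \<phi> w\<bar> \<le> A' * (1 + \<bar>u\<bar> + \<bar>w\<bar>) * \<bar>u - w\<bar>)"

lemma quad_growthD:
  assumes "quad_growth \<phi> A A'"
  shows "0 \<le> A" "0 \<le> A'" "\<phi> \<in> borel_measurable borel" "\<bar>\<phi> u\<bar> \<le> A * (1 + \<bar>u\<bar>)\<^sup>2"
    "\<bar>\<phi> u - \<phi> w\<bar> \<le> A' * (1 + \<bar>u\<bar> + \<bar>w\<bar>) * \<bar>u - w\<bar>"
  using assms unfolding quad_growth_def by auto

lemma quad_growth_const: "quad_growth (\<lambda>_. 1) 1 0"
  by (auto simp: quad_growth_def power2_eq_square algebra_simps)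

lemma quad_growth_abs: "quad_growth (\<lambda>u. \<bar>u\<bar>) 1 1"
  unfolding quad_growth_def
proof (safe)
  fix u w :: real
  show "\<bar>\<bar>u\<bar>\<bar> \<le> 1 * (1 + \<bar>u\<bar>)\<^sup>2" by (simp add: power2_eq_square algebra_simps)
  have "1 * \<bar>u - w\<bar> \<le> (1 + \<bar>u\<bar> + \<bar>w\<bar>) * \<bar>u - w\<bar>" by (rule mult_right_mono) auto
  then show "\<bar>\<bar>u\<bar> - \<bar>w\<bar>\<bar> \<le> 1 * (1 + \<bar>u\<bar> + \<bar>w\<bar>) * \<bar>u - w\<bar>"
    using abs_triangle_ineq3[of u w] by simp
qed auto

text \<open>In the application \<open>h0 x\<close> is \<open>- vI (- x / \<epsilon>)\<close> and
  \<open>r0 x\<close> is \<open>\<rho>I (- x / \<epsilon>)\<close>, up to null sets. The horizon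
  \<open>T\<close> is a parameter so that the estimates can be used on shorter intervals;
  \<open>L\<close> is any Lipschitz constant of \<zeta>.\<close>

locale age_transport =
  fixes \<epsilon> T L :: real and \<zeta> h0 r0 :: "real \<Rightarrow> real"
  assumes eps: "0 < \<epsilon>" and T: "0 < T"
    and zeta_lip: "L-lipschitz_on UNIV \<zeta>" and zeta_nonneg: "\<And>u. 0 \<le> \<zeta> u"
    and h0[measurable]: "h0 \<in> borel_measurable borel" and r0[measurable]: "r0 \<in> borel_measurable borel"
    and r0_nonneg: "\<And>x. 0 \<le> r0 x"
    and r0_int: "set_integrable lborel {..0} (\<lambda>x. r0 x * (1 + \<bar>h0 x\<bar>)\<^sup>2)"
begin

text \<open>
  Characteristics are labelled by \<open>x = t - \<epsilon> * a\<close>, which is the time of birth when positive.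
  On the characteristic \<open>x\<close>, \<open>v = vel G t x\<close> and \<open>\<rho> = wt b x * surv G t x\<close>, where
  \<open>\<epsilon> * G\<close> is the primitive of the source of \<open>v\<close> and \<open>b\<close> is the birth rate.
\<close>

definition lab :: "(real \<Rightarrow> real) \<Rightarrow> real \<Rightarrow> real" where
  "lab G x = (if 0 < x then G x else h0 x)"

definition wt :: "(real \<Rightarrow> real) \<Rightarrow> real \<Rightarrow> real" where
  "wt b x = (if 0 < x then b x else r0 x)"

definition vel :: "(real \<Rightarrow> real) \<Rightarrow> real \<Rightarrow> real \<Rightarrow> real" where
  "vel G t x = G t - lab G x"

definition cum :: "(real \<Rightarrow> real) \<Rightarrow> real \<Rightarrow> real \<Rightarrow> real" where
  "cum G t x = (LBINT s:{max x 0..t}. \<zeta> (vel G s x))"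

definition surv :: "(real \<Rightarrow> real) \<Rightarrow> real \<Rightarrow> real \<Rightarrow> real" where
  "surv G t x = exp (- (cum G t x / \<epsilon>))"

text \<open>The division by \<epsilon> is the Jacobian of the passage from ages to labels, so this
  is the integral of \<open>\<phi> (v t a) * \<rho> t a\<close> over ages.\<close>

definition mom :: "(real \<Rightarrow> real) \<Rightarrow> (real \<Rightarrow> real) \<Rightarrow> (real \<Rightarrow> real) \<Rightarrow> real \<Rightarrow> real" where
  "mom \<phi> G b t = (LBINT x:{..t}. wt b x * surv G t x * \<phi> (vel G t x)) / \<epsilon>"

section \<open>Growth of the death rate\<close>

lemma L_nonneg: "0 \<le> L" by (rule lipschitz_on_nonneg[OF zeta_lip])

lemma zeta_diff: "\<bar>\<zeta> u - \<zeta> w\<bar> \<le> L * \<bar>u - w\<bar>"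
  using lipschitz_onD[OF zeta_lip, of u w] by (simp add: dist_real_def)

lemma zeta_continuous: "continuous_on S \<zeta>"
  using lipschitz_on_continuous_on[OF zeta_lip] continuous_on_subset by blast

lemma zeta_borel[measurable]: "\<zeta> \<in> borel_measurable borel"
  by (rule borel_measurable_continuous_onI[OF zeta_continuous])

text \<open>Serves both in \<open>\<zeta> u \<le> Z * (1 + \<bar>u\<bar>)\<close> and as local
  Lipschitz constant of \<open>\<zeta> u * u\<close>.\<close>

definition Z :: real where "Z = \<zeta> 0 + L"

lemma Z_nonneg: "0 \<le> Z" unfolding Z_def using L_nonneg zeta_nonneg[of 0] by simp

lemma zeta_growth0: "\<zeta> u \<le> \<zeta> 0 + L * \<bar>u\<bar>"
  using zeta_diff[of u 0] by simp

lemma zeta_growth: "\<zeta> u \<le> Z * (1 + \<bar>u\<bar>)"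
proof -
  have "0 \<le> \<bar>u\<bar> * \<zeta> 0" using zeta_nonneg[of 0] by simp
  then show ?thesis using zeta_growth0[of u] L_nonneg by (simp add: Z_def algebra_simps)
qed

lemma quad_growth_zeta: "quad_growth \<zeta> Z L"
  unfolding quad_growth_def
proof (safe)
  fix u w :: real
  have "Z * (1 + \<bar>u\<bar>) * 1 \<le> Z * (1 + \<bar>u\<bar>) * (1 + \<bar>u\<bar>)" using Z_nonneg by (intro mult_left_mono) auto
  then show "\<bar>\<zeta> u\<bar> \<le> Z * (1 + \<bar>u\<bar>)\<^sup>2" using zeta_growth[of u] zeta_nonneg[of u] by (simp add: power2_eq_square mult.assoc)
  have "L * 1 * \<bar>u - w\<bar> \<le> L * (1 + \<bar>u\<bar> + \<bar>w\<bar>) * \<bar>u - w\<bar>" using L_nonneg by (intro mult_right_mono mult_left_mono) auto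
  then show "\<bar>\<zeta> u - \<zeta> w\<bar> \<le> L * (1 + \<bar>u\<bar> + \<bar>w\<bar>) * \<bar>u - w\<bar>"
    using zeta_diff[of u w] by simp
qed (use Z_nonneg L_nonneg in auto)

text \<open>The function \<psi> stands for \<open>u\<close> and \<open>\<bar>u\<bar>\<close> alike.
  In the product difference the linear growth of \<zeta> multiplies the increment of \<psi>, and the
  linear growth of \<psi> that of \<zeta>.\<close>

lemma quad_growth_zeta_mult:
  assumes [measurable]: "\<psi> \<in> borel_measurable borel"
    and \<psi>: "\<And>u. \<bar>\<psi> u\<bar> \<le> \<bar>u\<bar>" "\<And>u w. \<bar>\<psi> u - \<psi> w\<bar> \<le> \<bar>u - w\<bar>"
  shows "quad_growth (\<lambda>u. \<zeta> u * \<psi> u) Z Z"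
  unfolding quad_growth_def
proof (safe)
  fix u w :: real
  have "\<bar>\<zeta> u * \<psi> u\<bar> = \<zeta> u * \<bar>\<psi> u\<bar>" using zeta_nonneg by (simp add: abs_mult)
  also have "\<dots> \<le> (Z * (1 + \<bar>u\<bar>)) * (1 + \<bar>u\<bar>)"
    using \<psi>(1)[of u] zeta_growth[of u] Z_nonneg zeta_nonneg by (intro mult_mono) auto
  finally show "\<bar>\<zeta> u * \<psi> u\<bar> \<le> Z * (1 + \<bar>u\<bar>)\<^sup>2" by (simp add: power2_eq_square mult.assoc)
  have "\<bar>\<zeta> u * \<psi> u - \<zeta> w * \<psi> w\<bar> = \<bar>\<zeta> u * (\<psi> u - \<psi> w) + \<psi> w * (\<zeta> u - \<zeta> w)\<bar>" by (simp add: algebra_simps)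
  also have "\<dots> \<le> \<bar>\<zeta> u\<bar> * \<bar>\<psi> u - \<psi> w\<bar> + \<bar>\<psi> w\<bar> * \<bar>\<zeta> u - \<zeta> w\<bar>"
    by (rule order_trans[OF abs_triangle_ineq]) (simp add: abs_mult)
  also have "\<dots> \<le> (\<zeta> 0 + L * \<bar>u\<bar>) * \<bar>u - w\<bar> + \<bar>w\<bar> * (L * \<bar>u - w\<bar>)"
    using \<psi>(1)[of w] \<psi>(2)[of u w] zeta_diff[of u w] zeta_growth0[of u] zeta_nonneg L_nonneg
    by (intro add_mono mult_mono) auto
  also have "\<dots> \<le> Z * (1 + \<bar>u\<bar> + \<bar>w\<bar>) * \<bar>u - w\<bar>"
  proof -
    have "\<zeta> 0 + L * \<bar>u\<bar> + \<bar>w\<bar> * L \<le> Z * (1 + \<bar>u\<bar> + \<bar>w\<bar>)"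
      using zeta_nonneg[of 0] L_nonneg by (simp add: Z_def algebra_simps add_increasing)
    then have "(\<zeta> 0 + L * \<bar>u\<bar> + \<bar>w\<bar> * L) * \<bar>u - w\<bar> \<le> Z * (1 + \<bar>u\<bar> + \<bar>w\<bar>) * \<bar>u - w\<bar>"
      by (intro mult_right_mono) auto
    then show ?thesis by (simp add: algebra_simps)
  qed
  finally show "\<bar>\<zeta> u * \<psi> u - \<zeta> w * \<psi> w\<bar> \<le> Z * (1 + \<bar>u\<bar> + \<bar>w\<bar>) * \<bar>u - w\<bar>" .
qed (use Z_nonneg in auto)

lemma quad_growth_kk: "quad_growth (\<lambda>u. \<zeta> u * u) Z Z"
  by (rule quad_growth_zeta_mult) auto

lemma quad_growth_zeta_abs: "quad_growth (\<lambda>u. \<zeta> u * \<bar>u\<bar>) Z Z"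
  by (rule quad_growth_zeta_mult) (auto intro: abs_triangle_ineq3)

section \<open>Measurability and survival along a characteristic\<close>

lemma lab_borel[measurable]:
  assumes [measurable]: "G \<in> borel_measurable borel"
  shows "lab G \<in> borel_measurable borel"
proof -
  have "(\<lambda>x. lab G x) \<in> borel_measurable borel" unfolding lab_def by measurable
  then show ?thesis .
qed

lemma wt_borel[measurable]:
  assumes [measurable]: "b \<in> borel_measurable borel"
  shows "wt b \<in> borel_measurable borel"
proof -
  have "(\<lambda>x. wt b x) \<in> borel_measurable borel" unfolding wt_def by measurable
  then show ?thesis .
qed

lemma vel_measurable:
  assumes [measurable]: "G \<in> borel_measurable borel" "f \<in> borel_measurable M" "g \<in> borel_measurable M"
  shows "(\<lambda>w. vel G (f w) (g w)) \<in> borel_measurable M"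
  unfolding vel_def by measurable

text \<open>With both arguments measurable functions on an arbitrary space, this is joint
  measurability in time and label, as needed for Fubini. The moving limits of integration in
  \<open>cum\<close> are put into an indicator.\<close>

lemma surv_measurable:
  assumes [measurable]: "G \<in> borel_measurable borel" "f \<in> borel_measurable M" "g \<in> borel_measurable M"
  shows "(\<lambda>w. surv G (f w) (g w)) \<in> borel_measurable M"
proof -
  have [measurable]: "(\<lambda>(w,s). indicat_real {max (g w) 0..f w} s *\<^sub>R \<zeta> (vel G s (g w))) \<in> borel_measurable (M \<Otimes>\<^sub>M lborel)"
    unfolding vel_def indicator_def atLeastAtMost_iff by measurable
  have [measurable]: "(\<lambda>w. cum G (f w) (g w)) \<in> borel_measurable M"
    unfolding cum_def set_lebesgue_integral_def by measurable
  show ?thesis unfolding surv_def by measurable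
qed

lemma zeta_vel_continuous:
  assumes "continuous_on UNIV G"
  shows "continuous_on S (\<lambda>s. \<zeta> (vel G s x))"
proof -
  have "continuous_on S (\<lambda>s. vel G s x)"
    unfolding vel_def using continuous_on_subset[OF assms] by (intro continuous_on_diff continuous_on_const) auto
  then show ?thesis by (rule continuous_on_compose2[OF zeta_continuous[of UNIV]]) auto
qed

lemma cum_eq_integral:
  assumes "continuous_on UNIV G"
  shows "cum G t x = integral {max x 0..t} (\<lambda>s. \<zeta> (vel G s x))"
  unfolding cum_def
  by (rule set_borel_integral_eq_integral(2))
    (intro borel_integrable_atLeastAtMost' zeta_vel_continuous assms)

lemma cum_nonneg: "0 \<le> cum G t x"
  unfolding cum_def set_lebesgue_integral_def
  by (intro Bochner_Integration.integral_nonneg) (auto simp: zeta_nonneg)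

lemma surv_bounds: "0 < surv G t x" "surv G t x \<le> 1"
  using cum_nonneg[of G t x] eps by (auto simp: surv_def)

lemma abs_surv: "\<bar>surv G t x\<bar> \<le> 1"
  using surv_bounds[of G t x] by simp

lemma surv_init: "continuous_on UNIV G \<Longrightarrow> surv G (max x 0) x = 1"
  by (simp add: surv_def cum_eq_integral)

lemma surv_derivative:
  assumes G: "continuous_on UNIV G" and t: "max x 0 \<le> t" "t \<le> c"
  shows "((\<lambda>t. surv G t x) has_real_derivative (- (\<zeta> (vel G t x) * surv G t x / \<epsilon>))) (at t within {max x 0..c})"
proof -
  have "((\<lambda>t. cum G t x) has_real_derivative \<zeta> (vel G t x)) (at t within {max x 0..c})"
    unfolding cum_eq_integral[OF G] using t by (intro integral_has_real_derivative zeta_vel_continuous G) auto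
  then show ?thesis
    unfolding surv_def using eps by (auto intro!: derivative_eq_intros)
qed

lemma surv_continuous:
  assumes G: "continuous_on UNIV G"
  shows "continuous_on {max x 0..c} (\<lambda>t. surv G t x)"
  by (auto simp: continuous_on_eq_continuous_within intro!: DERIV_continuous surv_derivative[OF G])

text \<open>Integrated form of \<epsilon> S' = - \<zeta>(v) S: the deaths along a characteristic
  account exactly for the loss of survival.\<close>

lemma surv_integral:
  assumes G: "continuous_on UNIV G" and st: "max x 0 \<le> s" "s \<le> t"
  shows "integral {s..t} (\<lambda>\<tau>. \<zeta> (vel G \<tau> x) * surv G \<tau> x) = \<epsilon> * (surv G s x - surv G t x)"
proof (rule integral_unique)
  have "((\<lambda>\<tau>. - (\<zeta> (vel G \<tau> x) * surv G \<tau> x / \<epsilon>)) has_integral (surv G t x - surv G s x)) {s..t}"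
  proof (rule fundamental_theorem_of_calculus[OF st(2)])
    fix \<tau> assume "\<tau> \<in> {s..t}"
    then have "((\<lambda>t. surv G t x) has_real_derivative (- (\<zeta> (vel G \<tau> x) * surv G \<tau> x / \<epsilon>))) (at \<tau> within {max x 0..t})"
      using st by (intro surv_derivative G) auto
    then have "((\<lambda>t. surv G t x) has_real_derivative (- (\<zeta> (vel G \<tau> x) * surv G \<tau> x / \<epsilon>))) (at \<tau> within {s..t})"
      by (rule DERIV_subset) (use st in auto)
    then show "((\<lambda>t. surv G t x) has_vector_derivative (- (\<zeta> (vel G \<tau> x) * surv G \<tau> x / \<epsilon>))) (at \<tau> within {s..t})"
      by (simp add: has_real_derivative_iff_has_vector_derivative)
  qed
  from has_integral_mult_right[OF this, of "- \<epsilon>"]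
  show "((\<lambda>\<tau>. \<zeta> (vel G \<tau> x) * surv G \<tau> x) has_integral \<epsilon> * (surv G s x - surv G t x)) {s..t}"
    using eps by (simp add: algebra_simps)
qed

lemma surv_antimono:
  assumes G: "continuous_on UNIV G" and st: "max x 0 \<le> s" "s \<le> t"
  shows "surv G t x \<le> surv G s x"
proof -
  have "0 \<le> integral {s..t} (\<lambda>\<tau>. \<zeta> (vel G \<tau> x) * surv G \<tau> x)"
  proof (rule Henstock_Kurzweil_Integration.integral_nonneg)
    have "continuous_on {s..t} (\<lambda>\<tau>. surv G \<tau> x)"
      by (rule continuous_on_subset[OF surv_continuous[OF G, of x t]]) (use st in auto)
    then show "(\<lambda>\<tau>. \<zeta> (vel G \<tau> x) * surv G \<tau> x) integrable_on {s..t}"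
      by (intro integrable_continuous_real continuous_on_mult zeta_vel_continuous G)
  qed (simp add: zeta_nonneg less_imp_le[OF surv_bounds(1)])
  then show ?thesis using surv_integral[OF assms] eps by (simp add: zero_le_mult_iff)
qed

section \<open>Uniform majorants and integrability of the moments\<close>

definition W :: "real \<Rightarrow> real \<Rightarrow> real" where
  "W M x = 1 + 2 * M + (if 0 < x then 0 else \<bar>h0 x\<bar>)"

text \<open>\<open>W M x\<close> bounds \<open>1 + \<bar>vel G t x\<bar>\<close> whenever
  \<open>\<bar>G\<bar> \<le> M\<close>: newborn labels involve two values of \<open>G\<close>,
  initial ones a value of \<open>G\<close> and \<open>h0\<close>. Squared and weighted it dominates
  every moment integrand with growth constant 1, uniformly in time and in the pair \<open>G\<close>,
  \<open>b\<close>.\<close>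

definition dom :: "real \<Rightarrow> real \<Rightarrow> real \<Rightarrow> real" where
  "dom B M x = (if 0 < x then B else r0 x) * (W M x)\<^sup>2"

lemma W_ge_1: "0 \<le> M \<Longrightarrow> 1 \<le> W M x" by (simp add: W_def)

lemma vel_bound:
  assumes "\<And>s. \<bar>G s\<bar> \<le> M"
  shows "1 + \<bar>vel G t x\<bar> \<le> W M x"
  using assms[of t] assms[of x] by (auto simp: vel_def lab_def W_def)

lemma dom_nonneg: "0 \<le> B \<Longrightarrow> 0 \<le> dom B M x"
  using r0_nonneg by (auto simp: dom_def)

lemma dom_borel[measurable]: "dom B M \<in> borel_measurable borel"
  unfolding dom_def[abs_def] W_def by measurable

lemma dom_integrable:
  assumes "0 \<le> B" "0 \<le> M" "t \<le> T"
  shows "set_integrable lborel {..t} (dom B M)"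
proof -
  have i1: "integrable lborel (\<lambda>x. (1 + 2 * M)\<^sup>2 * (indicat_real {..0} x *\<^sub>R (r0 x * (1 + \<bar>h0 x\<bar>)\<^sup>2)))"
    using r0_int unfolding set_integrable_def by (rule integrable_mult_right)
  have i2: "integrable lborel (\<lambda>x. indicat_real {0..T} x *\<^sub>R (B * (1 + 2 * M)\<^sup>2))"
    by (intro integrable_scaleR_left integrable_real_indicator) (auto simp: emeasure_lborel_Icc_eq)
  show ?thesis unfolding set_integrable_def
  proof (rule Bochner_Integration.integrable_bound[OF Bochner_Integration.integrable_add[OF i1 i2]])
    show "AE x in lborel. norm (indicat_real {..t} x *\<^sub>R dom B M x)
        \<le> norm ((1 + 2 * M)\<^sup>2 * (indicat_real {..0} x *\<^sub>R (r0 x * (1 + \<bar>h0 x\<bar>)\<^sup>2)) + indicat_real {0..T} x *\<^sub>R (B * (1 + 2 * M)\<^sup>2))"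
    proof (rule AE_I2)
      fix x
      consider "0 < x" "x \<le> t" | "x \<le> 0" | "t < x" by linarith
      then show "norm (indicat_real {..t} x *\<^sub>R dom B M x)
        \<le> norm ((1 + 2 * M)\<^sup>2 * (indicat_real {..0} x *\<^sub>R (r0 x * (1 + \<bar>h0 x\<bar>)\<^sup>2)) + indicat_real {0..T} x *\<^sub>R (B * (1 + 2 * M)\<^sup>2))"
      proof cases
        case 1 then show ?thesis using assms by (simp add: dom_def W_def)
      next
        case 2
        \<comment> \<open>This splits off a constant factor and leaves the integrand of
          \<open>r0_int\<close>.\<close>
        have "W M x \<le> (1 + 2 * M) * (1 + \<bar>h0 x\<bar>)" using 2 assms by (simp add: W_def algebra_simps)
        then have "(W M x)\<^sup>2 \<le> ((1 + 2 * M) * (1 + \<bar>h0 x\<bar>))\<^sup>2"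
          using W_ge_1[OF assms(2), of x] by (intro power_mono) auto
        then have "r0 x * (W M x)\<^sup>2 \<le> r0 x * ((1 + 2 * M)\<^sup>2 * (1 + \<bar>h0 x\<bar>)\<^sup>2)"
          using r0_nonneg by (intro mult_left_mono) (auto simp: power_mult_distrib)
        then have "dom B M x \<le> (1 + 2 * M)\<^sup>2 * (indicat_real {..0} x *\<^sub>R (r0 x * (1 + \<bar>h0 x\<bar>)\<^sup>2))"
          using 2 by (simp add: dom_def mult.left_commute)
        moreover have "\<bar>indicat_real {..t} x *\<^sub>R dom B M x\<bar> \<le> dom B M x"
          using dom_nonneg[OF assms(1), of M x] by (auto simp: indicator_def)
        moreover have "0 \<le> indicat_real {0..T} x *\<^sub>R (B * (1 + 2 * M)\<^sup>2)" using assms by simp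
        ultimately show ?thesis unfolding real_norm_def by linarith
      next
        case 3 then show ?thesis by simp
      qed
    qed
  qed measurable
qed

definition J :: "real \<Rightarrow> real \<Rightarrow> real" where
  "J B M = (LBINT x:{..T}. dom B M x)"

lemma dom_integral_le: 
  assumes "0 \<le> B" "0 \<le> M" "t \<le> T"
  shows "(LBINT x:{..t}. dom B M x) \<le> J B M"
  unfolding J_def set_lebesgue_integral_def
proof (rule integral_mono)
  show "integrable lborel (\<lambda>x. indicat_real {..t} x *\<^sub>R dom B M x)"
    "integrable lborel (\<lambda>x. indicat_real {..T} x *\<^sub>R dom B M x)"
    using dom_integrable[OF assms(1,2)] assms(3) by (auto simp: set_integrable_def)
qed (use assms dom_nonneg[OF assms(1), of M] in \<open>auto simp: indicator_def\<close>)

lemma J_nonneg: "0 \<le> B \<Longrightarrow> 0 \<le> J B M"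
  unfolding J_def set_lebesgue_integral_def
  by (intro Bochner_Integration.integral_nonneg) (auto simp: dom_nonneg)

text \<open>All later constants depend on the pair only through \<open>B\<close> and
  \<open>M\<close>. The conditions hold on the whole line; functions on \<open>{0..T}\<close> are
  brought into this form by clamping time.\<close>

definition admissible :: "real \<Rightarrow> real \<Rightarrow> (real \<Rightarrow> real) \<Rightarrow> (real \<Rightarrow> real) \<Rightarrow> bool" where
  "admissible B M G b \<longleftrightarrow> 0 \<le> B \<and> 0 \<le> M \<and> continuous_on UNIV G \<and> (\<forall>s. \<bar>G s\<bar> \<le> M) \<and>
     b \<in> borel_measurable borel \<and> (\<forall>s. \<bar>b s\<bar> \<le> B)"

lemma admissibleD:
  assumes "admissible B M G b"
  shows "0 \<le> B" "0 \<le> M" "continuous_on UNIV G" "\<And>s. \<bar>G s\<bar> \<le> M" "b \<in> borel_measurable borel"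
    "\<And>s. \<bar>b s\<bar> \<le> B" "G \<in> borel_measurable borel"
  using assms unfolding admissible_def by (auto intro: borel_measurable_continuous_onI)

lemma integrand_bound:
  assumes a: "admissible B M G b" and \<phi>: "quad_growth \<phi> A A'"
  shows "\<bar>wt b x * surv G t x * \<phi> (vel G t x)\<bar> \<le> A * dom B M x"
proof -
  have w: "\<bar>wt b x\<bar> \<le> (if 0 < x then B else r0 x)"
    using admissibleD(6)[OF a, of x] r0_nonneg[of x] by (auto simp: wt_def)
  have "\<bar>\<phi> (vel G t x)\<bar> \<le> A * (1 + \<bar>vel G t x\<bar>)\<^sup>2" by (rule quad_growthD[OF \<phi>])
  also have "\<dots> \<le> A * (W M x)\<^sup>2"
    using vel_bound[of G M t x] admissibleD(4)[OF a] quad_growthD(1)[OF \<phi>]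
    by (intro mult_left_mono power_mono) auto
  finally have p: "\<bar>\<phi> (vel G t x)\<bar> \<le> A * (W M x)\<^sup>2" .
  have "\<bar>wt b x * surv G t x * \<phi> (vel G t x)\<bar> \<le> (if 0 < x then B else r0 x) * 1 * (A * (W M x)\<^sup>2)"
    unfolding abs_mult using w p abs_surv[of G t x] admissibleD(1)[OF a] r0_nonneg[of x]
    by (intro mult_mono) auto
  then show ?thesis by (simp add: dom_def mult.left_commute)
qed

lemma integrand_integrable:
  assumes a: "admissible B M G b" and \<phi>: "quad_growth \<phi> A A'" and t: "t \<le> T"
  shows "set_integrable lborel {..t} (\<lambda>x. wt b x * surv G t x * \<phi> (vel G t x))"
  unfolding set_integrable_def
proof (rule Bochner_Integration.integrable_bound)
  note [measurable] = admissibleD(5,7)[OF a] quad_growthD(3)[OF \<phi>] surv_measurable vel_measurable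
  show "integrable lborel (\<lambda>x. A * (indicat_real {..t} x *\<^sub>R dom B M x))"
    using dom_integrable[OF admissibleD(1,2)[OF a] t] unfolding set_integrable_def by (rule integrable_mult_right)
  show "(\<lambda>x. indicat_real {..t} x *\<^sub>R (wt b x * surv G t x * \<phi> (vel G t x))) \<in> borel_measurable lborel"
    by measurable
  show "AE x in lborel. norm (indicat_real {..t} x *\<^sub>R (wt b x * surv G t x * \<phi> (vel G t x))) \<le> norm (A * (indicat_real {..t} x *\<^sub>R dom B M x))"
    using integrand_bound[OF a \<phi>] by (intro AE_I2) (auto simp: indicator_def intro: order_trans[OF _ abs_ge_self])
qed

lemma mom_bound:
  assumes a: "admissible B M G b" and \<phi>: "quad_growth \<phi> A A'" and t: "t \<le> T"
  shows "\<bar>mom \<phi> G b t\<bar> \<le> A * J B M / \<epsilon>"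
proof -
  have "\<bar>LBINT x:{..t}. wt b x * surv G t x * \<phi> (vel G t x)\<bar> \<le> (LBINT x:{..t}. A * dom B M x)"
    unfolding set_lebesgue_integral_def
  proof (rule order_trans[OF integral_abs_bound], rule integral_mono)
    show "integrable lborel (\<lambda>x. \<bar>indicat_real {..t} x *\<^sub>R (wt b x * surv G t x * \<phi> (vel G t x))\<bar>)"
      using integrand_integrable[OF assms] unfolding set_integrable_def by (rule integrable_abs)
    show "integrable lborel (\<lambda>x. indicat_real {..t} x *\<^sub>R (A * dom B M x))"
      using set_integrable_mult_right[OF dom_integrable[OF admissibleD(1,2)[OF a] t], of A]
      unfolding set_integrable_def .
  qed (use integrand_bound[OF a \<phi>] in \<open>auto simp: indicator_def\<close>)
  also have "\<dots> = A * (LBINT x:{..t}. dom B M x)" by simp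
  also have "\<dots> \<le> A * J B M"
    using dom_integral_le[OF admissibleD(1,2)[OF a] t] quad_growthD(1)[OF \<phi>] by (intro mult_left_mono) auto
  finally show ?thesis unfolding mom_def using eps by (simp add: abs_divide divide_right_mono)
qed

lemma mom_borel[measurable]:
  assumes [measurable]: "G \<in> borel_measurable borel" "b \<in> borel_measurable borel" "\<phi> \<in> borel_measurable borel"
  shows "mom \<phi> G b \<in> borel_measurable borel"
proof -
  note [measurable] = surv_measurable vel_measurable
  have [measurable]: "(\<lambda>(t,x). indicat_real {..t} x *\<^sub>R (wt b x * surv G t x * \<phi> (vel G t x))) \<in> borel_measurable (borel \<Otimes>\<^sub>M lborel)"
    unfolding indicator_def atMost_iff by measurable
  show ?thesis unfolding mom_def[abs_def] set_lebesgue_integral_def by measurable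
qed

section \<open>Dependence of the moments on the primitive and the birth rate\<close>

lemma surv_diff:
  assumes G1: "continuous_on UNIV G1" and G2: "continuous_on UNIV G2" and d: "continuous_on {0..T} d"
    and d0: "\<And>s. s \<in> {0..T} \<Longrightarrow> 0 \<le> d s" and dG: "\<And>s. s \<in> {0..T} \<Longrightarrow> \<bar>G1 s - G2 s\<bar> \<le> d s"
    and t: "t \<in> {0..T}" and x: "x \<le> t"
  shows "\<bar>surv G1 t x - surv G2 t x\<bar> \<le> L / \<epsilon> * (integral {0..t} d + (if 0 < x then T * d x else 0))"
proof -
  \<comment> \<open>On labels \<open>x > 0\<close> the velocity also involves \<open>G x\<close>,
    which costs the extra term \<open>d x\<close>; on initial labels \<open>h0\<close> cancels in
    the difference.\<close>
  let ?a = "max x 0" and ?e = "if 0 < x then d x else 0"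
  have a: "?a \<in> {0..t}" using x t by auto
  have e0: "0 \<le> ?e" using d0[of x] x t by auto
  have "norm (integral {?a..t} (\<lambda>s. \<zeta> (vel G1 s x) - \<zeta> (vel G2 s x))) \<le> integral {?a..t} (\<lambda>s. L * (d s + ?e))"
  proof (rule Henstock_Kurzweil_Integration.integral_norm_bound_integral)
    show "(\<lambda>s. \<zeta> (vel G1 s x) - \<zeta> (vel G2 s x)) integrable_on {?a..t}"
      by (intro integrable_continuous_real continuous_on_diff zeta_vel_continuous G1 G2)
    show "(\<lambda>s. L * (d s + ?e)) integrable_on {?a..t}"
      using a t by (intro integrable_continuous_real continuous_intros continuous_on_subset[OF d]) auto
    fix s assume s: "s \<in> {?a..t}"
    have "\<bar>vel G1 s x - vel G2 s x\<bar> \<le> d s + ?e"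
      using dG[of s] dG[of x] s a t by (auto simp: vel_def lab_def)
    then have "L * \<bar>vel G1 s x - vel G2 s x\<bar> \<le> L * (d s + ?e)" using L_nonneg by (rule mult_left_mono)
    then show "norm (\<zeta> (vel G1 s x) - \<zeta> (vel G2 s x)) \<le> L * (d s + ?e)"
      using zeta_diff[of "vel G1 s x" "vel G2 s x"] by simp
  qed
  also have "integral {?a..t} (\<lambda>s. L * (d s + ?e)) = L * (integral {?a..t} d + (t - ?a) * ?e)"
  proof -
    have "d integrable_on {?a..t}"
      using a t by (intro integrable_continuous_real continuous_on_subset[OF d]) auto
    then have "integral {?a..t} (\<lambda>s. d s + ?e) = integral {?a..t} d + (t - ?a) * ?e"
      using a by (subst Henstock_Kurzweil_Integration.integral_add) auto
    then show ?thesis by simp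
  qed
  also have "\<dots> \<le> L * (integral {0..t} d + T * ?e)"
  proof (intro mult_left_mono add_mono mult_right_mono)
    show "integral {?a..t} d \<le> integral {0..t} d"
      using a t d0 by (intro integral_subset_le integrable_continuous_real continuous_on_subset[OF d]) auto
  qed (use a t e0 L_nonneg in auto)
  also have "integral {?a..t} (\<lambda>s. \<zeta> (vel G1 s x) - \<zeta> (vel G2 s x)) = cum G1 t x - cum G2 t x"
    unfolding cum_eq_integral[OF G1] cum_eq_integral[OF G2]
    by (intro Henstock_Kurzweil_Integration.integral_diff integrable_continuous_real zeta_vel_continuous G1 G2)
  finally have c: "\<bar>cum G1 t x - cum G2 t x\<bar> \<le> L * (integral {0..t} d + T * ?e)" by simp
  have "\<bar>surv G1 t x - surv G2 t x\<bar> \<le> \<bar>cum G1 t x / \<epsilon> - cum G2 t x / \<epsilon>\<bar>"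
    unfolding surv_def using cum_nonneg eps by (intro abs_exp_minus_diff_le) auto
  also have "\<dots> = \<bar>cum G1 t x - cum G2 t x\<bar> / \<epsilon>" using eps by (simp add: diff_divide_distrib[symmetric] abs_divide)
  also have "\<dots> \<le> L * (integral {0..t} d + T * ?e) / \<epsilon>" using c eps by (intro divide_right_mono) auto
  finally show ?thesis by (auto simp: field_simps)
qed

text \<open>\<open>\<epsilon> * diffC B M\<close> dominates the three coefficients in
  \<open>mom_diff\<close>: that of \<open>A\<close> times the integral of \<open>d\<close>, that of
  \<open>A' * d t\<close>, and that of \<open>A'\<close> times the integral of
  \<open>d\<close>.\<close>

definition diffC :: "real \<Rightarrow> real \<Rightarrow> real" where
  "diffC B M = (J B M * L / \<epsilon> + 2 * J B M + B * (1 + 2 * M)\<^sup>2 * (1 + L * T / \<epsilon> + 2)) / \<epsilon>"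

lemma diffC_nonneg: "0 \<le> B \<Longrightarrow> 0 \<le> M \<Longrightarrow> 0 \<le> diffC B M"
  unfolding diffC_def using J_nonneg[of B M] eps L_nonneg T by (intro divide_nonneg_pos add_nonneg_nonneg mult_nonneg_nonneg) auto

text \<open>The three factors are exchanged one at a time. Differences at the label occur only for
  \<open>x > 0\<close>, where \<open>W\<close> is the constant \<open>1 + 2 * M\<close>; they are
  collected in the last term, to be integrated in \<open>x\<close>, while the others keep the
  majorant \<open>dom\<close>.\<close>

lemma integrand_diff:
  assumes a1: "admissible B M G1 b1" and a2: "admissible B M G2 b2" and \<phi>: "quad_growth \<phi> A A'"
    and d: "continuous_on {0..T} d" and d0: "\<And>s. s \<in> {0..T} \<Longrightarrow> 0 \<le> d s"
    and dG: "\<And>s. s \<in> {0..T} \<Longrightarrow> \<bar>G1 s - G2 s\<bar> \<le> d s"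
    and db: "\<And>s. s \<in> {0..T} \<Longrightarrow> \<bar>b1 s - b2 s\<bar> \<le> B * d s"
    and t: "t \<in> {0..T}" and x: "x \<le> t"
  shows "\<bar>wt b1 x * surv G1 t x * \<phi> (vel G1 t x) - wt b2 x * surv G2 t x * \<phi> (vel G2 t x)\<bar>
    \<le> dom B M x * (L / \<epsilon> * A * integral {0..t} d + 2 * A' * d t)
      + indicat_real {0..t} x * (B * (1 + 2 * M)\<^sup>2 * (A * (1 + L * T / \<epsilon>) + 2 * A') * d x)"
proof -
  let ?I = "integral {0..t} d" and ?w = "if 0 < x then B else r0 x" and ?e = "if 0 < x then d x else 0"
  note D1 = admissibleD[OF a1] and D2 = admissibleD[OF a2] and P = quad_growthD[OF \<phi>]
  have e0: "0 \<le> ?e" using d0[of x] x t by auto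
  have w0: "0 \<le> ?w" using D1(1) r0_nonneg by auto
  have W1: "1 \<le> W M x" by (rule W_ge_1[OF D1(2)])
  have I0: "0 \<le> ?I" using t d0
    by (intro Henstock_Kurzweil_Integration.integral_nonneg integrable_continuous_real continuous_on_subset[OF d]) auto
  have dt0: "0 \<le> d t" using d0 t by auto
  have v1: "1 + \<bar>vel G1 t x\<bar> \<le> W M x" and v2: "1 + \<bar>vel G2 t x\<bar> \<le> W M x"
    using vel_bound D1(4) D2(4) by blast+
  have p1: "\<bar>\<phi> (vel G1 t x)\<bar> \<le> A * (W M x)\<^sup>2"
    by (rule order_trans[OF P(4)]) (intro mult_left_mono power_mono v1 P(1), auto)
  have "\<bar>vel G1 t x - vel G2 t x\<bar> \<le> d t + ?e"
    using dG[of t] dG[of x] t x by (auto simp: vel_def lab_def)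
  then have "\<bar>\<phi> (vel G1 t x) - \<phi> (vel G2 t x)\<bar> \<le> A' * (2 * W M x) * (d t + ?e)"
    by (intro order_trans[OF P(5)] mult_mono mult_left_mono P(2) mult_nonneg_nonneg) (use v1 v2 W1 in auto)
  also have "\<dots> \<le> A' * (2 * (W M x)\<^sup>2) * (d t + ?e)"
    using W1 e0 dt0 P(2) by (intro mult_right_mono mult_left_mono) (auto simp: power2_eq_square)
  finally have p2: "\<bar>\<phi> (vel G1 t x) - \<phi> (vel G2 t x)\<bar> \<le> A' * (2 * (W M x)\<^sup>2) * (d t + ?e)" .
  have s: "\<bar>surv G1 t x - surv G2 t x\<bar> \<le> L / \<epsilon> * (?I + T * ?e)"
    using surv_diff[OF D1(3) D2(3) d d0 dG t x] by (auto split: if_splits)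
  have w1: "\<bar>wt b1 x - wt b2 x\<bar> \<le> ?w * ?e" using db[of x] x t by (auto simp: wt_def)
  have w2: "\<bar>wt b2 x\<bar> \<le> ?w" using D2(6)[of x] r0_nonneg[of x] by (auto simp: wt_def)
  have "\<bar>wt b1 x * surv G1 t x * \<phi> (vel G1 t x) - wt b2 x * surv G2 t x * \<phi> (vel G2 t x)\<bar>
    = \<bar>(wt b1 x - wt b2 x) * surv G1 t x * \<phi> (vel G1 t x)
      + wt b2 x * (surv G1 t x - surv G2 t x) * \<phi> (vel G1 t x)
      + wt b2 x * surv G2 t x * (\<phi> (vel G1 t x) - \<phi> (vel G2 t x))\<bar>" by (simp add: algebra_simps)
  also have "\<dots> \<le> \<bar>wt b1 x - wt b2 x\<bar> * \<bar>surv G1 t x\<bar> * \<bar>\<phi> (vel G1 t x)\<bar>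
      + \<bar>wt b2 x\<bar> * \<bar>surv G1 t x - surv G2 t x\<bar> * \<bar>\<phi> (vel G1 t x)\<bar>
      + \<bar>wt b2 x\<bar> * \<bar>surv G2 t x\<bar> * \<bar>\<phi> (vel G1 t x) - \<phi> (vel G2 t x)\<bar>"
    unfolding abs_mult[symmetric] by (intro order_trans[OF abs_triangle_ineq] add_mono order_refl)
  also have "\<dots> \<le> (?w * ?e) * 1 * (A * (W M x)\<^sup>2)
      + ?w * (L / \<epsilon> * (?I + T * ?e)) * (A * (W M x)\<^sup>2)
      + ?w * 1 * (A' * (2 * (W M x)\<^sup>2) * (d t + ?e))"
    using w0 e0 I0 dt0 L_nonneg eps T P(1,2)
    by (intro add_mono mult_mono w1 w2 s p1 p2 abs_surv mult_nonneg_nonneg add_nonneg_nonneg divide_nonneg_pos) auto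
  also have "\<dots> = ?w * (W M x)\<^sup>2 * (L / \<epsilon> * A * ?I + 2 * A' * d t)
      + ?w * (W M x)\<^sup>2 * (A * (1 + L * T / \<epsilon>) + 2 * A') * ?e"
    using eps by (simp add: field_simps)
  also have "?w * (W M x)\<^sup>2 * (A * (1 + L * T / \<epsilon>) + 2 * A') * ?e
      \<le> indicat_real {0..t} x * (B * (1 + 2 * M)\<^sup>2 * (A * (1 + L * T / \<epsilon>) + 2 * A') * d x)"
  proof (cases "0 < x")
    case True
    then show ?thesis using x by (simp add: W_def)
  next
    case False
    have "0 \<le> B * (1 + 2 * M)\<^sup>2 * (A * (1 + L * T / \<epsilon>) + 2 * A')"
      using D1(1,2) P(1,2) L_nonneg T eps by (intro mult_nonneg_nonneg add_nonneg_nonneg divide_nonneg_pos) auto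
    then show ?thesis using False d0[of x] x t by (auto simp: indicator_def)
  qed
  finally show ?thesis by (simp add: dom_def)
qed

text \<open>
  The term \<open>A' * d t\<close> is the instantaneous dependence on \<open>G t\<close>; it is absent for the mass, where
  \<open>A' = 0\<close>.
\<close>

lemma mom_diff:
  assumes a1: "admissible B M G1 b1" and a2: "admissible B M G2 b2" and \<phi>: "quad_growth \<phi> A A'"
    and d: "continuous_on {0..T} d" and d0: "\<And>s. s \<in> {0..T} \<Longrightarrow> 0 \<le> d s"
    and dG: "\<And>s. s \<in> {0..T} \<Longrightarrow> \<bar>G1 s - G2 s\<bar> \<le> d s"
    and db: "\<And>s. s \<in> {0..T} \<Longrightarrow> \<bar>b1 s - b2 s\<bar> \<le> B * d s"
    and t: "t \<in> {0..T}"
  shows "\<bar>mom \<phi> G1 b1 t - mom \<phi> G2 b2 t\<bar> \<le> diffC B M * (A * integral {0..t} d + A' * (d t + integral {0..t} d))"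
proof -
  let ?I = "integral {0..t} d"
  note D1 = admissibleD[OF a1] and P = quad_growthD[OF \<phi>]
  have I0: "0 \<le> ?I" using t d0
    by (intro Henstock_Kurzweil_Integration.integral_nonneg integrable_continuous_real continuous_on_subset[OF d]) auto
  have dt0: "0 \<le> d t" using d0 t by auto
  define c1 where "c1 = L / \<epsilon> * A * ?I + 2 * A' * d t"
  define c2 where "c2 = B * (1 + 2 * M)\<^sup>2 * (A * (1 + L * T / \<epsilon>) + 2 * A')"
  have c1: "0 \<le> c1" unfolding c1_def using L_nonneg eps P(1,2) I0 dt0
    by (intro add_nonneg_nonneg mult_nonneg_nonneg divide_nonneg_pos) auto
  let ?f = "\<lambda>x. wt b1 x * surv G1 t x * \<phi> (vel G1 t x) - wt b2 x * surv G2 t x * \<phi> (vel G2 t x)"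
  have fi: "set_integrable lborel {..t} ?f"
    using t by (intro set_integral_diff(1) integrand_integrable[OF a1 \<phi>] integrand_integrable[OF a2 \<phi>]) auto
  have di: "set_integrable lborel {0..t} d"
    by (rule borel_integrable_atLeastAtMost') (use t in \<open>auto intro: continuous_on_subset[OF d]\<close>)
  have dI: "(LBINT x:{0..t}. d x) = ?I" by (rule set_borel_integral_eq_integral(2)[OF di])
  have Ji: "set_integrable lborel {..t} (dom B M)" using t by (intro dom_integrable D1) auto
  have "\<bar>LBINT x:{..t}. ?f x\<bar> \<le> (\<integral>x. c1 * (indicat_real {..t} x *\<^sub>R dom B M x) + c2 * (indicat_real {0..t} x *\<^sub>R d x) \<partial>lborel)"
    unfolding set_lebesgue_integral_def
  proof (rule order_trans[OF integral_abs_bound], rule integral_mono)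
    show "integrable lborel (\<lambda>x. \<bar>indicat_real {..t} x *\<^sub>R ?f x\<bar>)"
      using fi unfolding set_integrable_def by (rule integrable_abs)
    show "integrable lborel (\<lambda>x. c1 * (indicat_real {..t} x *\<^sub>R dom B M x) + c2 * (indicat_real {0..t} x *\<^sub>R d x))"
      using Ji di unfolding set_integrable_def by (intro Bochner_Integration.integrable_add integrable_mult_right)
    fix x
    show "\<bar>indicat_real {..t} x *\<^sub>R ?f x\<bar> \<le> c1 * (indicat_real {..t} x *\<^sub>R dom B M x) + c2 * (indicat_real {0..t} x *\<^sub>R d x)"
    proof (cases "x \<le> t")
      case True
      have "\<bar>?f x\<bar> \<le> dom B M x * c1 + indicat_real {0..t} x * (c2 * d x)"
        unfolding c1_def c2_def by (rule integrand_diff[OF a1 a2 \<phi> d d0 dG db t True])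
      then show ?thesis using True by (simp add: algebra_simps)
    qed (simp add: indicator_def)
  qed
  also have "\<dots> = c1 * (LBINT x:{..t}. dom B M x) + c2 * ?I"
    unfolding dI[symmetric] unfolding set_lebesgue_integral_def
    using Ji di unfolding set_integrable_def by (subst Bochner_Integration.integral_add) auto
  also have "\<dots> \<le> c1 * J B M + c2 * ?I"
    using dom_integral_le[OF D1(1,2), of t] t c1 by (intro add_right_mono mult_left_mono) auto
  also have "\<dots> = (J B M * L / \<epsilon> + B * (1 + 2 * M)\<^sup>2 * (1 + L * T / \<epsilon>)) * (A * ?I)
      + (2 * J B M) * (A' * d t) + (2 * (B * (1 + 2 * M)\<^sup>2)) * (A' * ?I)"
    unfolding c1_def c2_def by (simp add: algebra_simps)
  also have "\<dots> \<le> \<epsilon> * diffC B M * (A * ?I) + \<epsilon> * diffC B M * (A' * d t) + \<epsilon> * diffC B M * (A' * ?I)"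
  proof -
    have q: "0 \<le> B * (1 + 2 * M)\<^sup>2" "0 \<le> J B M" "0 \<le> J B M * L / \<epsilon>" "0 \<le> B * (1 + 2 * M)\<^sup>2 * (L * T / \<epsilon>)"
      using D1(1,2) J_nonneg[of B M] L_nonneg T eps by auto
    have "\<epsilon> * diffC B M = J B M * L / \<epsilon> + 2 * J B M + (B * (1 + 2 * M)\<^sup>2 * 3 + B * (1 + 2 * M)\<^sup>2 * (L * T / \<epsilon>))"
      using eps by (simp add: diffC_def field_simps)
    then show ?thesis using q I0 dt0 P(1,2)
      by (intro add_mono mult_right_mono mult_nonneg_nonneg) (auto simp: algebra_simps)
  qed
  also have "\<dots> = \<epsilon> * (diffC B M * (A * ?I + A' * (d t + ?I)))" by (simp add: algebra_simps)
  finally have *: "\<bar>LBINT x:{..t}. ?f x\<bar> \<le> \<epsilon> * (diffC B M * (A * ?I + A' * (d t + ?I)))" .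
  have "mom \<phi> G1 b1 t - mom \<phi> G2 b2 t = (LBINT x:{..t}. ?f x) / \<epsilon>"
    unfolding mom_def using t
    by (subst set_integral_diff(2)) (auto intro!: integrand_integrable[OF a1 \<phi>] integrand_integrable[OF a2 \<phi>] simp: diff_divide_distrib)
  then show ?thesis using * eps by (simp add: abs_divide divide_le_eq mult.commute)
qed

section \<open>Balance laws for the mass and the first absolute moment\<close>

lemma mom_swap:
  assumes a: "admissible B M G b" and \<psi>: "quad_growth \<psi> A A'" and \<gamma>[measurable]: "\<gamma> \<in> borel_measurable borel"
    and \<Gamma>: "\<And>s. \<bar>\<gamma> s\<bar> \<le> \<Gamma>" and t: "t \<in> {0..T}"
  shows "set_integrable lborel {..t} (\<lambda>x. wt b x * (LBINT s:{max x 0..t}. \<gamma> s * (surv G s x * \<psi> (vel G s x))))"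
    and "(LBINT x:{..t}. wt b x * (LBINT s:{max x 0..t}. \<gamma> s * (surv G s x * \<psi> (vel G s x))))
      = \<epsilon> * (LBINT s:{0..t}. \<gamma> s * mom \<psi> G b s)"
proof -
  note [measurable] = admissibleD(5,7)[OF a] quad_growthD(3)[OF \<psi>] surv_measurable vel_measurable
  note D = admissibleD[OF a]
  \<comment> \<open>The integrand on the region \<open>max x 0 \<le> s \<le> t\<close>: integrating
    first in \<open>s\<close> follows one characteristic, integrating first in \<open>x\<close>
    gives the moment at time \<open>s\<close>.\<close>
  define f where "f = (\<lambda>x s. (if x \<le> t \<and> max x 0 \<le> s \<and> s \<le> t then wt b x * (\<gamma> s * (surv G s x * \<psi> (vel G s x))) else 0))"
  have fm: "case_prod f \<in> borel_measurable (borel \<Otimes>\<^sub>M borel)" unfolding f_def by measurable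
  have G0: "0 \<le> \<Gamma>" using \<Gamma>[of 0] by simp
  have fb: "\<bar>f x s\<bar> \<le> (A * (indicat_real {..t} x *\<^sub>R dom B M x)) * (indicat_real {0..t} s *\<^sub>R \<Gamma>)" for x s
  proof (cases "x \<le> t \<and> max x 0 \<le> s \<and> s \<le> t")
    case True
    have "\<bar>f x s\<bar> = \<bar>wt b x * surv G s x * \<psi> (vel G s x)\<bar> * \<bar>\<gamma> s\<bar>"
      using True by (simp add: f_def abs_mult)
    also have "\<dots> \<le> (A * dom B M x) * \<Gamma>"
      using integrand_bound[OF a \<psi>, of x s] \<Gamma>[of s] dom_nonneg[OF D(1)] quad_growthD(1)[OF \<psi>]
      by (intro mult_mono) auto
    finally show ?thesis using True by simp
  next
    case False
    then have "f x s = 0" unfolding f_def by (rule if_not_P)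
    then show ?thesis using G0 dom_nonneg[OF D(1)] quad_growthD(1)[OF \<psi>] by simp
  qed
  have i1: "integrable lborel (\<lambda>x. A * (indicat_real {..t} x *\<^sub>R dom B M x))"
    using dom_integrable[OF D(1,2), of t] t unfolding set_integrable_def by (intro integrable_mult_right) auto
  have i2: "integrable lborel (\<lambda>s. indicat_real {0..t} s *\<^sub>R \<Gamma>)"
    by (intro integrable_scaleR_left integrable_real_indicator) (auto simp: emeasure_lborel_Icc_eq)
  have e1: "(\<integral>s. f x s \<partial>lborel) = indicat_real {..t} x *\<^sub>R (wt b x * (LBINT s:{max x 0..t}. \<gamma> s * (surv G s x * \<psi> (vel G s x))))" for x
  proof -
    have "f x s = (indicat_real {..t} x * wt b x) * (indicat_real {max x 0..t} s *\<^sub>R (\<gamma> s * (surv G s x * \<psi> (vel G s x))))" for s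
      by (auto simp: f_def indicator_def)
    then show ?thesis unfolding set_lebesgue_integral_def by simp
  qed
  have e2: "(\<integral>x. f x s \<partial>lborel) = \<epsilon> * (indicat_real {0..t} s *\<^sub>R (\<gamma> s * mom \<psi> G b s))" for s
  proof -
    have "f x s = (indicat_real {0..t} s * \<gamma> s) * (indicat_real {..s} x *\<^sub>R (wt b x * surv G s x * \<psi> (vel G s x)))" for x
      by (auto simp: f_def indicator_def)
    then show ?thesis unfolding mom_def set_lebesgue_integral_def using eps by simp
  qed
  from Fubini_product_bound[OF fm i1 i2 fb]
  show "set_integrable lborel {..t} (\<lambda>x. wt b x * (LBINT s:{max x 0..t}. \<gamma> s * (surv G s x * \<psi> (vel G s x))))"
    and "(LBINT x:{..t}. wt b x * (LBINT s:{max x 0..t}. \<gamma> s * (surv G s x * \<psi> (vel G s x))))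
      = \<epsilon> * (LBINT s:{0..t}. \<gamma> s * mom \<psi> G b s)"
    unfolding e1 e2 set_integrable_def set_lebesgue_integral_def by simp_all
qed

lemma r0_integrable:
  assumes [measurable]: "\<phi> \<in> borel_measurable borel" and \<phi>: "\<And>u. \<bar>\<phi> u\<bar> \<le> (1 + \<bar>u\<bar>)\<^sup>2"
  shows "set_integrable lborel {..0} (\<lambda>x. r0 x * \<phi> (h0 x))"
  unfolding set_integrable_def
proof (rule Bochner_Integration.integrable_bound[OF r0_int[unfolded set_integrable_def]])
  show "AE x in lborel. norm (indicat_real {..0} x *\<^sub>R (r0 x * \<phi> (h0 x))) \<le> norm (indicat_real {..0} x *\<^sub>R (r0 x * (1 + \<bar>h0 x\<bar>)\<^sup>2))"
    using \<phi> r0_nonneg by (auto simp: indicator_def abs_mult intro!: mult_left_mono)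
qed measurable

lemma wt_integral:
  assumes a: "admissible B M G b" and t: "t \<in> {0..T}"
  shows "set_integrable lborel {..t} (wt b)"
    "(LBINT x:{..t}. wt b x) = (LBINT x:{..0}. r0 x) + (LBINT x:{0..t}. b x)"
proof -
  have i1: "set_integrable lborel {..0} r0"
    using r0_integrable[of "\<lambda>_. 1"] by (simp add: power2_eq_square algebra_simps)
  have i2: "set_integrable lborel {0..t} b"
    by (rule set_integrable_bounded_borel[of _ _ _ B]) (use admissibleD[OF a] in auto)
  \<comment> \<open>The label 0 is counted in both integrals on the right; it is a null set.\<close>
  have eq: "AE x in lborel. indicat_real {..t} x *\<^sub>R wt b x = indicat_real {..0} x *\<^sub>R r0 x + indicat_real {0..t} x *\<^sub>R b x"
    using AE_lborel_singleton[of 0] by eventually_elim (use t in \<open>auto simp: wt_def indicator_def\<close>)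
  have i: "integrable lborel (\<lambda>x. indicat_real {..0} x *\<^sub>R r0 x + indicat_real {0..t} x *\<^sub>R b x)"
    using i1 i2 unfolding set_integrable_def by auto
  have m: "(\<lambda>x. indicat_real {..t} x *\<^sub>R wt b x) \<in> borel_measurable lborel"
    using wt_borel[OF admissibleD(5)[OF a]] by measurable
  show "set_integrable lborel {..t} (wt b)" unfolding set_integrable_def
    using i m by (subst integrable_cong_AE[OF _ _ eq]) auto
  have "(LBINT x:{..t}. wt b x) = (\<integral>x. indicat_real {..0} x *\<^sub>R r0 x + indicat_real {0..t} x *\<^sub>R b x \<partial>lborel)"
    unfolding set_lebesgue_integral_def using i m by (intro integral_cong_AE[OF _ _ eq]) auto
  then show "(LBINT x:{..t}. wt b x) = (LBINT x:{..0}. r0 x) + (LBINT x:{0..t}. b x)"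
    using i1 i2 unfolding set_lebesgue_integral_def set_integrable_def by simp
qed

lemma mom_set_integrable:
  assumes a: "admissible B M G b" and \<phi>: "quad_growth \<phi> A A'" and "t \<le> T"
  shows "set_integrable lborel {s..t} (mom \<phi> G b)"
  by (rule set_integrable_bounded_borel[OF mom_borel[OF admissibleD(7,5)[OF a] quad_growthD(3)[OF \<phi>]], of s t "A * J B M / \<epsilon>"])
    (use mom_bound[OF a \<phi>] assms(3) in auto)

text \<open>Obtained from \<open>surv_integral\<close>, started at the entry time, by weighting with
  \<open>wt b\<close>, integrating over labels and swapping: what is present has entered and has not
  died.\<close>

lemma mass_balance:
  assumes a: "admissible B M G b" and t: "t \<in> {0..T}"
  shows "\<epsilon> * mom (\<lambda>_. 1) G b t = (LBINT x:{..0}. r0 x) + (LBINT s:{0..t}. b s - mom \<zeta> G b s)"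
proof -
  note G = admissibleD(3)[OF a]
  have pt: "wt b x * surv G t x * 1 = wt b x - wt b x * (LBINT s:{max x 0..t}. 1 * (surv G s x * \<zeta> (vel G s x))) / \<epsilon>"
    if x: "x \<le> t" for x
  proof -
    have xt: "max x 0 \<le> t" using x t by auto
    have "(LBINT s:{max x 0..t}. surv G s x * \<zeta> (vel G s x)) = integral {max x 0..t} (\<lambda>s. \<zeta> (vel G s x) * surv G s x)"
      unfolding mult.commute[of "surv G _ _"]
      by (intro set_borel_integral_eq_integral(2) borel_integrable_atLeastAtMost' continuous_on_mult zeta_vel_continuous
        surv_continuous G)
    also have "\<dots> = \<epsilon> * (1 - surv G t x)"
      using surv_integral[OF G order_refl xt] surv_init[OF G] by simp
    finally show ?thesis unfolding mult_1 using eps by (simp add: right_diff_distrib diff_divide_distrib)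
  qed
  note sw = mom_swap[OF a quad_growth_zeta, of "\<lambda>_. 1" 1 t, simplified, unfolded atLeastAtMost_iff[symmetric]]
  have "(LBINT x:{..t}. wt b x * surv G t x * 1)
      = (LBINT x:{..t}. wt b x - wt b x * (LBINT s:{max x 0..t}. 1 * (surv G s x * \<zeta> (vel G s x))) / \<epsilon>)"
    by (rule set_lebesgue_integral_cong) (simp, use pt in auto)
  also have "\<dots> = (LBINT x:{..t}. wt b x) - (LBINT x:{..t}. wt b x * (LBINT s:{max x 0..t}. 1 * (surv G s x * \<zeta> (vel G s x))) / \<epsilon>)"
    by (intro set_integral_diff(2) wt_integral[OF a t] set_integrable_divide)
      (use sw(1) t in auto)
  also have "\<dots> = (LBINT x:{..0}. r0 x) + (LBINT x:{0..t}. b x) - (LBINT s:{0..t}. mom \<zeta> G b s)"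
    using sw(2) t eps by (simp add: wt_integral[OF a t])
  also have "\<dots> = (LBINT x:{..0}. r0 x) + (LBINT s:{0..t}. b s - mom \<zeta> G b s)"
  proof -
    have "set_integrable lborel {0..t} b"
      by (rule set_integrable_bounded_borel[OF admissibleD(5)[OF a] admissibleD(6)[OF a]])
    moreover have "set_integrable lborel {0..t} (mom \<zeta> G b)"
      by (rule mom_set_integrable[OF a quad_growth_zeta]) (use t in auto)
    ultimately show ?thesis by (simp add: set_integral_diff(2))
  qed
  finally show ?thesis using eps by (simp add: mom_def)
qed

lemma mass_continuous:
  assumes a: "admissible B M G b"
  shows "continuous_on {0..T} (mom (\<lambda>_. 1) G b)"
proof -
  let ?f = "\<lambda>s. b s - mom \<zeta> G b s"
  have i: "set_integrable lborel {0..t} ?f" if "t \<in> {0..T}" for t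
    by (intro set_integral_diff(1) mom_set_integrable[OF a quad_growth_zeta] set_integrable_bounded_borel[OF admissibleD(5)[OF a] admissibleD(6)[OF a]])
     (use that in auto)
  have "continuous_on {0..T} (\<lambda>t. ((LBINT x:{..0}. r0 x) + integral {0..t} ?f) / \<epsilon>)"
    using T eps by (intro continuous_intros indefinite_integral_continuous_1 set_borel_integral_eq_integral(1) i) auto
  then show ?thesis
  proof (rule continuous_on_eq)
    fix t assume that: "t \<in> {0..T}"
    show "((LBINT x:{..0}. r0 x) + integral {0..t} ?f) / \<epsilon> = mom (\<lambda>_. 1) G b t"
      using mass_balance[OF a that] set_borel_integral_eq_integral(2)[OF i[OF that]] eps by (simp add: field_simps)
  qed
qed

text \<open>
  \<open>G\<close> is only an indefinite integral; \<open>nonincreasing_quadratic_error\<close> replaces the chain rule for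
  \<open>\<bar>v\<bar>\<close> along a characteristic.
\<close>

lemma abs_vel_decay:
  assumes a: "admissible B M G b" and \<gamma>[measurable]: "\<gamma> \<in> borel_measurable borel"
    and \<gamma>0: "\<And>s. 0 \<le> \<gamma> s" and \<Gamma>: "\<And>s. \<gamma> s \<le> \<Gamma>"
    and incr: "\<And>s t. 0 \<le> s \<Longrightarrow> s \<le> t \<Longrightarrow> t \<le> T \<Longrightarrow> \<bar>G t - G s\<bar> \<le> (LBINT \<tau>:{s..t}. \<gamma> \<tau>) / \<epsilon>"
    and x: "max x 0 \<le> t" and t: "t \<le> T"
  shows "surv G t x * \<bar>vel G t x\<bar> + (LBINT s:{max x 0..t}. surv G s x * (\<zeta> (vel G s x) * \<bar>vel G s x\<bar>)) / \<epsilon>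
    \<le> \<bar>vel G (max x 0) x\<bar> + (LBINT s:{max x 0..t}. \<gamma> s * surv G s x) / \<epsilon>"
proof -
  note D = admissibleD[OF a]
  note [measurable] = D(5,7) surv_measurable vel_measurable
  let ?a = "max x 0"
  define S where "S = (\<lambda>s. surv G s x)"
  define v where "v = (\<lambda>s. vel G s x)"
  define C where "C = Z * W M x"
  have C0: "0 \<le> C" using Z_nonneg W_ge_1[OF D(2), of x] by (simp add: C_def)
  have zC: "\<zeta> (v s) \<le> C" for s
    unfolding C_def v_def by (rule order_trans[OF zeta_growth mult_left_mono[OF vel_bound Z_nonneg]]) (rule D)
  have G0: "0 \<le> \<Gamma>" using \<gamma>0[of 0] \<Gamma>[of 0] by simp
  have Sc: "continuous_on {?a..t} S" unfolding S_def by (rule surv_continuous[OF D(3)])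
  have vc: "continuous_on A v" for A
    unfolding v_def vel_def using continuous_on_subset[OF D(3)] by (intro continuous_on_diff continuous_on_const) auto
  have zc: "continuous_on A (\<lambda>s. \<zeta> (v s))" for A unfolding v_def by (rule zeta_vel_continuous[OF D(3)])
  have fi: "(\<lambda>s. S s * (\<zeta> (v s) * \<bar>v s\<bar>)) integrable_on {p..q}" if "?a \<le> p" "q \<le> t" for p q
    by (intro integrable_continuous_real continuous_intros zc vc continuous_on_subset[OF Sc]) (use that in auto)
  have gS: "set_integrable lborel {p..q} (\<lambda>s. \<gamma> s * S s)" for p q
  proof (rule set_integrable_bounded_borel)
    show "(\<lambda>s. \<gamma> s * S s) \<in> borel_measurable borel" unfolding S_def by measurable
    show "\<bar>\<gamma> s * S s\<bar> \<le> \<Gamma> * 1" for s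
      unfolding S_def abs_mult using \<gamma>0[of s] \<Gamma>[of s] G0 by (intro mult_mono abs_surv) auto
  qed
  have gi: "(\<lambda>s. \<gamma> s * S s) integrable_on {p..q}" for p q by (rule set_borel_integral_eq_integral(1)[OF gS])
  have g: "set_integrable lborel {p..q} \<gamma>" for p q
    by (rule set_integrable_bounded_borel[of _ _ _ \<Gamma>]) (use \<gamma>0 \<Gamma> in auto)
  \<comment> \<open>The left side of the claim minus the time integral on its right, as a function
    of time. Its initial value is the remaining term, so the claim says that \<open>u\<close> does
    not increase.\<close>
  define u where "u = (\<lambda>s. S s * \<bar>v s\<bar> + integral {?a..s} (\<lambda>s. S s * (\<zeta> (v s) * \<bar>v s\<bar>)) / \<epsilon> - integral {?a..s} (\<lambda>s. \<gamma> s * S s) / \<epsilon>)"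
  have "u t \<le> u ?a"
  proof (rule nonincreasing_quadratic_error[OF x])
    fix p q assume pq: "?a \<le> p" "p \<le> q" "q \<le> t"
    have vg: "\<bar>v q'\<bar> \<le> \<bar>v p\<bar> + (LBINT \<tau>:{p..q'}. \<gamma> \<tau>) / \<epsilon>" if "p \<le> q'" "q' \<le> t" for q'
    proof -
      have "\<bar>v q' - v p\<bar> \<le> (LBINT \<tau>:{p..q'}. \<gamma> \<tau>) / \<epsilon>"
        using incr[of p q'] that pq t by (simp add: v_def vel_def)
      then show ?thesis by linarith
    qed
    have Sm: "S q \<le> S s" if "s \<in> {p..q}" for s
      unfolding S_def by (rule surv_antimono[OF D(3)]) (use that pq in auto)
    \<comment> \<open>Survival decreases, so \<open>S q\<close> may be replaced by the larger
      \<open>S \<tau>\<close> under the integral.\<close>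
    have "S q * (LBINT \<tau>:{p..q}. \<gamma> \<tau>) = (LBINT \<tau>:{p..q}. \<gamma> \<tau> * S q)" by simp
    also have "\<dots> \<le> (LBINT \<tau>:{p..q}. \<gamma> \<tau> * S \<tau>)"
      by (intro set_integral_mono set_integrable_mult_left g gS mult_left_mono Sm \<gamma>0)
    also have "\<dots> = integral {p..q} (\<lambda>s. \<gamma> s * S s)" by (rule set_borel_integral_eq_integral(2)[OF gS])
    finally have e1: "S q * (LBINT \<tau>:{p..q}. \<gamma> \<tau>) / \<epsilon> \<le> integral {p..q} (\<lambda>s. \<gamma> s * S s) / \<epsilon>"
      using eps by (intro divide_right_mono) auto
    have "S q * \<bar>v q\<bar> \<le> S q * (\<bar>v p\<bar> + (LBINT \<tau>:{p..q}. \<gamma> \<tau>) / \<epsilon>)"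
      unfolding S_def using pq by (intro mult_left_mono vg less_imp_le[OF surv_bounds(1)]) auto
    with e1 have e2: "S q * \<bar>v q\<bar> \<le> S q * \<bar>v p\<bar> + integral {p..q} (\<lambda>s. \<gamma> s * S s) / \<epsilon>"
      by (simp add: algebra_simps)
    have SI: "integral {p..q} (\<lambda>s. S s * \<zeta> (v s)) = \<epsilon> * (S p - S q)"
      using surv_integral[OF D(3) pq(1,2)] by (simp add: S_def v_def mult.commute)
    have Si: "(\<lambda>s. S s * \<zeta> (v s)) integrable_on {p..q}"
      using pq by (intro integrable_continuous_real continuous_intros zc continuous_on_subset[OF Sc]) auto
    \<comment> \<open>Freezing \<open>\<bar>v\<bar>\<close> at the left end \<open>p\<close> makes
      the integral explicit by \<open>SI\<close>; the error is the growth of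
      \<open>\<bar>v\<bar>\<close>, of order \<open>q - p\<close>, over a length
      \<open>q - p\<close>.\<close>
    have "integral {p..q} (\<lambda>s. S s * (\<zeta> (v s) * \<bar>v s\<bar>)) \<le> integral {p..q} (\<lambda>s. (S s * \<zeta> (v s)) * \<bar>v p\<bar> + C * (\<Gamma> * (q - p) / \<epsilon>))"
    proof (rule integral_le)
      show "(\<lambda>s. S s * (\<zeta> (v s) * \<bar>v s\<bar>)) integrable_on {p..q}" using pq by (intro fi)
      show "(\<lambda>s. (S s * \<zeta> (v s)) * \<bar>v p\<bar> + C * (\<Gamma> * (q - p) / \<epsilon>)) integrable_on {p..q}"
        using pq by (intro integrable_continuous_real continuous_intros zc continuous_on_subset[OF Sc]) auto
      fix s assume s: "s \<in> {p..q}"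
      have "(LBINT \<tau>:{p..s}. \<gamma> \<tau>) \<le> (LBINT \<tau>:{p..s}. \<Gamma>)"
        by (intro set_integral_mono g \<Gamma> set_integrable_bounded_borel[of _ _ _ \<Gamma>]) (use G0 in auto)
      also have "\<dots> = \<Gamma> * (s - p)" using s by (simp add: set_lebesgue_integral_def)
      also have "\<dots> \<le> \<Gamma> * (q - p)" using s G0 by (intro mult_left_mono) auto
      finally have "(LBINT \<tau>:{p..s}. \<gamma> \<tau>) / \<epsilon> \<le> \<Gamma> * (q - p) / \<epsilon>" using eps by (intro divide_right_mono) auto
      then have "\<bar>v s\<bar> \<le> \<bar>v p\<bar> + \<Gamma> * (q - p) / \<epsilon>" using vg[of s] s pq by auto
      then have "(S s * \<zeta> (v s)) * \<bar>v s\<bar> \<le> (S s * \<zeta> (v s)) * (\<bar>v p\<bar> + \<Gamma> * (q - p) / \<epsilon>)"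
        unfolding S_def by (intro mult_left_mono mult_nonneg_nonneg less_imp_le[OF surv_bounds(1)] zeta_nonneg)
      also have "\<dots> \<le> (S s * \<zeta> (v s)) * \<bar>v p\<bar> + C * (\<Gamma> * (q - p) / \<epsilon>)"
      proof -
        have "S s * \<zeta> (v s) \<le> 1 * C"
          unfolding S_def by (intro mult_mono surv_bounds zC zeta_nonneg) auto
        then have "(S s * \<zeta> (v s)) * (\<Gamma> * (q - p) / \<epsilon>) \<le> C * (\<Gamma> * (q - p) / \<epsilon>)"
          using G0 eps pq by (intro mult_right_mono) auto
        then show ?thesis by (simp add: distrib_left)
      qed
      finally show "S s * (\<zeta> (v s) * \<bar>v s\<bar>) \<le> (S s * \<zeta> (v s)) * \<bar>v p\<bar> + C * (\<Gamma> * (q - p) / \<epsilon>)"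
        by (simp add: mult.assoc)
    qed
    also have "\<dots> = \<epsilon> * (S p - S q) * \<bar>v p\<bar> + C * (\<Gamma> * (q - p) / \<epsilon>) * (q - p)"
      using pq Si by (subst Henstock_Kurzweil_Integration.integral_add) (auto simp: SI intro!: integrable_on_mult_left)
    finally have "integral {p..q} (\<lambda>s. S s * (\<zeta> (v s) * \<bar>v s\<bar>)) / \<epsilon>
        \<le> (\<epsilon> * (S p - S q) * \<bar>v p\<bar> + C * (\<Gamma> * (q - p) / \<epsilon>) * (q - p)) / \<epsilon>"
      using eps by (intro divide_right_mono) auto
    also have "\<dots> = (S p - S q) * \<bar>v p\<bar> + C * \<Gamma> / \<epsilon>\<^sup>2 * (q - p)\<^sup>2"
      using eps by (simp add: field_simps power2_eq_square)
    finally have e3: "integral {p..q} (\<lambda>s. S s * (\<zeta> (v s) * \<bar>v s\<bar>)) / \<epsilon> \<le> (S p - S q) * \<bar>v p\<bar> + C * \<Gamma> / \<epsilon>\<^sup>2 * (q - p)\<^sup>2" .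
    have c1: "integral {?a..q} (\<lambda>s. S s * (\<zeta> (v s) * \<bar>v s\<bar>)) = integral {?a..p} (\<lambda>s. S s * (\<zeta> (v s) * \<bar>v s\<bar>)) + integral {p..q} (\<lambda>s. S s * (\<zeta> (v s) * \<bar>v s\<bar>))"
      using pq by (intro Henstock_Kurzweil_Integration.integral_combine[symmetric] fi) auto
    have c2: "integral {?a..q} (\<lambda>s. \<gamma> s * S s) = integral {?a..p} (\<lambda>s. \<gamma> s * S s) + integral {p..q} (\<lambda>s. \<gamma> s * S s)"
      using pq by (intro Henstock_Kurzweil_Integration.integral_combine[symmetric] gi) auto
    \<comment> \<open>The terms \<open>S q * \<bar>v p\<bar>\<close> and
      \<open>(S p - S q) * \<bar>v p\<bar>\<close> add up to \<open>S p * \<bar>v p\<bar>\<close>,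
      so only the quadratic error remains.\<close>
    show "u q - u p \<le> C * \<Gamma> / \<epsilon>\<^sup>2 * (q - p)\<^sup>2"
      unfolding u_def c1 c2 using e2 e3 by (simp add: algebra_simps add_divide_distrib)
  qed
  moreover have "u ?a = \<bar>vel G ?a x\<bar>" unfolding u_def by (simp add: S_def v_def surv_init[OF D(3)])
  moreover have "(LBINT s:{?a..t}. S s * (\<zeta> (v s) * \<bar>v s\<bar>)) = integral {?a..t} (\<lambda>s. S s * (\<zeta> (v s) * \<bar>v s\<bar>))"
    by (intro set_borel_integral_eq_integral(2) borel_integrable_atLeastAtMost' continuous_intros zc vc Sc)
  moreover have "(LBINT s:{?a..t}. \<gamma> s * surv G s x) = integral {?a..t} (\<lambda>s. \<gamma> s * S s)"
    using set_borel_integral_eq_integral(2)[OF gS, of ?a t] unfolding S_def .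
  ultimately show ?thesis using surv_init[OF D(3), of x] unfolding u_def by (simp add: S_def v_def)
qed

text \<open>Comes from \<open>abs_vel_decay\<close>, weighted with the density at entry and
  integrated over labels; two uses of \<open>mom_swap\<close> produce the dissipation on the left
  and the production by the source on the right.\<close>

lemma abs_moment_inequality:
  assumes a: "admissible B M G b" and b0: "\<And>s. 0 \<le> b s" and \<gamma>[measurable]: "\<gamma> \<in> borel_measurable borel"
    and \<gamma>0: "\<And>s. 0 \<le> \<gamma> s" and \<Gamma>: "\<And>s. \<gamma> s \<le> \<Gamma>"
    and incr: "\<And>s t. 0 \<le> s \<Longrightarrow> s \<le> t \<Longrightarrow> t \<le> T \<Longrightarrow> \<bar>G t - G s\<bar> \<le> (LBINT \<tau>:{s..t}. \<gamma> \<tau>) / \<epsilon>"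
    and init: "G 0 = 0" and t: "t \<in> {0..T}"
  shows "\<epsilon> * mom (\<lambda>u. \<bar>u\<bar>) G b t + (LBINT s:{0..t}. mom (\<lambda>u. \<zeta> u * \<bar>u\<bar>) G b s)
    \<le> (LBINT x:{..0}. r0 x * \<bar>h0 x\<bar>) + (LBINT s:{0..t}. \<gamma> s * mom (\<lambda>_. 1) G b s)"
proof -
  let ?A1 = "\<lambda>x. wt b x * surv G t x * \<bar>vel G t x\<bar>"
  let ?A2 = "\<lambda>x. wt b x * (LBINT s:{max x 0..t}. 1 * (surv G s x * (\<zeta> (vel G s x) * \<bar>vel G s x\<bar>)))"
  let ?A3 = "\<lambda>x. indicat_real {..0} x *\<^sub>R (r0 x * \<bar>h0 x\<bar>)"
  let ?A4 = "\<lambda>x. wt b x * (LBINT s:{max x 0..t}. \<gamma> s * (surv G s x * 1))"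
  have wt0: "0 \<le> wt b x" for x using b0 r0_nonneg by (simp add: wt_def)
  have G: "\<bar>\<gamma> s\<bar> \<le> \<Gamma>" for s using \<gamma>0[of s] \<Gamma>[of s] by simp
  have i1: "set_integrable lborel {..t} ?A1" by (rule integrand_integrable[OF a quad_growth_abs]) (use t in auto)
  note s2 = mom_swap[OF a quad_growth_zeta_abs, of "\<lambda>_. 1" 1, OF _ _ t]
  have i2: "set_integrable lborel {..t} ?A2" by (rule s2(1)) auto
  have i3: "set_integrable lborel {..t} ?A3"
    unfolding set_integrable_def
  proof (rule Bochner_Integration.integrable_bound)
    show "integrable lborel ?A3"
      using r0_integrable[of abs] by (simp add: set_integrable_def power2_eq_square algebra_simps)
  qed (auto simp: indicator_def)
  note s4 = mom_swap[OF a quad_growth_const \<gamma> G t]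
  have i2': "set_integrable lborel {..t} (\<lambda>x. ?A2 x / \<epsilon>)" by (intro set_integrable_divide i2)
  have i4': "set_integrable lborel {..t} (\<lambda>x. ?A4 x / \<epsilon>)" by (intro set_integrable_divide s4(1))
  have "(LBINT x:{..t}. ?A1 x + ?A2 x / \<epsilon>) \<le> (LBINT x:{..t}. ?A3 x + ?A4 x / \<epsilon>)"
  proof (rule set_integral_mono)
    show "set_integrable lborel {..t} (\<lambda>x. ?A1 x + ?A2 x / \<epsilon>)"
      by (intro set_integral_add(1) set_integrable_divide i1 i2)
    show "set_integrable lborel {..t} (\<lambda>x. ?A3 x + ?A4 x / \<epsilon>)"
      by (intro set_integral_add(1) set_integrable_divide i3 s4(1))
    fix x assume x: "x \<in> {..t}"
    have "surv G t x * \<bar>vel G t x\<bar> + (LBINT s:{max x 0..t}. surv G s x * (\<zeta> (vel G s x) * \<bar>vel G s x\<bar>)) / \<epsilon>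
      \<le> \<bar>vel G (max x 0) x\<bar> + (LBINT s:{max x 0..t}. \<gamma> s * surv G s x) / \<epsilon>"
      by (rule abs_vel_decay[OF a \<gamma> \<gamma>0 \<Gamma> incr]) (use x t in auto)
    from mult_left_mono[OF this wt0[of x]]
    have "?A1 x + ?A2 x / \<epsilon> \<le> wt b x * \<bar>vel G (max x 0) x\<bar> + ?A4 x / \<epsilon>" by (simp add: algebra_simps)
    \<comment> \<open>Newborns enter with velocity 0, and \<open>G 0 = 0\<close> gives initial
      labels the velocity \<open>- h0 x\<close>; births therefore do not feed the moment.\<close>
    also have "wt b x * \<bar>vel G (max x 0) x\<bar> = ?A3 x"
      using init by (auto simp: vel_def lab_def wt_def)
    finally show "?A1 x + ?A2 x / \<epsilon> \<le> ?A3 x + ?A4 x / \<epsilon>" .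
  qed
  moreover have "(LBINT x:{..t}. ?A1 x + ?A2 x / \<epsilon>) = (LBINT x:{..t}. ?A1 x) + (LBINT x:{..t}. ?A2 x) / \<epsilon>"
    unfolding set_integral_add(2)[OF i1 i2'] set_integral_divide_zero ..
  moreover have "(LBINT x:{..t}. ?A3 x + ?A4 x / \<epsilon>) = (LBINT x:{..t}. ?A3 x) + (LBINT x:{..t}. ?A4 x) / \<epsilon>"
    unfolding set_integral_add(2)[OF i3 i4'] set_integral_divide_zero ..
  moreover have "(LBINT x:{..t}. ?A1 x) = \<epsilon> * mom (\<lambda>u. \<bar>u\<bar>) G b t" using eps by (simp add: mom_def)
  moreover have "(LBINT x:{..t}. ?A2 x) = \<epsilon> * (LBINT s:{0..t}. mom (\<lambda>u. \<zeta> u * \<bar>u\<bar>) G b s)"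
    using s2(2) by simp
  moreover have "(LBINT x:{..t}. ?A3 x) = (LBINT x:{..0}. r0 x * \<bar>h0 x\<bar>)"
    unfolding set_lebesgue_integral_def using t by (intro Bochner_Integration.integral_cong) (auto simp: indicator_def)
  moreover note s4(2)
  ultimately show ?thesis using eps by simp
qed

end

section \<open>The Volterra system for the total mass and the primitive of the source\<close>

lemma LBINT_bounded_borel:
  fixes g :: "real \<Rightarrow> real"
  assumes g: "g \<in> borel_measurable borel" and b: "\<And>s. s \<in> {0..T} \<Longrightarrow> \<bar>g s\<bar> \<le> C"
  shows "continuous_on {0..T} (\<lambda>t. LBINT s:{0..t}. g s)"
    and "0 \<le> s \<Longrightarrow> s \<le> t \<Longrightarrow> t \<le> T \<Longrightarrow> (LBINT s:{0..t}. g s) - (LBINT s:{0..s}. g s) = (LBINT s:{s..t}. g s)"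
    and "0 \<le> s \<Longrightarrow> s \<le> t \<Longrightarrow> t \<le> T \<Longrightarrow> \<bar>LBINT s:{s..t}. g s\<bar> \<le> C * (t - s)"
proof -
  have i: "set_integrable lborel {s..t} g" if "0 \<le> s" "t \<le> T" for s t
    by (rule set_integrable_bounded_borel[OF g, of _ _ C]) (use b that in auto)
  note HK = set_borel_integral_eq_integral[OF i]
  have "continuous_on {0..T} (\<lambda>t. integral {0..t} g)"
    by (cases "0 \<le> T") (auto intro!: indefinite_integral_continuous_1 HK(1))
  then show "continuous_on {0..T} (\<lambda>t. LBINT s:{0..t}. g s)"
    by (rule continuous_on_eq) (use HK(2)[of 0] in auto)
  show "(LBINT s:{0..t}. g s) - (LBINT s:{0..s}. g s) = (LBINT s:{s..t}. g s)" if "0 \<le> s" "s \<le> t" "t \<le> T"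
    using that Henstock_Kurzweil_Integration.integral_combine[OF that(1,2) HK(1)[OF order_refl that(3)]] by (simp add: HK(2))
  show "\<bar>LBINT s:{s..t}. g s\<bar> \<le> C * (t - s)" if st: "0 \<le> s" "s \<le> t" "t \<le> T"
  proof -
    have "norm (integral {s..t} g) \<le> integral {s..t} (\<lambda>_. C)"
      by (rule Henstock_Kurzweil_Integration.integral_norm_bound_integral) (use st b HK(1) in auto)
    then show ?thesis using st by (simp add: HK(2) mult.commute)
  qed
qed

lemma quotient_diff_le:
  fixes a b p q m :: real
  assumes m: "0 < m" "m \<le> \<bar>p\<bar>" "m \<le> \<bar>q\<bar>"
  shows "\<bar>a / p - b / q\<bar> \<le> \<bar>a - b\<bar> / m + \<bar>b\<bar> * \<bar>p - q\<bar> / m\<^sup>2"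
proof -
  have nz: "p \<noteq> 0" "q \<noteq> 0" using m by auto
  have "a / p - b / q = (a - b) / p + b * (q - p) / (p * q)" using nz by (simp add: field_simps)
  then have "\<bar>a / p - b / q\<bar> \<le> \<bar>a - b\<bar> / \<bar>p\<bar> + \<bar>b\<bar> * \<bar>p - q\<bar> / (\<bar>p\<bar> * \<bar>q\<bar>)"
    using abs_triangle_ineq[of "(a - b) / p" "b * (q - p) / (p * q)"] by (simp add: abs_mult abs_divide abs_minus_commute)
  also have "\<dots> \<le> \<bar>a - b\<bar> / m + \<bar>b\<bar> * \<bar>p - q\<bar> / (m * m)"
    using m by (intro add_mono divide_left_mono mult_mono mult_pos_pos) auto
  finally show ?thesis by (simp add: power2_eq_square)
qed

definition clip :: "real \<Rightarrow> real \<Rightarrow> real" where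
  "clip K u = max (- K) (min K u)"

lemma clip_simps:
  "0 \<le> K \<Longrightarrow> \<bar>clip K u\<bar> \<le> K" "\<bar>clip K u - clip K w\<bar> \<le> \<bar>u - w\<bar>" "\<bar>u\<bar> \<le> K \<Longrightarrow> clip K u = u"
  "0 \<le> K \<Longrightarrow> \<bar>clip K u\<bar> \<le> \<bar>u\<bar>"
  by (auto simp: clip_def)

lemma clip_borel[measurable]: "clip K \<in> borel_measurable borel"
  unfolding clip_def[abs_def] by measurable

context age_transport begin

abbreviation kk :: "real \<Rightarrow> real" where "kk u \<equiv> \<zeta> u * u"

section \<open>Lipschitz estimate for the source, and uniqueness\<close>

definition srcC :: "real \<Rightarrow> real \<Rightarrow> real \<Rightarrow> real \<Rightarrow> real" where
  "srcC B M N m = diffC B M * Z * (1 + 2 * T) / (\<epsilon> * m) + N / m\<^sup>2"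

text \<open>Serves the truncated system, with \<kappa> a \<open>clip\<close> and the denominators
  cut off from below, as well as uniqueness, with \<kappa> the identity. Integration in time absorbs
  the instantaneous term of \<open>mom_diff\<close>, which yields the Volterra form.\<close>

lemma source_diff:
  assumes a1: "admissible B M G1 b1" and a2: "admissible B M G2 b2"
    and d: "continuous_on {0..T} d" and d0: "\<And>s. s \<in> {0..T} \<Longrightarrow> 0 \<le> d s"
    and dG: "\<And>s. s \<in> {0..T} \<Longrightarrow> \<bar>G1 s - G2 s\<bar> \<le> d s"
    and db: "\<And>s. s \<in> {0..T} \<Longrightarrow> \<bar>b1 s - b2 s\<bar> \<le> B * d s"
    and dq: "\<And>s. s \<in> {0..T} \<Longrightarrow> \<bar>q1 s - q2 s\<bar> \<le> d s"
    and m: "0 < m" "\<And>s. m \<le> \<bar>q1 s\<bar>" "\<And>s. m \<le> \<bar>q2 s\<bar>"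
    and [measurable]: "q1 \<in> borel_measurable borel" "q2 \<in> borel_measurable borel" "D \<in> borel_measurable borel"
      "\<kappa> \<in> borel_measurable borel"
    and \<kappa>: "\<And>u w. \<bar>\<kappa> u - \<kappa> w\<bar> \<le> \<bar>u - w\<bar>"
    and N: "\<And>s. s \<in> {0..T} \<Longrightarrow> \<bar>D s + \<kappa> (mom kk G1 b1 s) / \<epsilon>\<bar> \<le> N"
      "\<And>s. s \<in> {0..T} \<Longrightarrow> \<bar>D s + \<kappa> (mom kk G2 b2 s) / \<epsilon>\<bar> \<le> N"
    and t: "t \<in> {0..T}"
  shows "\<bar>(LBINT s:{0..t}. (D s + \<kappa> (mom kk G1 b1 s) / \<epsilon>) / q1 s) - (LBINT s:{0..t}. (D s + \<kappa> (mom kk G2 b2 s) / \<epsilon>) / q2 s)\<bar>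
    \<le> srcC B M N m * integral {0..t} d"
proof -
  note D1 = admissibleD[OF a1] and D2 = admissibleD[OF a2]
  note [measurable] = D1(5,7) D2(5,7)
  let ?f1 = "\<lambda>s. (D s + \<kappa> (mom kk G1 b1 s) / \<epsilon>) / q1 s" and ?f2 = "\<lambda>s. (D s + \<kappa> (mom kk G2 b2 s) / \<epsilon>) / q2 s"
  let ?I = "integral {0..t} d"
  let ?c = "diffC B M * Z"
  have c0: "0 \<le> ?c" using diffC_nonneg[OF D1(1,2)] Z_nonneg by simp
  have di: "d integrable_on {a..s}" if "0 \<le> a" "s \<le> T" for a s
    using that by (intro integrable_continuous_real continuous_on_subset[OF d]) auto
  have I0: "0 \<le> ?I" using t d0 by (intro Henstock_Kurzweil_Integration.integral_nonneg di) auto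
  have N0: "0 \<le> N" using N(1)[of 0] T by auto
  have fb: "\<bar>?f1 s\<bar> \<le> N / m" "\<bar>?f2 s\<bar> \<le> N / m" if "s \<in> {0..T}" for s
    unfolding abs_divide using N[OF that] m(1) m(2,3)[of s] N0 by (intro frac_le; auto)+
  have i: "set_integrable lborel {0..t} ?f1" "set_integrable lborel {0..t} ?f2"
    by (intro set_integrable_bounded_borel[of _ _ _ "N / m"]; use fb t in \<open>auto\<close>)+
  have pt: "\<bar>?f1 s - ?f2 s\<bar> \<le> (?c / (\<epsilon> * m) + N / m\<^sup>2) * d s + ?c * (2 * ?I) / (\<epsilon> * m)" if s: "s \<in> {0..t}" for s
  proof -
    have sT: "s \<in> {0..T}" using s t by auto
    have Is: "integral {0..s} d \<le> ?I" using s t d0 by (intro integral_subset_le di) auto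
    have "\<bar>\<kappa> (mom kk G1 b1 s) - \<kappa> (mom kk G2 b2 s)\<bar> \<le> \<bar>mom kk G1 b1 s - mom kk G2 b2 s\<bar>" by (rule \<kappa>)
    also have "\<dots> \<le> diffC B M * (Z * integral {0..s} d + Z * (d s + integral {0..s} d))"
      by (rule mom_diff[OF a1 a2 quad_growth_kk d d0 dG db sT])
    also have "\<dots> = ?c * (d s + 2 * integral {0..s} d)" by (simp add: algebra_simps)
    also have "\<dots> \<le> ?c * (d s + 2 * ?I)" using c0 Is by (intro mult_left_mono) auto
    finally have "\<bar>\<kappa> (mom kk G1 b1 s) - \<kappa> (mom kk G2 b2 s)\<bar> / \<epsilon> \<le> ?c * (d s + 2 * ?I) / \<epsilon>"
      using eps by (intro divide_right_mono) auto
    then have k: "\<bar>(D s + \<kappa> (mom kk G1 b1 s) / \<epsilon>) - (D s + \<kappa> (mom kk G2 b2 s) / \<epsilon>)\<bar> \<le> ?c * (d s + 2 * ?I) / \<epsilon>"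
      using eps by (simp add: diff_divide_distrib[symmetric] abs_divide)
    have "\<bar>?f1 s - ?f2 s\<bar> \<le> ?c * (d s + 2 * ?I) / \<epsilon> / m + N * d s / m\<^sup>2"
      using m(1) N(2)[OF sT] dq[OF sT] N0 k
      by (intro order_trans[OF quotient_diff_le[OF m(1) m(2)[of s] m(3)[of s]]] add_mono divide_right_mono mult_mono) auto
    also have "\<dots> = (?c / (\<epsilon> * m) + N / m\<^sup>2) * d s + ?c * (2 * ?I) / (\<epsilon> * m)"
      using eps m(1) by (simp add: field_simps)
    finally show ?thesis .
  qed
  have "(LBINT s:{0..t}. ?f1 s) - (LBINT s:{0..t}. ?f2 s) = integral {0..t} (\<lambda>s. ?f1 s - ?f2 s)"
    by (simp add: set_integral_diff(2)[OF i, symmetric] set_borel_integral_eq_integral(2)[OF set_integral_diff(1)[OF i]])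
  moreover have "norm (integral {0..t} (\<lambda>s. ?f1 s - ?f2 s)) \<le> integral {0..t} (\<lambda>s. (?c / (\<epsilon> * m) + N / m\<^sup>2) * d s + ?c * (2 * ?I) / (\<epsilon> * m))"
    using t pt by (intro Henstock_Kurzweil_Integration.integral_norm_bound_integral set_borel_integral_eq_integral(1)[OF set_integral_diff(1)[OF i]]
        integrable_continuous_real continuous_intros continuous_on_subset[OF d]) auto
  moreover have "\<dots> = (?c / (\<epsilon> * m) + N / m\<^sup>2) * ?I + ?c * (2 * ?I) / (\<epsilon> * m) * t"
    using t by (subst Henstock_Kurzweil_Integration.integral_add) (auto intro!: di integrable_on_mult_right)
  moreover have "\<dots> \<le> (?c / (\<epsilon> * m) + N / m\<^sup>2) * ?I + ?c * (2 * ?I) / (\<epsilon> * m) * T"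
    using t c0 I0 eps m(1) by (intro add_left_mono mult_left_mono) auto
  moreover have "\<dots> = srcC B M N m * ?I" by (simp add: srcC_def algebra_simps add_divide_distrib)
  ultimately show ?thesis by simp
qed

lemma srcC_nonneg: "0 \<le> B \<Longrightarrow> 0 \<le> M \<Longrightarrow> 0 \<le> N \<Longrightarrow> 0 < m \<Longrightarrow> 0 \<le> srcC B M N m"
  unfolding srcC_def using diffC_nonneg[of B M] Z_nonneg eps T by auto

text \<open>The masses are bounded away from 0 in modulus only, since the sign of a competitor's
  mass is not known beforehand. Gronwall's inequality is applied to \<open>d\<close>, the sum of
  both differences.\<close>

lemma system_unique:
  assumes a1: "admissible B M G1 b1" and a2: "admissible B M G2 b2"
    and \<mu>c: "continuous_on UNIV \<mu>1" "continuous_on UNIV \<mu>2"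
    and db: "\<And>s. s \<in> {0..T} \<Longrightarrow> \<bar>b1 s - b2 s\<bar> \<le> B * \<bar>\<mu>1 s - \<mu>2 s\<bar>"
    and m: "0 < m" "\<And>s. m \<le> \<bar>\<mu>1 s\<bar>" "\<And>s. m \<le> \<bar>\<mu>2 s\<bar>"
    and D: "D \<in> borel_measurable borel" "\<And>s. \<bar>D s\<bar> \<le> Dm"
    and e1: "\<And>t. t \<in> {0..T} \<Longrightarrow> \<mu>1 t = mom (\<lambda>_. 1) G1 b1 t"
      "\<And>t. t \<in> {0..T} \<Longrightarrow> G1 t = (LBINT s:{0..t}. (D s + mom kk G1 b1 s / \<epsilon>) / \<mu>1 s)"
    and e2: "\<And>t. t \<in> {0..T} \<Longrightarrow> \<mu>2 t = mom (\<lambda>_. 1) G2 b2 t"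
      "\<And>t. t \<in> {0..T} \<Longrightarrow> G2 t = (LBINT s:{0..t}. (D s + mom kk G2 b2 s / \<epsilon>) / \<mu>2 s)"
    and t: "t \<in> {0..T}"
  shows "G1 t = G2 t \<and> \<mu>1 t = \<mu>2 t"
proof -
  note D1 = admissibleD[OF a1] and D2 = admissibleD[OF a2]
  define d where "d = (\<lambda>s. \<bar>G1 s - G2 s\<bar> + \<bar>\<mu>1 s - \<mu>2 s\<bar>)"
  have dc: "continuous_on S d" for S
    unfolding d_def using continuous_on_subset[OF D1(3)] continuous_on_subset[OF D2(3)] \<mu>c[THEN continuous_on_subset]
    by (intro continuous_intros) auto
  define N where "N = Dm + (Z * J B M / \<epsilon>) / \<epsilon>"
  have Nb: "\<bar>D s + mom kk G b s / \<epsilon>\<bar> \<le> N" if "admissible B M G b" "s \<in> {0..T}" for G b s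
  proof -
    have "\<bar>mom kk G b s\<bar> / \<epsilon> \<le> (Z * J B M / \<epsilon>) / \<epsilon>"
      using mom_bound[OF that(1) quad_growth_kk, of s] that(2) eps by (intro divide_right_mono) auto
    then show ?thesis using D(2)[of s] abs_triangle_ineq[of "D s" "mom kk G b s / \<epsilon>"] eps by (simp add: N_def abs_divide)
  qed
  have N0: "0 \<le> N" using Nb[OF a1, of 0] T by auto
  define C where "C = srcC B M N m + diffC B M"
  have C0: "0 \<le> C" unfolding C_def using srcC_nonneg[OF D1(1,2) N0 m(1)] diffC_nonneg[OF D1(1,2)] by simp
  have "d s \<le> 0 + C * integral {0..s} d" if s: "s \<in> {0..T}" for s
  proof -
    have db': "\<bar>b1 s - b2 s\<bar> \<le> B * d s" if "s \<in> {0..T}" for s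
      by (rule order_trans[OF db[OF that] mult_left_mono]) (use D1(1) in \<open>auto simp: d_def\<close>)
    have "\<bar>G1 s - G2 s\<bar> \<le> srcC B M N m * integral {0..s} d"
      unfolding e1(2)[OF s] e2(2)[OF s]
      by (rule source_diff[OF a1 a2 dc _ _ db' _ m _ _ D(1), where \<kappa>="\<lambda>u. u"])
        (use Nb[OF a1] Nb[OF a2] s \<mu>c in \<open>auto simp: d_def intro: borel_measurable_continuous_onI\<close>)
    moreover have "\<bar>\<mu>1 s - \<mu>2 s\<bar> \<le> diffC B M * (1 * integral {0..s} d + 0 * (d s + integral {0..s} d))"
      unfolding e1(1)[OF s] e2(1)[OF s]
      by (rule mom_diff[OF a1 a2 quad_growth_const dc _ _ db' s]) (auto simp: d_def)
    ultimately show ?thesis by (simp add: d_def[of] C_def algebra_simps)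
  qed
  from gronwall[OF dc C0 this t] have "d t \<le> 0" by simp
  then show ?thesis unfolding d_def by (intro conjI) linarith+
qed


section \<open>A priori bounds\<close>

lemma mom_zeta_bounds:
  assumes a: "admissible B M G b" and b0: "\<And>s. 0 \<le> b s" and t: "t \<le> T"
    and lip: "\<And>u. \<bar>\<zeta> u - \<zeta> 0\<bar> \<le> \<zeta>Lip * \<bar>u\<bar>"
  shows "0 \<le> mom (\<lambda>_. 1) G b t" "0 \<le> mom \<zeta> G b t" "\<bar>mom kk G b t\<bar> \<le> mom (\<lambda>u. \<zeta> u * \<bar>u\<bar>) G b t"
    "mom \<zeta> G b t \<le> \<zeta> 0 * mom (\<lambda>_. 1) G b t + \<zeta>Lip * mom (\<lambda>u. \<bar>u\<bar>) G b t"
proof -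
  have w: "0 \<le> wt b x * surv G t x" for x
    using b0 r0_nonneg surv_bounds(1)[of G t x] by (auto simp: wt_def)
  note I = integrand_integrable[OF a _ t]
  show "0 \<le> mom (\<lambda>_. 1) G b t" "0 \<le> mom \<zeta> G b t"
    unfolding mom_def set_lebesgue_integral_def using w zeta_nonneg eps
    by (auto intro!: divide_nonneg_pos Bochner_Integration.integral_nonneg mult_nonneg_nonneg)
  have "\<bar>LBINT x:{..t}. wt b x * surv G t x * kk (vel G t x)\<bar> \<le> (LBINT x:{..t}. wt b x * surv G t x * (\<zeta> (vel G t x) * \<bar>vel G t x\<bar>))"
    unfolding set_lebesgue_integral_def
  proof (rule order_trans[OF integral_abs_bound], rule integral_mono)
    show "integrable lborel (\<lambda>x. \<bar>indicat_real {..t} x *\<^sub>R (wt b x * surv G t x * kk (vel G t x))\<bar>)"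
      using I[OF quad_growth_kk] unfolding set_integrable_def by (rule integrable_abs)
    show "integrable lborel (\<lambda>x. indicat_real {..t} x *\<^sub>R (wt b x * surv G t x * (\<zeta> (vel G t x) * \<bar>vel G t x\<bar>)))"
      using I[OF quad_growth_zeta_abs] unfolding set_integrable_def .
    fix x
    have "\<bar>wt b x * surv G t x * kk (vel G t x)\<bar> = wt b x * surv G t x * (\<zeta> (vel G t x) * \<bar>vel G t x\<bar>)"
      using w[of x] zeta_nonneg by (simp add: abs_mult[of "wt b x * surv G t x"] abs_mult[of "\<zeta> _"])
    then show "\<bar>indicat_real {..t} x *\<^sub>R (wt b x * surv G t x * kk (vel G t x))\<bar>
       \<le> indicat_real {..t} x *\<^sub>R (wt b x * surv G t x * (\<zeta> (vel G t x) * \<bar>vel G t x\<bar>))"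
      by (simp add: abs_mult[of "indicat_real _ _"])
  qed
  then show "\<bar>mom kk G b t\<bar> \<le> mom (\<lambda>u. \<zeta> u * \<bar>u\<bar>) G b t"
    unfolding mom_def using eps by (simp add: abs_divide divide_right_mono)
  let ?r = "\<lambda>x. wt b x * surv G t x"
  have i1: "set_integrable lborel {..t} (\<lambda>x. \<zeta> 0 * (?r x * 1))" and i2: "set_integrable lborel {..t} (\<lambda>x. \<zeta>Lip * (?r x * \<bar>vel G t x\<bar>))"
    by (intro set_integrable_mult_right I[OF quad_growth_const] I[OF quad_growth_abs])+
  have "(LBINT x:{..t}. ?r x * \<zeta> (vel G t x)) \<le> (LBINT x:{..t}. \<zeta> 0 * (?r x * 1) + \<zeta>Lip * (?r x * \<bar>vel G t x\<bar>))"
  proof (rule set_integral_mono)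
    show "set_integrable lborel {..t} (\<lambda>x. ?r x * \<zeta> (vel G t x))" by (rule I[OF quad_growth_zeta])
    show "set_integrable lborel {..t} (\<lambda>x. \<zeta> 0 * (?r x * 1) + \<zeta>Lip * (?r x * \<bar>vel G t x\<bar>))"
      by (rule set_integral_add(1)[OF i1 i2])
    fix x
    \<comment> \<open>Here \<open>\<zeta>Lip\<close> enters rather than \<open>L\<close>; the
      resulting bound on deaths is compared with the births when the mass is small.\<close>
    have "\<zeta> (vel G t x) \<le> \<zeta> 0 + \<zeta>Lip * \<bar>vel G t x\<bar>" using lip[of "vel G t x"] by linarith
    from mult_left_mono[OF this w[of x]]
    show "?r x * \<zeta> (vel G t x) \<le> \<zeta> 0 * (?r x * 1) + \<zeta>Lip * (?r x * \<bar>vel G t x\<bar>)" by (simp add: algebra_simps)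
  qed
  also have "\<dots> = \<zeta> 0 * (LBINT x:{..t}. ?r x * 1) + \<zeta>Lip * (LBINT x:{..t}. ?r x * \<bar>vel G t x\<bar>)"
    unfolding set_integral_add(2)[OF i1 i2] by simp
  finally show "mom \<zeta> G b t \<le> \<zeta> 0 * mom (\<lambda>_. 1) G b t + \<zeta>Lip * mom (\<lambda>u. \<bar>u\<bar>) G b t"
    unfolding mom_def using eps by (simp add: field_simps)
qed

lemma mom_initial:
  assumes "continuous_on UNIV G"
  shows "mom (\<lambda>_. 1) G b 0 = (LBINT x:{..0}. r0 x) / \<epsilon>"
proof -
  have "surv G 0 x = 1" if "x \<le> 0" for x
    using surv_init[OF assms, of x] that by (simp add: max_def split: if_splits)
  then have "(LBINT x:{..0}. wt b x * surv G 0 x * 1) = (LBINT x:{..0}. r0 x)"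
    by (intro set_lebesgue_integral_cong) (auto simp: wt_def)
  then show ?thesis by (simp add: mom_def)
qed

text \<open>
  Since \<open>vel G t x + lab G x = G t\<close>, the size of \<open>G t\<close> is controlled by the first moments.
\<close>

lemma primitive_le_moments:
  assumes a: "admissible B M G b" and b0: "\<And>s. 0 \<le> b s" and t: "t \<in> {0..T}"
  shows "\<epsilon> * (\<bar>G t\<bar> * mom (\<lambda>_. 1) G b t)
    \<le> \<epsilon> * mom (\<lambda>u. \<bar>u\<bar>) G b t + (LBINT x:{..0}. r0 x * \<bar>h0 x\<bar>) + B * integral {0..t} (\<lambda>s. \<bar>G s\<bar>)"
proof -
  note D = admissibleD[OF a]
  let ?r = "\<lambda>x. wt b x * surv G t x"
  let ?h = "\<lambda>x. indicat_real {..0} x *\<^sub>R (r0 x * \<bar>h0 x\<bar>) + indicat_real {0..t} x *\<^sub>R (B * \<bar>G x\<bar>)"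
  have tT: "t \<le> T" using t by simp
  have w: "0 \<le> ?r x" for x
    using b0 r0_nonneg surv_bounds(1)[of G t x] by (auto simp: wt_def)
  have gc: "continuous_on S (\<lambda>s. \<bar>G s\<bar>)" for S by (intro continuous_intros continuous_on_subset[OF D(3)]) auto
  have ih: "integrable lborel (\<lambda>x. indicat_real {..0} x *\<^sub>R (r0 x * \<bar>h0 x\<bar>))"
    using r0_integrable[of abs] by (simp add: set_integrable_def power2_eq_square algebra_simps)
  have ig: "integrable lborel (\<lambda>x. indicat_real {0..t} x *\<^sub>R (B * \<bar>G x\<bar>))"
    unfolding set_integrable_def[symmetric]
    by (intro borel_integrable_atLeastAtMost' continuous_on_mult continuous_on_const gc)
  have iH: "set_integrable lborel {..t} ?h"
    unfolding set_integrable_def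
    by (rule Bochner_Integration.integrable_bound[OF Bochner_Integration.integrable_add[OF ih ig]]) 
      (use borel_measurable_integrable[OF ih] borel_measurable_integrable[OF ig] in \<open>auto simp: indicator_def\<close>)
  have i1: "set_integrable lborel {..t} (\<lambda>x. ?r x * 1)" and i2: "set_integrable lborel {..t} (\<lambda>x. ?r x * \<bar>vel G t x\<bar>)"
    by (rule integrand_integrable[OF a quad_growth_const tT] integrand_integrable[OF a quad_growth_abs tT])+
  have "(LBINT x:{..t}. \<bar>G t\<bar> * (?r x * 1)) \<le> (LBINT x:{..t}. ?r x * \<bar>vel G t x\<bar> + ?h x)"
  proof (rule set_integral_mono_AE)
    show "set_integrable lborel {..t} (\<lambda>x. \<bar>G t\<bar> * (?r x * 1))" by (intro set_integrable_mult_right i1)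
    show "set_integrable lborel {..t} (\<lambda>x. ?r x * \<bar>vel G t x\<bar> + ?h x)" by (rule set_integral_add(1)[OF i2 iH])
    show "AE x\<in>{..t} in lborel. \<bar>G t\<bar> * (?r x * 1) \<le> ?r x * \<bar>vel G t x\<bar> + ?h x"
      using AE_lborel_singleton[of 0]
    proof (eventually_elim, safe)
      fix x assume x: "x \<noteq> 0" "x \<le> t"
      have "\<bar>G t\<bar> \<le> \<bar>vel G t x\<bar> + \<bar>lab G x\<bar>" by (simp add: vel_def)
      from mult_left_mono[OF this w[of x]] have "\<bar>G t\<bar> * (?r x * 1) \<le> ?r x * \<bar>vel G t x\<bar> + ?r x * \<bar>lab G x\<bar>"
        by (simp add: algebra_simps)
      \<comment> \<open>Labels are \<open>G x\<close> on newborns, of density at most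
        \<open>B\<close>, and \<open>h0 x\<close> on initial ones; survival is at most 1.\<close>
      also have "?r x * \<bar>lab G x\<bar> \<le> (if 0 < x then B else r0 x) * 1 * \<bar>lab G x\<bar>"
        using D(6)[of x] b0[of x] r0_nonneg surv_bounds[of G t x] D(1)
        by (intro mult_mono mult_right_mono) (auto simp: wt_def)
      also have "\<dots> = ?h x" using x by (auto simp: lab_def indicator_def)
      finally show "\<bar>G t\<bar> * (?r x * 1) \<le> ?r x * \<bar>vel G t x\<bar> + ?h x" by simp
    qed
  qed
  also have "\<dots> = (LBINT x:{..t}. ?r x * \<bar>vel G t x\<bar>) + (LBINT x:{..t}. ?h x)" by (rule set_integral_add(2)[OF i2 iH])
  also have "(LBINT x:{..t}. ?h x) = (LBINT x:{..0}. r0 x * \<bar>h0 x\<bar>) + B * integral {0..t} (\<lambda>s. \<bar>G s\<bar>)"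
  proof -
    have "(LBINT x:{..t}. ?h x) = (\<integral>x. ?h x \<partial>lborel)"
      unfolding set_lebesgue_integral_def using t by (intro Bochner_Integration.integral_cong) (auto simp: indicator_def)
    also have "\<dots> = (LBINT x:{..0}. r0 x * \<bar>h0 x\<bar>) + (LBINT x:{0..t}. B * \<bar>G x\<bar>)"
      unfolding set_lebesgue_integral_def by (rule Bochner_Integration.integral_add[OF ih ig])
    also have "(LBINT x:{0..t}. B * \<bar>G x\<bar>) = integral {0..t} (\<lambda>s. B * \<bar>G s\<bar>)"
      by (rule set_borel_integral_eq_integral(2)) (use ig in \<open>simp add: set_integrable_def\<close>)
    finally show ?thesis by simp
  qed
  finally show ?thesis unfolding mom_def using eps by (simp add: algebra_simps)
qed

section \<open>The truncated system and the removal of the truncations\<close>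

definition cl :: "real \<Rightarrow> real" where
  "cl t = max 0 (min T t)"

lemma cl_in: "cl t \<in> {0..T}" and cl_id: "t \<in> {0..T} \<Longrightarrow> cl t = t" and cl_idem: "cl (cl t) = cl t"
  using T by (auto simp: cl_def)

lemma cl_continuous: "continuous_on S cl"
  unfolding cl_def by (intro continuous_intros)

lemma continuous_cl_compose: "continuous_on {0..T} u \<Longrightarrow> continuous_on S (\<lambda>t. u (cl t))"
  by (rule continuous_on_compose2[OF _ cl_continuous]) (use cl_in in auto)

text \<open>The truncations make the right-hand sides globally Lipschitz, as
  \<open>volterra_fixed_point\<close> demands, for the pair formed by \<open>G\<close> and \<mu>.
  The bound \<open>M\<close> obtained here depends on \<open>K\<close>; \<open>system_exists\<close>
  replaces it by one that does not.\<close>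

lemma truncated_fixed_point:
  assumes \<beta>: "continuous_on {0..T} \<beta>" "\<And>s. s \<in> {0..T} \<Longrightarrow> 0 \<le> \<beta> s \<and> \<beta> s \<le> B"
    and D: "D \<in> borel_measurable borel" "\<And>s. \<bar>D s\<bar> \<le> Dm" and m: "0 < m" and K: "0 \<le> K"
  obtains G \<mu> b M where "admissible B M G b" "b = (\<lambda>s. \<beta> (cl s) * (1 - max 0 (min 1 (\<mu> s))))"
    "continuous_on UNIV \<mu>" "\<And>s. \<mu> s = \<mu> (cl s)" "\<And>s. G s = G (cl s)"
    "\<And>t. t \<in> {0..T} \<Longrightarrow> \<mu> t = mom (\<lambda>_. 1) G b t"
    "\<And>t. t \<in> {0..T} \<Longrightarrow> G t = (LBINT s:{0..t}. (D s + clip K (mom kk G b s) / \<epsilon>) / max m (\<mu> s))"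
proof -
  note [measurable] = D(1)
  define N where "N = Dm + K / \<epsilon>"
  \<comment> \<open>The truncated source is at most \<open>N / m\<close> in modulus, so its
    primitive stays within \<open>M\<close> and the clip of \<open>G\<close> at that level turns out
    to be inactive (\<open>Gb\<close>).\<close>
  define M where "M = N / m * T"
  have N0: "0 \<le> N" using D(2)[of 0] K eps by (simp add: N_def)
  have M0: "0 \<le> M" using N0 m T by (simp add: M_def)
  have B0: "0 \<le> B" using \<beta>(2)[of 0] T by auto
  define Gx where "Gx = (\<lambda>(u::real\<Rightarrow>real\<times>real) s. clip M (fst (u (cl s))))"
  define mx where "mx = (\<lambda>(u::real\<Rightarrow>real\<times>real) s. snd (u (cl s)))"
  define bx where "bx = (\<lambda>(u::real\<Rightarrow>real\<times>real) s. \<beta> (cl s) * (1 - max 0 (min 1 (mx u s))))"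
  define src where "src = (\<lambda>u s. (D s + clip K (mom kk (Gx u) (bx u) s) / \<epsilon>) / max m (mx u s))"
  define \<Psi> where "\<Psi> = (\<lambda>u t. (LBINT s:{0..t}. src u s, mom (\<lambda>_. 1) (Gx u) (bx u) t))"
  have mxc: "continuous_on UNIV (mx u)" if "continuous_on {0..T} u" for u
    unfolding mx_def using that by (intro continuous_cl_compose continuous_intros)
  have adm: "admissible B M (Gx u) (bx u)" if u: "continuous_on {0..T} u" for u
    unfolding admissible_def
  proof (intro conjI allI B0 M0)
    show "continuous_on UNIV (Gx u)"
      unfolding Gx_def clip_def using u by (intro continuous_intros continuous_cl_compose)
    show "\<bar>Gx u s\<bar> \<le> M" for s unfolding Gx_def by (rule clip_simps(1)[OF M0])
    show "bx u \<in> borel_measurable borel"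
      unfolding bx_def by (intro borel_measurable_continuous_onI continuous_intros mxc u continuous_cl_compose \<beta>)
    show "\<bar>bx u s\<bar> \<le> B" for s
      using \<beta>(2)[OF cl_in[of s]] mult_mono[of "\<beta> (cl s)" B "1 - max 0 (min 1 (mx u s))" 1]
      by (auto simp: bx_def abs_mult)
  qed
  have nb: "\<bar>D s + clip K v / \<epsilon>\<bar> \<le> N" for s v
  proof -
    have "\<bar>clip K v\<bar> / \<epsilon> \<le> K / \<epsilon>" using clip_simps(1)[OF K] eps by (intro divide_right_mono) auto
    then show ?thesis using D(2)[of s] abs_triangle_ineq[of "D s" "clip K v / \<epsilon>"] eps by (simp add: N_def abs_divide)
  qed
  have srcb: "\<bar>src u s\<bar> \<le> N / m" for u s
    unfolding src_def abs_divide using nb m N0 by (intro frac_le) auto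
  have srcm: "src u \<in> borel_measurable borel" if u: "continuous_on {0..T} u" for u
  proof -
    note [measurable] = mom_borel[OF admissibleD(7,5)[OF adm[OF u]] quad_growthD(3)[OF quad_growth_kk]]
      borel_measurable_continuous_onI[OF mxc[OF u]]
    show ?thesis unfolding src_def by measurable
  qed
  obtain u where u: "continuous_on {0..T} u" "\<And>t. t \<in> {0..T} \<Longrightarrow> \<Psi> u t = u t"
  proof (rule volterra_fixed_point[of T \<Psi> "srcC B M N m + diffC B M"])
    show "continuous_on {0..T} (\<Psi> u)" if u: "continuous_on {0..T} u" for u
      unfolding \<Psi>_def by (intro continuous_on_Pair LBINT_bounded_borel(1)[OF srcm[OF u] srcb] mass_continuous[OF adm[OF u]])
    fix u w :: "real \<Rightarrow> real \<times> real" and t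
    assume u: "continuous_on {0..T} u" and w: "continuous_on {0..T} w" and t: "t \<in> {0..T}"
    let ?d = "\<lambda>s. norm (u s - w s)"
    have dc: "continuous_on {0..T} ?d" using u w by (intro continuous_intros)
    have f: "\<bar>fst (u s) - fst (w s)\<bar> \<le> ?d s" and s: "\<bar>snd (u s) - snd (w s)\<bar> \<le> ?d s" for s
      using dist_fst_le[of "u s" "w s"] dist_snd_le[of "u s" "w s"] unfolding dist_real_def dist_norm by blast+
    have dG: "\<bar>Gx u s - Gx w s\<bar> \<le> ?d s" if "s \<in> {0..T}" for s
      using order_trans[OF clip_simps(2) f] that by (simp add: Gx_def cl_id)
    have dm: "\<bar>mx u s - mx w s\<bar> \<le> ?d s" if "s \<in> {0..T}" for s using s that by (simp add: mx_def cl_id)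
    have db: "\<bar>bx u s - bx w s\<bar> \<le> B * ?d s" if st: "s \<in> {0..T}" for s
    proof -
      have "\<bar>bx u s - bx w s\<bar> = \<bar>\<beta> s\<bar> * \<bar>max 0 (min 1 (mx u s)) - max 0 (min 1 (mx w s))\<bar>"
        unfolding bx_def abs_mult[symmetric] using st by (simp add: cl_id algebra_simps abs_minus_commute)
      also have "\<dots> \<le> B * ?d s"
        using \<beta>(2)[OF st] dm[OF st] by (intro mult_mono) auto
      finally show ?thesis .
    qed
    have "norm (\<Psi> u t - \<Psi> w t) \<le> \<bar>(LBINT s:{0..t}. src u s) - (LBINT s:{0..t}. src w s)\<bar>
        + \<bar>mom (\<lambda>_. 1) (Gx u) (bx u) t - mom (\<lambda>_. 1) (Gx w) (bx w) t\<bar>"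
      unfolding \<Psi>_def diff_Pair by (rule order_trans[OF norm_Pair_le]) simp
    also have "\<dots> \<le> srcC B M N m * integral {0..t} ?d + diffC B M * (1 * integral {0..t} ?d + 0 * (?d t + integral {0..t} ?d))"
    proof (rule add_mono)
      have [measurable]: "mx u \<in> borel_measurable borel" "mx w \<in> borel_measurable borel"
        using mxc u w by (auto intro: borel_measurable_continuous_onI)
      show "\<bar>(LBINT s:{0..t}. src u s) - (LBINT s:{0..t}. src w s)\<bar> \<le> srcC B M N m * integral {0..t} ?d"
        unfolding src_def
      proof (rule source_diff[OF adm[OF u] adm[OF w] dc _ dG db _ m])
        show "\<bar>max m (mx u s) - max m (mx w s)\<bar> \<le> ?d s" if "s \<in> {0..T}" for s
          using dm[OF that] by (auto simp: max_def)
      qed (use nb t D(1) in \<open>auto simp: clip_simps(2)\<close>)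
      show "\<bar>mom (\<lambda>_. 1) (Gx u) (bx u) t - mom (\<lambda>_. 1) (Gx w) (bx w) t\<bar>
          \<le> diffC B M * (1 * integral {0..t} ?d + 0 * (?d t + integral {0..t} ?d))"
        by (rule mom_diff[OF adm[OF u] adm[OF w] quad_growth_const dc _ dG db t]) auto
    qed
    finally show "norm (\<Psi> u t - \<Psi> w t) \<le> (srcC B M N m + diffC B M) * integral {0..t} ?d"
      by (simp add: algebra_simps)
  qed (use T in auto)
  have uf: "fst (u t) = (LBINT s:{0..t}. src u s)" "snd (u t) = mom (\<lambda>_. 1) (Gx u) (bx u) t" if "t \<in> {0..T}" for t
    unfolding u(2)[OF that, symmetric] by (simp_all add: \<Psi>_def)
  have Gb: "\<bar>fst (u t)\<bar> \<le> M" if t: "t \<in> {0..T}" for t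
  proof -
    have "\<bar>fst (u t)\<bar> \<le> N / m * (t - 0)"
      unfolding uf(1)[OF t] by (rule LBINT_bounded_borel(3)[OF srcm[OF u(1)] srcb]) (use t in auto)
    also have "\<dots> \<le> M" unfolding M_def using t N0 m by (intro mult_left_mono) auto
    finally show ?thesis .
  qed
  have Gu: "Gx u s = fst (u (cl s))" for s unfolding Gx_def by (rule clip_simps(3)[OF Gb[OF cl_in]])
  show ?thesis
  proof (rule that[OF adm[OF u(1)] _ mxc[OF u(1)]])
    show "bx u = (\<lambda>s. \<beta> (cl s) * (1 - max 0 (min 1 (mx u s))))" by (rule bx_def[THEN fun_cong])
    show "mx u s = mx u (cl s)" "Gx u s = Gx u (cl s)" for s by (simp_all add: mx_def Gx_def cl_idem)
    show "mx u t = mom (\<lambda>_. 1) (Gx u) (bx u) t" if "t \<in> {0..T}" for t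
      using uf(2)[OF that] that by (simp add: mx_def cl_id)
    show "Gx u t = (LBINT s:{0..t}. (D s + clip K (mom kk (Gx u) (bx u) s) / \<epsilon>) / max m (mx u s))" if "t \<in> {0..T}" for t
      using uf(1)[OF that] that by (simp add: Gu cl_id src_def)
  qed
qed

lemma LBINT_nonneg_on: "(\<And>s. s \<in> {a..b} \<Longrightarrow> 0 \<le> f s) \<Longrightarrow> 0 \<le> (LBINT s:{a..b}. f s)" for f :: "real \<Rightarrow> real"
  unfolding set_lebesgue_integral_def
  by (intro Bochner_Integration.integral_nonneg) (auto simp: indicator_def)

lemma system_exists:
  assumes \<beta>: "continuous_on {0..T} \<beta>" "\<And>s. s \<in> {0..T} \<Longrightarrow> \<beta>min \<le> \<beta> s \<and> \<beta> s \<le> B" "0 < \<beta>min"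
    and D: "D \<in> borel_measurable borel" "\<And>s. \<bar>D s\<bar> \<le> Dm"
    and lip: "\<And>u. \<bar>\<zeta> u - \<zeta> 0\<bar> \<le> \<zeta>Lip * \<bar>u\<bar>"
    and R0: "0 < (LBINT x:{..0}. r0 x)" "(LBINT x:{..0}. r0 x) < \<epsilon>"
    and small: "\<zeta>Lip * ((LBINT x:{..0}. r0 x * \<bar>h0 x\<bar>) / \<epsilon> + (LBINT s:{0..T}. \<bar>D s\<bar>)) < \<beta>min"
  obtains G \<mu> b M m where "admissible B M G b" "b = (\<lambda>s. \<beta> (cl s) * (1 - \<mu> s))"
    "continuous_on UNIV \<mu>" "0 < m" "\<And>s. m \<le> \<mu> s"
    "\<And>t. t \<in> {0..T} \<Longrightarrow> \<mu> t = mom (\<lambda>_. 1) G b t"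
    "\<And>t. t \<in> {0..T} \<Longrightarrow> G t = (LBINT s:{0..t}. (D s + mom kk G b s / \<epsilon>) / \<mu> s)"
proof -
  note [measurable] = D(1)
  define R1 where "R1 = (LBINT x:{..0}. r0 x * \<bar>h0 x\<bar>)"
  define P where "P = R1 / \<epsilon> + (LBINT s:{0..T}. \<bar>D s\<bar>)"
  define \<mu>0 where "\<mu>0 = (LBINT x:{..0}. r0 x) / \<epsilon>"
  have \<mu>0: "0 < \<mu>0" "\<mu>0 < 1" using R0 eps by (auto simp: \<mu>0_def)
  have Lip0: "0 \<le> \<zeta>Lip" using order_trans[OF abs_ge_zero lip[of 1]] by simp
  have small': "\<zeta>Lip * P < \<beta>min" using small by (simp add: P_def R1_def)
  have B0: "0 \<le> B" using \<beta>(2)[of 0] \<beta>(3) T by auto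
  have R1: "0 \<le> R1" unfolding R1_def set_lebesgue_integral_def
    by (intro Bochner_Integration.integral_nonneg) (auto simp: r0_nonneg)
  have P0: "0 \<le> P" unfolding P_def using R1 eps by (intro add_nonneg_nonneg LBINT_nonneg_on divide_nonneg_pos) auto
  \<comment> \<open>The second entry solves
    \<open>\<zeta> 0 * m + \<zeta>Lip * P = \<beta>min * (1 - m)\<close>: up to this mass, births
    are at least as large as deaths. The first entry keeps the initial mass from starting below the
    barrier.\<close>
  define m where "m = min \<mu>0 ((\<beta>min - \<zeta>Lip * P) / (\<beta>min + \<zeta> 0))"
  have bz: "0 < \<beta>min + \<zeta> 0" using \<beta>(3) zeta_nonneg[of 0] by simp
  have m: "0 < m" "m \<le> \<mu>0" using \<mu>0 small' bz by (auto simp: m_def)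
  have m1: "m < 1" using m(2) \<mu>0(2) by simp
  have mb: "\<zeta> 0 * m + \<zeta>Lip * P \<le> \<beta>min * (1 - m)"
  proof -
    have "m \<le> (\<beta>min - \<zeta>Lip * P) / (\<beta>min + \<zeta> 0)" by (simp add: m_def)
    then have "m * (\<beta>min + \<zeta> 0) \<le> \<beta>min - \<zeta>Lip * P" using bz by (simp add: pos_le_divide_eq)
    then show ?thesis by (simp add: algebra_simps)
  qed
  \<comment> \<open>\<open>M1\<close> is the Gronwall bound for \<open>G\<close> found below,
    computed from the data, \<open>P\<close> and \<open>m\<close>; \<open>K\<close> is the bound for
    \<open>mom kk\<close> that \<open>M1\<close> implies. Neither refers to a truncation level of
    \<open>G\<close> or of \<open>mom kk\<close>, so the choice is not circular.\<close>
  define c where "c = B / (\<epsilon> * m)"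
  define M1 where "M1 = (P + R1 / \<epsilon>) / m * exp (c * T)"
  define K where "K = Z * J B M1 / \<epsilon>"
  have c0: "0 \<le> c" using B0 eps m by (simp add: c_def)
  have M10: "0 \<le> M1" using P0 R1 eps m by (simp add: M1_def)
  have K0: "0 \<le> K" using Z_nonneg J_nonneg[OF B0] eps by (simp add: K_def)
  have \<beta>0: "0 \<le> \<beta> s \<and> \<beta> s \<le> B" if "s \<in> {0..T}" for s using \<beta>(2)[OF that] \<beta>(3) by simp
  obtain G \<mu> b M where a: "admissible B M G b" and b: "b = (\<lambda>s. \<beta> (cl s) * (1 - max 0 (min 1 (\<mu> s))))"
    and \<mu>c: "continuous_on UNIV \<mu>" and \<mu>cl: "\<And>s. \<mu> s = \<mu> (cl s)" and Gcl: "\<And>s. G s = G (cl s)"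
    and \<mu>: "\<And>t. t \<in> {0..T} \<Longrightarrow> \<mu> t = mom (\<lambda>_. 1) G b t"
    and G: "\<And>t. t \<in> {0..T} \<Longrightarrow> G t = (LBINT s:{0..t}. (D s + clip K (mom kk G b s) / \<epsilon>) / max m (\<mu> s))"
    by (rule truncated_fixed_point[OF \<beta>(1) \<beta>0 D m(1) K0]) (assumption, erule that, assumption+)
  note A = admissibleD[OF a]
  note [measurable] = mom_borel[OF A(7,5)] borel_measurable_continuous_onI[OF \<mu>c] A(5,7)
  have b0: "0 \<le> b s" for s
    unfolding b using \<beta>(2)[OF cl_in[of s]] \<beta>(3) by (intro mult_nonneg_nonneg) auto
  note Zb = mom_zeta_bounds[OF a b0 _ lip]
  define f where "f = (\<lambda>s. (D s + clip K (mom kk G b s) / \<epsilon>) / max m (\<mu> s))"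
  have [measurable]: "mom kk G b \<in> borel_measurable borel" "mom \<zeta> G b \<in> borel_measurable borel"
     "mom (\<lambda>u. \<zeta> u * \<bar>u\<bar>) G b \<in> borel_measurable borel" "mom (\<lambda>_. 1) G b \<in> borel_measurable borel" by measurable
  have fm[measurable]: "f \<in> borel_measurable borel" unfolding f_def by measurable
  define F where "F = (Dm + K / \<epsilon>) / m"
  have fb: "\<bar>f s\<bar> \<le> F" for s
  proof -
    have "\<bar>clip K (mom kk G b s)\<bar> / \<epsilon> \<le> K / \<epsilon>" using clip_simps(1)[OF K0] eps by (intro divide_right_mono) auto
    then have "\<bar>D s + clip K (mom kk G b s) / \<epsilon>\<bar> \<le> Dm + K / \<epsilon>"
      using D(2)[of s] abs_triangle_ineq[of "D s" "clip K (mom kk G b s) / \<epsilon>"] eps by (simp add: abs_divide)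
    then show ?thesis unfolding f_def F_def abs_divide using m by (intro frac_le) auto
  qed
  define \<gamma> where "\<gamma> = (\<lambda>s. \<epsilon> * \<bar>f s\<bar>)"
  have \<gamma>m[measurable]: "\<gamma> \<in> borel_measurable borel" unfolding \<gamma>_def by measurable
  have \<gamma>b: "0 \<le> \<gamma> s" "\<gamma> s \<le> \<epsilon> * F" for s using fb[of s] eps by (auto simp: \<gamma>_def)
  have fi: "set_integrable lborel {s..t} f" for s t by (rule set_integrable_bounded_borel[OF fm fb])
  have incr: "\<bar>G t - G s\<bar> \<le> (LBINT \<tau>:{s..t}. \<gamma> \<tau>) / \<epsilon>" if "0 \<le> s" "s \<le> t" "t \<le> T" for s t
  proof -
    have "G t - G s = (LBINT \<tau>:{s..t}. f \<tau>)"
      using LBINT_bounded_borel(2)[OF fm fb that] G[of t] G[of s] that unfolding f_def by auto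
    moreover have "\<bar>LBINT \<tau>:{s..t}. f \<tau>\<bar> \<le> (LBINT \<tau>:{s..t}. \<bar>f \<tau>\<bar>)"
      unfolding set_lebesgue_integral_def by (rule order_trans[OF integral_abs_bound]) (simp add: abs_mult)
    moreover have "(LBINT \<tau>:{s..t}. \<gamma> \<tau>) / \<epsilon> = (LBINT \<tau>:{s..t}. \<bar>f \<tau>\<bar>)" unfolding \<gamma>_def using eps by simp
    ultimately show ?thesis by simp
  qed
  have G00: "G 0 = 0"
    using LBINT_bounded_borel(3)[OF fm fb, of 0 0 T] G[of 0] T unfolding f_def by auto
  have \<mu>nn: "0 \<le> \<mu> s" if "s \<in> {0..T}" for s using Zb(1)[of s] \<mu>[OF that] that by auto
  have p: "mom (\<lambda>u. \<bar>u\<bar>) G b t \<le> P" if t: "t \<in> {0..T}" for t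
  proof -
    have i1: "set_integrable lborel {0..t} (\<lambda>s. \<gamma> s * mom (\<lambda>_. 1) G b s)"
    proof (rule set_integrable_bounded_borel)
      fix s assume s: "s \<in> {0..t}"
      show "\<bar>\<gamma> s * mom (\<lambda>_. 1) G b s\<bar> \<le> (\<epsilon> * F) * (1 * J B M / \<epsilon>)"
        unfolding abs_mult using \<gamma>b[of s] s t by (intro mult_mono mom_bound[OF a quad_growth_const]) auto
    qed measurable
    have i2: "set_integrable lborel {0..t} (\<lambda>s. \<epsilon> * \<bar>D s\<bar>)"
      by (intro set_integrable_mult_right set_integrable_bounded_borel[of _ _ _ Dm]) (use D in auto)
    have i3: "set_integrable lborel {0..t} (mom (\<lambda>u. \<zeta> u * \<bar>u\<bar>) G b)"
      by (rule mom_set_integrable[OF a quad_growth_zeta_abs]) (use t in auto)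
    have "(LBINT s:{0..t}. \<gamma> s * mom (\<lambda>_. 1) G b s) \<le> (LBINT s:{0..t}. \<epsilon> * \<bar>D s\<bar> + mom (\<lambda>u. \<zeta> u * \<bar>u\<bar>) G b s)"
    proof (rule set_integral_mono[OF i1 set_integral_add(1)[OF i2 i3]])
      fix s assume "s \<in> {0..t}"
      then have s: "s \<in> {0..T}" using t by auto
      \<comment> \<open>\<open>max m (\<mu> s)\<close> is at least the mass and \<open>clip\<close>
        does not increase moduli, so both truncations respect the bound on mass times
        source.\<close>
      have "\<gamma> s * mom (\<lambda>_. 1) G b s \<le> \<gamma> s * max m (\<mu> s)" using \<gamma>b(1)[of s] \<mu>[OF s] by (intro mult_left_mono) auto
      also have "\<dots> = \<bar>\<epsilon> * D s + clip K (mom kk G b s)\<bar>"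
      proof -
        have "\<epsilon> * \<bar>f s\<bar> * max m (\<mu> s) = \<bar>\<epsilon> * (f s * max m (\<mu> s))\<bar>" using eps m by (simp add: abs_mult)
        also have "f s * max m (\<mu> s) = D s + clip K (mom kk G b s) / \<epsilon>" using m by (simp add: f_def)
        finally show ?thesis using eps by (simp add: \<gamma>_def distrib_left)
      qed
      also have "\<dots> \<le> \<epsilon> * \<bar>D s\<bar> + \<bar>clip K (mom kk G b s)\<bar>"
        using abs_triangle_ineq[of "\<epsilon> * D s" "clip K (mom kk G b s)"] eps by (simp add: abs_mult)
      also have "\<dots> \<le> \<epsilon> * \<bar>D s\<bar> + mom (\<lambda>u. \<zeta> u * \<bar>u\<bar>) G b s"
        using clip_simps(4)[OF K0, of "mom kk G b s"] Zb(3)[of s] s by auto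
      finally show "\<gamma> s * mom (\<lambda>_. 1) G b s \<le> \<epsilon> * \<bar>D s\<bar> + mom (\<lambda>u. \<zeta> u * \<bar>u\<bar>) G b s" .
    qed
    also have "\<dots> = \<epsilon> * (LBINT s:{0..t}. \<bar>D s\<bar>) + (LBINT s:{0..t}. mom (\<lambda>u. \<zeta> u * \<bar>u\<bar>) G b s)"
      by (simp add: set_integral_add(2)[OF i2 i3])
    \<comment> \<open>The moment of \<open>\<zeta> u * \<bar>u\<bar>\<close> cancels against the
      dissipation in \<open>abs_moment_inequality\<close>.\<close>
    finally have "\<epsilon> * mom (\<lambda>u. \<bar>u\<bar>) G b t \<le> R1 + \<epsilon> * (LBINT s:{0..t}. \<bar>D s\<bar>)"
      using abs_moment_inequality[OF a b0 \<gamma>m \<gamma>b incr G00 t] by (simp add: R1_def)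
    also have "(LBINT s:{0..t}. \<bar>D s\<bar>) \<le> (LBINT s:{0..T}. \<bar>D s\<bar>)"
      unfolding set_lebesgue_integral_def
    proof (rule integral_mono)
      show "integrable lborel (\<lambda>s. indicat_real {0..u} s *\<^sub>R \<bar>D s\<bar>)" for u
        using set_integrable_bounded_borel[of "\<lambda>s. \<bar>D s\<bar>" 0 u Dm] D unfolding set_integrable_def by auto
      then show "integrable lborel (\<lambda>s. indicat_real {0..u} s *\<^sub>R \<bar>D s\<bar>)" for u .
    qed (use t in \<open>auto simp: indicator_def\<close>)
    finally have "\<epsilon> * mom (\<lambda>u. \<bar>u\<bar>) G b t \<le> \<epsilon> * P" using eps by (simp add: P_def algebra_simps)
    then show ?thesis using eps by simp
  qed
  have hb: "\<bar>b s - mom \<zeta> G b s\<bar> \<le> B + Z * J B M / \<epsilon>" if "s \<in> {0..T}" for s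
    using A(6)[of s] mom_bound[OF a quad_growth_zeta, of s] that by auto
  have bal: "\<epsilon> * (\<mu> t - \<mu> s) = (LBINT \<tau>:{s..t}. b \<tau> - mom \<zeta> G b \<tau>)" if "0 \<le> s" "s \<le> t" "t \<le> T" for s t
    using LBINT_bounded_borel(2)[of "\<lambda>s. b s - mom \<zeta> G b s" T "B + Z * J B M / \<epsilon>", OF _ hb that] that
      mass_balance[OF a, of t] mass_balance[OF a, of s] \<mu>[of t] \<mu>[of s] by (simp add: right_diff_distrib)
  have \<mu>init: "\<mu> 0 = \<mu>0" using \<mu>[of 0] mom_initial[OF A(3)] T by (simp add: \<mu>0_def)
  \<comment> \<open>Wherever the mass is at least 1 the truncated birth rate is 0 and only deaths
    remain, so the mass cannot have risen since the last passage through 1.\<close>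
  have le1: "\<mu> t \<le> 1" if t: "t \<in> {0..T}" for t
  proof (rule ccontr)
    assume "\<not> \<mu> t \<le> 1"
    then obtain s where s: "0 \<le> s" "s < t" "\<mu> s = 1" "\<And>\<tau>. s < \<tau> \<Longrightarrow> \<tau> \<le> t \<Longrightarrow> 1 < \<mu> \<tau>"
      using last_passage[of 0 t \<mu> 1] continuous_on_subset[OF \<mu>c] \<mu>init \<mu>0 t by (metis atLeastAtMost_iff less_imp_le not_le subset_UNIV)
    have "0 \<le> (LBINT \<tau>:{s..t}. - (b \<tau> - mom \<zeta> G b \<tau>))"
    proof (rule LBINT_nonneg_on)
      fix \<tau> assume \<tau>: "\<tau> \<in> {s..t}"
      have "1 \<le> \<mu> \<tau>" using s(3) s(4)[of \<tau>] \<tau> by (cases "\<tau> = s") auto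
      then show "0 \<le> - (b \<tau> - mom \<zeta> G b \<tau>)" using Zb(2)[of \<tau>] \<tau> t by (auto simp: b)
    qed
    also have "\<dots> = - (LBINT \<tau>:{s..t}. b \<tau> - mom \<zeta> G b \<tau>)"
      unfolding set_lebesgue_integral_def by (simp add: algebra_simps Bochner_Integration.integral_minus[symmetric])
    finally have "\<epsilon> * (\<mu> t - \<mu> s) \<le> 0" using bal[of s t] s t by simp
    then show False using eps s(2,3) s(4)[of t] by (simp add: mult_le_0_iff)
  qed
  \<comment> \<open>\<open>last_passage\<close> for \<open>- \<mu>\<close>: after the last time at
    level \<open>m\<close> the mass is below \<open>m\<close>, where births are at least deaths by
    \<open>mb\<close>, so it cannot have fallen.\<close>
  have gem: "m \<le> \<mu> t" if t: "t \<in> {0..T}" for t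
  proof (rule ccontr)
    assume "\<not> m \<le> \<mu> t"
    then obtain s where s: "0 \<le> s" "s < t" "- \<mu> s = - m" "\<And>\<tau>. s < \<tau> \<Longrightarrow> \<tau> \<le> t \<Longrightarrow> - m < - \<mu> \<tau>"
      using last_passage[of 0 t "\<lambda>s. - \<mu> s" "- m"] continuous_on_subset[OF continuous_on_minus[OF \<mu>c]] \<mu>init m t
      by (metis atLeastAtMost_iff less_imp_le neg_le_iff_le neg_less_iff_less not_le subset_UNIV)
    have "0 \<le> (LBINT \<tau>:{s..t}. b \<tau> - mom \<zeta> G b \<tau>)"
    proof (rule LBINT_nonneg_on)
      fix \<tau> assume \<tau>: "\<tau> \<in> {s..t}"
      then have \<tau>T: "\<tau> \<in> {0..T}" using s t by auto
      have le: "\<mu> \<tau> \<le> m" using s(3) s(4)[of \<tau>] \<tau> by (cases "\<tau> = s") auto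
      have "mom \<zeta> G b \<tau> \<le> \<zeta> 0 * \<mu> \<tau> + \<zeta>Lip * mom (\<lambda>u. \<bar>u\<bar>) G b \<tau>"
        using Zb(4)[of \<tau>] \<mu>[OF \<tau>T] \<tau>T by auto
      also have "\<dots> \<le> \<zeta> 0 * m + \<zeta>Lip * P"
        using le p[OF \<tau>T] zeta_nonneg[of 0] Lip0 by (intro add_mono mult_left_mono) auto
      also have "\<dots> \<le> \<beta>min * (1 - m)" by (rule mb)
      also have "\<dots> \<le> \<beta> (cl \<tau>) * (1 - \<mu> \<tau>)"
        using \<beta>(2)[OF cl_in[of \<tau>]] \<beta>(3) le m1 by (intro mult_mono) auto
      also have "\<dots> = b \<tau>" using \<mu>nn[OF \<tau>T] le m1 by (simp add: b)
      finally show "0 \<le> b \<tau> - mom \<zeta> G b \<tau>" by simp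
    qed
    then have "0 \<le> \<epsilon> * (\<mu> t - \<mu> s)" using bal[of s t] s t by simp
    then show False using eps s(2,3) s(4)[of t] by (simp add: zero_le_mult_iff)
  qed
  have \<mu>b: "m \<le> \<mu> s" "\<mu> s \<le> 1" for s using gem[OF cl_in] le1[OF cl_in] \<mu>cl[of s] by auto
  have bb: "b = (\<lambda>s. \<beta> (cl s) * (1 - \<mu> s))"
  proof -
    have "max 0 (min 1 (\<mu> s)) = \<mu> s" for s using \<mu>b[of s] m(1) by auto
    then show ?thesis unfolding b by simp
  qed
  have "\<bar>G t\<bar> \<le> M1" if t: "t \<in> {0..T}" for t
  proof -
    have Gc: "continuous_on S (\<lambda>s. \<bar>G s\<bar>)" for S by (intro continuous_intros continuous_on_subset[OF A(3)]) auto
    have "\<bar>G t\<bar> \<le> (P + R1 / \<epsilon>) / m * exp (c * t)"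
    proof (rule gronwall[OF Gc c0 _ t])
      fix t assume t: "t \<in> {0..T}"
      let ?I = "integral {0..t} (\<lambda>s. \<bar>G s\<bar>)"
      have "\<epsilon> * (\<bar>G t\<bar> * m) \<le> \<epsilon> * (\<bar>G t\<bar> * \<mu> t)" using eps \<mu>b by (intro mult_left_mono) auto
      also have "\<dots> \<le> \<epsilon> * P + R1 + B * ?I"
      proof -
        have "\<epsilon> * mom (\<lambda>u. \<bar>u\<bar>) G b t \<le> \<epsilon> * P" using p[OF t] eps by (intro mult_left_mono) auto
        then show ?thesis using primitive_le_moments[OF a b0 t] \<mu>[OF t] by (simp add: R1_def)
      qed
      finally have "\<bar>G t\<bar> * (\<epsilon> * m) \<le> \<epsilon> * P + R1 + B * ?I" by (simp add: mult.left_commute mult.assoc)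
      then have "\<bar>G t\<bar> \<le> (\<epsilon> * P + R1 + B * ?I) / (\<epsilon> * m)" using eps m by (simp add: pos_le_divide_eq)
      also have "\<dots> = (P + R1 / \<epsilon>) / m + c * ?I" using eps m by (simp add: c_def field_simps)
      finally show "\<bar>G t\<bar> \<le> (P + R1 / \<epsilon>) / m + c * ?I" .
    qed
    also have "\<dots> \<le> M1" unfolding M1_def using t c0 P0 R1 eps m by (intro mult_left_mono) (auto intro: mult_left_mono)
    finally show ?thesis .
  qed
  then have "\<bar>G s\<bar> \<le> M1" for s using Gcl[of s] cl_in[of s] by metis
  then have a1: "admissible B M1 G b" using A M10 unfolding admissible_def by auto
  \<comment> \<open>The moment bound is now taken with \<open>M1\<close> in place of
    \<open>M\<close>, and its value is the level \<open>K\<close>.\<close>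
  have "clip K (mom kk G b s) = mom kk G b s" if "s \<in> {0..T}" for s
    by (rule clip_simps(3)) (use mom_bound[OF a1 quad_growth_kk, of s] that in \<open>auto simp: K_def\<close>)
  then have "G t = (LBINT s:{0..t}. (D s + mom kk G b s / \<epsilon>) / \<mu> s)" if t: "t \<in> {0..T}" for t
    unfolding G[OF t] using \<mu>b t by (intro set_lebesgue_integral_cong) (auto simp: max_absorb2)
  then show ?thesis using that[OF a1 bb \<mu>c m(1) \<mu>b(1) \<mu>] by blast
qed

end

section \<open>Solutions in the sense of characteristics\<close>

lemma AE_lebesgue_on_iff:
  fixes S :: "'a::euclidean_space set"
  assumes "S \<in> sets borel"
  shows "(AE x in lebesgue_on S. P x) \<longleftrightarrow> (AE x in lborel. x \<in> S \<longrightarrow> P x)"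
  using assms by (subst AE_restrict_space_iff) (auto simp: AE_completion_iff sets_completionI_sets)

text \<open>By completeness an arbitrary \<open>g\<close> that agrees almost everywhere with a Borel
  function is measurable. This transfers the Lebesgue integrals of the problem to Borel
  representatives.\<close>

lemma lebesgue_on_cong_AE:
  fixes f g :: "real \<Rightarrow> real"
  assumes S: "S \<in> sets borel" and f[measurable]: "f \<in> borel_measurable borel"
    and ae: "AE x in lborel. x \<in> S \<longrightarrow> g x = f x"
  shows "g \<in> borel_measurable (lebesgue_on S)"
    and "integrable (lebesgue_on S) g \<longleftrightarrow> set_integrable lborel S f"
    and "(LINT x|lebesgue_on S. g x) = (LBINT x:S. f x)"
proof -
  note [measurable] = S
  have Sl: "S \<inter> space lebesgue \<in> sets lebesgue" using S by (auto intro: sets_completionI_sets)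
  have b: "(\<lambda>x. indicat_real S x *\<^sub>R f x) \<in> borel_measurable lborel" by measurable
  have ae': "AE x in lebesgue. indicat_real S x *\<^sub>R f x = indicat_real S x *\<^sub>R g x"
    unfolding AE_completion_iff using ae by eventually_elim (auto simp: indicator_def)
  have ae'': "AE x in lebesgue. indicat_real S x *\<^sub>R g x = indicat_real S x *\<^sub>R f x"
    using ae' by eventually_elim auto
  have m: "(\<lambda>x. indicat_real S x *\<^sub>R g x) \<in> borel_measurable lebesgue"
    by (rule borel_measurable_AE[OF measurable_completion[OF b] ae'])
  then have "(\<lambda>x. if x \<in> S then g x else 0) \<in> borel_measurable lebesgue"
    by (simp add: indicator_def of_bool_def if_distrib[of "\<lambda>x. x * _"] cong: if_cong)
  then show "g \<in> borel_measurable (lebesgue_on S)" by (rule borel_measurable_if_D)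
  show "integrable (lebesgue_on S) g \<longleftrightarrow> set_integrable lborel S f"
    unfolding integrable_restrict_space[OF Sl] set_integrable_def integrable_completion[OF b, symmetric]
    by (rule integrable_cong_AE[OF m measurable_completion[OF b] ae''])
  show "(LINT x|lebesgue_on S. g x) = (LBINT x:S. f x)"
    unfolding integral_restrict_space[OF Sl] set_lebesgue_integral_def integral_completion[OF b, symmetric]
    by (rule integral_cong_AE[OF m measurable_completion[OF b] ae''])
qed

lemma lebesgue_on_borel_rep:
  fixes g :: "'a::euclidean_space \<Rightarrow> real"
  assumes S: "S \<in> sets borel" and g: "g \<in> borel_measurable (lebesgue_on S)"
  obtains f where "f \<in> borel_measurable borel" "AE x in lborel. x \<in> S \<longrightarrow> g x = f x"
proof -
  have "(\<lambda>x. if x \<in> S then g x else 0) \<in> borel_measurable lebesgue"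
    using S by (intro borel_measurable_if_I g) (auto intro: sets_completionI_sets)
  from completion_ex_borel_measurable_real[OF this]
  obtain f where f: "f \<in> borel_measurable borel" "AE x in lborel. (if x \<in> S then g x else 0) = f x"
    by auto
  show ?thesis by (rule that[OF f(1)]) (use f(2) in eventually_elim, auto)
qed

text \<open>The predicate may fail to be measurable, so the transformation rule is applied to a
  Borel null set containing its exceptions.\<close>

lemma AE_lborel_affine:
  fixes P :: "real \<Rightarrow> bool"
  assumes c: "c \<noteq> 0" and P: "AE x in lborel. P x"
  shows "AE x in lborel. P (t + c * x)"
proof -
  obtain N where N: "N \<in> null_sets lborel" "\<And>x. x \<notin> N \<Longrightarrow> P x"
    using P unfolding eventually_ae_filter by auto
  note [measurable] = null_setsD2[OF N(1), simplified]
  have "AE x in lborel. x \<notin> N" by (rule AE_not_in[OF N(1)])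
  then have "AE x in lborel. t + c * x \<notin> N" by (intro AE_borel_affine[OF c, of "\<lambda>x. x \<notin> N"]) auto
  then show ?thesis by eventually_elim (rule N(2))
qed

lemma age_substitution:
  fixes F :: "real \<Rightarrow> real"
  assumes e: "0 < \<epsilon>"
  shows "(LBINT x:{..t}. F x) = \<epsilon> * (LBINT a:{0..}. F (t - \<epsilon> * a))"
    and "set_integrable lborel {..t} F \<longleftrightarrow> set_integrable lborel {0..} (\<lambda>a. F (t - \<epsilon> * a))"
proof -
  have eq: "indicat_real {..t} (t + (- \<epsilon>) * a) *\<^sub>R F (t + (- \<epsilon>) * a) = indicat_real {0..} a *\<^sub>R F (t - \<epsilon> * a)" for a
    using e by (auto simp: indicator_def zero_le_mult_iff)
  show "(LBINT x:{..t}. F x) = \<epsilon> * (LBINT a:{0..}. F (t - \<epsilon> * a))"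
    unfolding set_lebesgue_integral_def eq[symmetric]
    using lborel_integral_real_affine[of "- \<epsilon>" "\<lambda>x. indicat_real {..t} x *\<^sub>R F x" t] e by simp
  show "set_integrable lborel {..t} F \<longleftrightarrow> set_integrable lborel {0..} (\<lambda>a. F (t - \<epsilon> * a))"
    unfolding set_integrable_def eq[symmetric]
    using lborel_integrable_real_affine_iff[of "- \<epsilon>" "\<lambda>x. indicat_real {..t} x *\<^sub>R F x" t] e by simp
qed

lemma segment_substitution:
  fixes F :: "real \<Rightarrow> real"
  assumes e: "0 < \<epsilon>"
  shows "(LBINT s:{0..a}. F (x + \<epsilon> * s)) = (LBINT \<tau>:{x..x + \<epsilon> * a}. F \<tau>) / \<epsilon>"
proof -
  have eq: "indicat_real {x..x + \<epsilon> * a} (x + \<epsilon> * s) *\<^sub>R F (x + \<epsilon> * s) = indicat_real {0..a} s *\<^sub>R F (x + \<epsilon> * s)" for s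
    using e by (auto simp: indicator_def zero_le_mult_iff)
  show ?thesis
    unfolding set_lebesgue_integral_def eq[symmetric]
    using lborel_integral_real_affine[of \<epsilon> "\<lambda>\<tau>. indicat_real {x..x + \<epsilon> * a} \<tau> *\<^sub>R F \<tau>" x] e by simp
qed

lemma Linf_AE_bound:
  assumes "Linf S u"
  obtains C where "0 \<le> C" "AE x in lebesgue_on S. \<bar>u x\<bar> \<le> C"
proof -
  have m: "(\<lambda>x. ereal \<bar>u x\<bar>) \<in> borel_measurable (lebesgue_on S)" and fin: "esssup (lebesgue_on S) (\<lambda>x. ereal \<bar>u x\<bar>) < \<infinity>"
    using assms unfolding Linf_def by auto
  obtain C where C: "esssup (lebesgue_on S) (\<lambda>x. ereal \<bar>u x\<bar>) \<le> ereal C"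
    using fin by (cases "esssup (lebesgue_on S) (\<lambda>x. ereal \<bar>u x\<bar>)") auto
  have "AE x in lebesgue_on S. ereal \<bar>u x\<bar> \<le> esssup (lebesgue_on S) (\<lambda>x. ereal \<bar>u x\<bar>)" by (rule esssup_AE)
  then have "AE x in lebesgue_on S. \<bar>u x\<bar> \<le> \<bar>C\<bar>"
  proof eventually_elim
    fix x assume "ereal \<bar>u x\<bar> \<le> esssup (lebesgue_on S) (\<lambda>x. ereal \<bar>u x\<bar>)"
    then have "ereal \<bar>u x\<bar> \<le> ereal C" using C by (rule order_trans)
    then show "\<bar>u x\<bar> \<le> \<bar>C\<bar>" by simp
  qed
  then show ?thesis by (intro that[of "\<bar>C\<bar>"]) auto
qed

lemma Linf_I:
  assumes "u \<in> borel_measurable (lebesgue_on S)" "AE x in lebesgue_on S. \<bar>u x\<bar> \<le> C"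
  shows "Linf S u"
  unfolding Linf_def
proof
  have "esssup (lebesgue_on S) (\<lambda>x. ereal \<bar>u x\<bar>) \<le> ereal C"
    using assms by (intro esssup_I) auto
  then show "esssup (lebesgue_on S) (\<lambda>x. ereal \<bar>u x\<bar>) < \<infinity>"
    by (rule order.strict_trans1) simp
qed (rule assms(1))

context age_transport begin

lemma vel_cong:
  assumes "\<And>s. s \<in> {0..t} \<Longrightarrow> G1 s = G2 s" "s \<in> {0..t}" "x \<le> t"
  shows "vel G1 s x = vel G2 s x"
  using assms by (auto simp: vel_def lab_def)

lemma surv_cong:
  assumes "\<And>s. s \<in> {0..t} \<Longrightarrow> G1 s = G2 s" "x \<le> t"
  shows "surv G1 t x = surv G2 t x"
proof -
  have "cum G1 t x = cum G2 t x"
    unfolding cum_def by (intro set_lebesgue_integral_cong) (auto intro!: arg_cong[where f=\<zeta>] vel_cong[of t] assms)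
  then show ?thesis by (simp add: surv_def)
qed

lemma mom_cong:
  assumes "\<And>s. s \<in> {0..t} \<Longrightarrow> G1 s = G2 s" "\<And>s. s \<in> {0..t} \<Longrightarrow> b1 s = b2 s" "0 \<le> t"
  shows "mom \<phi> G1 b1 t = mom \<phi> G2 b2 t"
proof -
  have "(LBINT x:{..t}. wt b1 x * surv G1 t x * \<phi> (vel G1 t x)) = (LBINT x:{..t}. wt b2 x * surv G2 t x * \<phi> (vel G2 t x))"
  proof (rule set_lebesgue_integral_cong)
    show "\<forall>x. x \<in> {..t} \<longrightarrow> wt b1 x * surv G1 t x * \<phi> (vel G1 t x) = wt b2 x * surv G2 t x * \<phi> (vel G2 t x)"
    proof (intro allI impI)
      fix x assume "x \<in> {..t}"
      then have x: "x \<le> t" by simp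
      have "wt b1 x = wt b2 x" using assms x by (auto simp: wt_def)
      then show "wt b1 x * surv G1 t x * \<phi> (vel G1 t x) = wt b2 x * surv G2 t x * \<phi> (vel G2 t x)"
        using surv_cong[OF assms(1) x] vel_cong[OF assms(1) _ x, where s=t] assms(3) by simp
    qed
  qed simp
  then show ?thesis by (simp add: mom_def)
qed

lemma integral_over_ages:
  assumes a: "admissible B M G b" and \<phi>: "quad_growth \<phi> A A'" and t: "t \<le> T"
    and g: "AE a in lebesgue_on {0..}. g a = wt b (t - \<epsilon> * a) * surv G t (t - \<epsilon> * a) * \<phi> (vel G t (t - \<epsilon> * a))"
  shows "integrable (lebesgue_on {0..}) g" "(LINT a|lebesgue_on {0..}. g a) = mom \<phi> G b t"
proof -
  note [measurable] = admissibleD(5,7)[OF a] quad_growthD(3)[OF \<phi>] surv_measurable vel_measurable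
  let ?F = "\<lambda>x. wt b x * surv G t x * \<phi> (vel G t x)"
  have F: "(\<lambda>a. ?F (t - \<epsilon> * a)) \<in> borel_measurable borel" by measurable
  have ae: "AE a in lborel. a \<in> {0..} \<longrightarrow> g a = ?F (t - \<epsilon> * a)"
    using g by (simp add: AE_lebesgue_on_iff)
  note L = lebesgue_on_cong_AE[OF _ F ae, simplified]
  show "integrable (lebesgue_on {0..}) g"
    using L(2) integrand_integrable[OF a \<phi> t] age_substitution(2)[OF eps, of t ?F] by simp
  show "(LINT a|lebesgue_on {0..}. g a) = mom \<phi> G b t"
    unfolding L(3) mom_def age_substitution(1)[OF eps, of t ?F] using eps by simp
qed

end

text \<open>Here \<open>h0\<close>, \<open>r0\<close> and \<open>D\<close> are Borel representatives
  of the data. The sign of \<open>h0\<close> is due to \<open>vel\<close>, which subtracts the label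
  from \<open>G t\<close>.\<close>

locale coupled_system = age_transport \<epsilon> T L \<zeta> h0 r0
  for \<epsilon> T L :: real and \<zeta> h0 r0 :: "real \<Rightarrow> real" +
  fixes \<beta> f \<rho>I vI D :: "real \<Rightarrow> real" and Dm :: real
  assumes vI_rep: "AE a in lborel. 0 \<le> a \<longrightarrow> vI a = - h0 (- \<epsilon> * a)"
    and rhoI_rep: "AE a in lborel. 0 \<le> a \<longrightarrow> \<rho>I a = r0 (- \<epsilon> * a)"
    and D_borel[measurable]: "D \<in> borel_measurable borel" and D_bound: "\<And>s. \<bar>D s\<bar> \<le> Dm"
    and D_deriv: "AE s in lborel. s \<in> {0<..<T} \<longrightarrow> D s = deriv f s"
    and beta_cont: "continuous_on {0..T} \<beta>"
begin

section \<open>The representation formulas in the label variable\<close>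

lemma AE_initial:
  "AE a in lborel. t / \<epsilon> \<le> a \<longrightarrow> vI (a - t / \<epsilon>) = - h0 (t - \<epsilon> * a) \<and> \<rho>I (a - t / \<epsilon>) = r0 (t - \<epsilon> * a)"
proof -
  have "AE a in lborel. 0 \<le> - (t / \<epsilon>) + 1 * a \<longrightarrow> vI (- (t / \<epsilon>) + 1 * a) = - h0 (- \<epsilon> * (- (t / \<epsilon>) + 1 * a))"
    by (rule AE_lborel_affine[OF _ vI_rep]) simp
  moreover have "AE a in lborel. 0 \<le> - (t / \<epsilon>) + 1 * a \<longrightarrow> \<rho>I (- (t / \<epsilon>) + 1 * a) = r0 (- \<epsilon> * (- (t / \<epsilon>) + 1 * a))"
    by (rule AE_lborel_affine[OF _ rhoI_rep]) simp
  ultimately show ?thesis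
  proof eventually_elim
    fix a assume 1: "0 \<le> - (t / \<epsilon>) + 1 * a \<longrightarrow> vI (- (t / \<epsilon>) + 1 * a) = - h0 (- \<epsilon> * (- (t / \<epsilon>) + 1 * a))"
      and 2: "0 \<le> - (t / \<epsilon>) + 1 * a \<longrightarrow> \<rho>I (- (t / \<epsilon>) + 1 * a) = r0 (- \<epsilon> * (- (t / \<epsilon>) + 1 * a))"
    have "- \<epsilon> * (- (t / \<epsilon>) + 1 * a) = t - \<epsilon> * a" using eps by (simp add: algebra_simps)
    moreover have "- (t / \<epsilon>) + 1 * a = a - t / \<epsilon>" by simp
    ultimately show "t / \<epsilon> \<le> a \<longrightarrow> vI (a - t / \<epsilon>) = - h0 (t - \<epsilon> * a) \<and> \<rho>I (a - t / \<epsilon>) = r0 (t - \<epsilon> * a)"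
      using 1 2 by auto
  qed
qed

text \<open>The survival factor only sees \<open>v\<close> almost everywhere along the characteristic.\<close>

lemma rho_char_label:
  assumes G: "continuous_on UNIV G" and t: "t \<in> {0..T}" and a: "0 \<le> a"
    and v: "AE \<tau> in lborel. \<tau> \<in> {0<..<T} \<and> t - \<epsilon> * a \<le> \<tau> \<longrightarrow> v \<tau> ((\<tau> - (t - \<epsilon> * a)) / \<epsilon>) = vel G \<tau> (t - \<epsilon> * a)"
  shows "rho_char \<epsilon> \<beta> \<zeta> \<rho>I \<rho> v t a =
    (if a < t / \<epsilon> then \<beta> (t - \<epsilon> * a) * (1 - mu0 \<rho> (t - \<epsilon> * a)) else \<rho>I (a - t / \<epsilon>)) * surv G t (t - \<epsilon> * a)"
proof -
  define x where "x = t - \<epsilon> * a"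
  have xt: "x \<le> t" using a eps by (simp add: x_def)
  have iff: "a < t / \<epsilon> \<longleftrightarrow> 0 < x" using eps by (simp add: x_def field_simps)
  have eps_nz: "\<epsilon> \<noteq> 0" using eps by simp
  have GB: "G \<in> borel_measurable borel" by (rule borel_measurable_continuous_onI[OF G])
  note [measurable] = GB vel_measurable
  \<comment> \<open>Nothing is known of \<open>v\<close> at the times 0 and \<open>T\<close>, which
    form a null set on the characteristic.\<close>
  have v': "AE \<tau> in lborel. \<tau> \<in> {0..T} \<and> x \<le> \<tau> \<longrightarrow> v \<tau> ((\<tau> - x) / \<epsilon>) = vel G \<tau> x"
    using v AE_lborel_singleton[of 0] AE_lborel_singleton[of T] by eventually_elim (auto simp: x_def)
  show ?thesis
  proof (cases "0 < x")
    case True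
    have eq: "t - \<epsilon> * (a - s) = x + \<epsilon> * s" for s by (simp add: x_def algebra_simps)
    have "AE s in lborel. s \<in> {0..a} \<longrightarrow> \<zeta> (v (t - \<epsilon> * (a - s)) s) = \<zeta> (vel G (x + \<epsilon> * s) x)"
      using AE_lborel_affine[OF eps_nz v', of x]
    proof eventually_elim
      fix s assume 2: "x + \<epsilon> * s \<in> {0..T} \<and> x \<le> x + \<epsilon> * s \<longrightarrow> v (x + \<epsilon> * s) ((x + \<epsilon> * s - x) / \<epsilon>) = vel G (x + \<epsilon> * s) x"
      show "s \<in> {0..a} \<longrightarrow> \<zeta> (v (t - \<epsilon> * (a - s)) s) = \<zeta> (vel G (x + \<epsilon> * s) x)"
      proof
        assume s: "s \<in> {0..a}"
        have "0 \<le> \<epsilon> * s" "\<epsilon> * s \<le> \<epsilon> * a" using s eps by auto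
        then have "x + \<epsilon> * s \<in> {0..T}" using True t by (auto simp: x_def)
        then show "\<zeta> (v (t - \<epsilon> * (a - s)) s) = \<zeta> (vel G (x + \<epsilon> * s) x)"
          using 2 s eps unfolding eq by simp
      qed
    qed
    then have "(LINT s|lebesgue_on {0..a}. \<zeta> (v (t - \<epsilon> * (a - s)) s)) = (LBINT s:{0..a}. \<zeta> (vel G (x + \<epsilon> * s) x))"
      by (intro lebesgue_on_cong_AE(3)) measurable
    also have "\<dots> = cum G t x / \<epsilon>"
      using segment_substitution[OF eps, of a "\<lambda>\<tau>. \<zeta> (vel G \<tau> x)" x] True by (simp add: cum_def x_def)
    finally show ?thesis using True unfolding rho_char_def by (simp add: iff x_def[symmetric] surv_def)
  next
    case False
    have eq: "a + (s - t) / \<epsilon> = (s - x) / \<epsilon>" for s using eps by (simp add: x_def field_simps)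
    have "AE s in lborel. s \<in> {0..t} \<longrightarrow> \<zeta> (v s (a + (s - t) / \<epsilon>)) = \<zeta> (vel G s x)"
      using v' by eventually_elim (use False t in \<open>auto simp: eq\<close>)
    then have "(LINT s|lebesgue_on {0..t}. \<zeta> (v s (a + (s - t) / \<epsilon>))) = (LBINT s:{0..t}. \<zeta> (vel G s x))"
      by (intro lebesgue_on_cong_AE(3)) measurable
    also have "\<dots> = cum G t x" using False by (simp add: cum_def max_def)
    finally show ?thesis using False unfolding rho_char_def by (simp add: iff x_def[symmetric] surv_def)
  qed
qed

text \<open>The source integral since birth telescopes to two values of the primitive
  \<open>G\<close>, so the history of \<open>v\<close> enters only through them.\<close>

lemma v_char_label:
  assumes \<sigma>[measurable]: "\<sigma> \<in> borel_measurable borel" and \<sigma>i: "set_integrable lborel {0..T} \<sigma>"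
    and g: "AE s in lborel. s \<in> {0<..<T} \<longrightarrow> g s = \<epsilon> * \<sigma> s"
    and G: "\<And>t. t \<in> {0..T} \<Longrightarrow> G t = (LBINT s:{0..t}. \<sigma> s)"
    and t: "t \<in> {0..T}" and a: "0 \<le> a"
  shows "v_char \<epsilon> vI g t a = (if a < t / \<epsilon> then G t - G (t - \<epsilon> * a) else vI (a - t / \<epsilon>) + G t)"
proof -
  have g': "AE s in lborel. s \<in> {0..T} \<longrightarrow> g s = \<epsilon> * \<sigma> s"
    using g AE_lborel_singleton[of 0] AE_lborel_singleton[of T] by eventually_elim auto
  have I: "1 / \<epsilon> * (LINT s|lebesgue_on {c..t}. g s) = (LBINT s:{c..t}. \<sigma> s)" if c: "0 \<le> c" for c
  proof -
    have "AE s in lborel. s \<in> {c..t} \<longrightarrow> g s = \<epsilon> * \<sigma> s"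
      using g' by eventually_elim (use c t in auto)
    then have "(LINT s|lebesgue_on {c..t}. g s) = (LBINT s:{c..t}. \<epsilon> * \<sigma> s)"
      by (intro lebesgue_on_cong_AE(3)) auto
    then show ?thesis using eps by simp
  qed
  show ?thesis
  proof (cases "a < t / \<epsilon>")
    case True
    then have x: "0 \<le> t - \<epsilon> * a" "t - \<epsilon> * a \<le> t" using a eps by (auto simp: field_simps)
    have si: "set_integrable lborel {p..q} \<sigma>" if "0 \<le> p" "q \<le> T" for p q
      by (rule set_integrable_subset[OF \<sigma>i]) (use that in auto)
    note HK = set_borel_integral_eq_integral[OF si]
    have "integral {0..t - \<epsilon> * a} \<sigma> + integral {t - \<epsilon> * a..t} \<sigma> = integral {0..t} \<sigma>"
      using x t by (intro Henstock_Kurzweil_Integration.integral_combine HK(1)) auto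
    then have "G (t - \<epsilon> * a) + (LBINT s:{t - \<epsilon> * a..t}. \<sigma> s) = G t"
      using x t by (simp add: G HK(2))
    then show ?thesis using True I[OF x(1)] by (simp add: v_char_def)
  next
    case False
    then show ?thesis using I[of 0] G[OF t] by (simp add: v_char_def)
  qed
qed

lemma AE_v_char:
  assumes "\<sigma> \<in> borel_measurable borel" "set_integrable lborel {0..T} \<sigma>"
    and "AE s in lborel. s \<in> {0<..<T} \<longrightarrow> g s = \<epsilon> * \<sigma> s"
    and "\<And>t. t \<in> {0..T} \<Longrightarrow> G t = (LBINT s:{0..t}. \<sigma> s)"
    and t: "t \<in> {0..T}"
  shows "AE a in lborel. 0 \<le> a \<longrightarrow> v_char \<epsilon> vI g t a = vel G t (t - \<epsilon> * a)"
  using AE_initial[of t]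
proof eventually_elim
  fix a assume i: "t / \<epsilon> \<le> a \<longrightarrow> vI (a - t / \<epsilon>) = - h0 (t - \<epsilon> * a) \<and> \<rho>I (a - t / \<epsilon>) = r0 (t - \<epsilon> * a)"
  have "a < t / \<epsilon> \<longleftrightarrow> 0 < t - \<epsilon> * a" using eps by (simp add: field_simps)
  then show "0 \<le> a \<longrightarrow> v_char \<epsilon> vI g t a = vel G t (t - \<epsilon> * a)"
    using v_char_label[OF assms(1-4) t, of a] i by (auto simp: vel_def lab_def)
qed

text \<open>At a fixed time, age and label are related by an affine map, so a property of almost
  every characteristic holds at almost every age.\<close>

lemma AE_rho_char:
  assumes G: "continuous_on UNIV G" and t: "t \<in> {0..T}"
    and v: "AE x in lborel. AE \<tau> in lborel. \<tau> \<in> {0<..<T} \<and> x \<le> \<tau> \<longrightarrow> v \<tau> ((\<tau> - x) / \<epsilon>) = vel G \<tau> x"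
    and b: "\<And>s. s \<in> {0..T} \<Longrightarrow> b s = \<beta> s * (1 - mu0 \<rho> s)"
  shows "AE a in lborel. 0 \<le> a \<longrightarrow> rho_char \<epsilon> \<beta> \<zeta> \<rho>I \<rho> v t a = wt b (t - \<epsilon> * a) * surv G t (t - \<epsilon> * a)"
proof -
  have "AE a in lborel. AE \<tau> in lborel. \<tau> \<in> {0<..<T} \<and> t + (- \<epsilon>) * a \<le> \<tau> \<longrightarrow> v \<tau> ((\<tau> - (t + (- \<epsilon>) * a)) / \<epsilon>) = vel G \<tau> (t + (- \<epsilon>) * a)"
    by (rule AE_lborel_affine[OF _ v]) (use eps in simp)
  then have "AE a in lborel. AE \<tau> in lborel. \<tau> \<in> {0<..<T} \<and> t - \<epsilon> * a \<le> \<tau> \<longrightarrow> v \<tau> ((\<tau> - (t - \<epsilon> * a)) / \<epsilon>) = vel G \<tau> (t - \<epsilon> * a)"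
    by simp
  then show ?thesis using AE_initial[of t]
  proof eventually_elim
    fix a assume 1: "AE \<tau> in lborel. \<tau> \<in> {0<..<T} \<and> t - \<epsilon> * a \<le> \<tau> \<longrightarrow> v \<tau> ((\<tau> - (t - \<epsilon> * a)) / \<epsilon>) = vel G \<tau> (t - \<epsilon> * a)"
      and i: "t / \<epsilon> \<le> a \<longrightarrow> vI (a - t / \<epsilon>) = - h0 (t - \<epsilon> * a) \<and> \<rho>I (a - t / \<epsilon>) = r0 (t - \<epsilon> * a)"
    show "0 \<le> a \<longrightarrow> rho_char \<epsilon> \<beta> \<zeta> \<rho>I \<rho> v t a = wt b (t - \<epsilon> * a) * surv G t (t - \<epsilon> * a)"
    proof
      assume a: "0 \<le> a"
      have iff: "a < t / \<epsilon> \<longleftrightarrow> 0 < t - \<epsilon> * a" using eps by (simp add: field_simps)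
      have "0 < t - \<epsilon> * a \<longrightarrow> t - \<epsilon> * a \<in> {0..T}" using t a eps by (auto intro: order_trans[of _ t])
      then show "rho_char \<epsilon> \<beta> \<zeta> \<rho>I \<rho> v t a = wt b (t - \<epsilon> * a) * surv G t (t - \<epsilon> * a)"
        using rho_char_label[where v=v and \<rho>=\<rho>, OF G t a 1] i iff b by (auto simp: wt_def)
    qed
  qed
qed


text \<open>The density is merely integrable in age. The difference between two times is split into
  a change of time at fixed label, which tends to 0 by dominated convergence, and a change of label
  at fixed time, which is a translation of \<open>R t\<close> by \<open>X n - t\<close>.\<close>

lemma density_time_continuous:
  assumes a: "admissible B M G b" and t: "t \<in> {0..T}" and X: "\<And>n. X n \<in> {0..T}" "X \<longlonglongrightarrow> t"
  shows "(\<lambda>n. LINT a|lebesgue_on {0..}. \<bar>wt b (X n - \<epsilon> * a) * surv G (X n) (X n - \<epsilon> * a) - wt b (t - \<epsilon> * a) * surv G t (t - \<epsilon> * a)\<bar>) \<longlonglongrightarrow> 0"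
proof -
  note A = admissibleD[OF a]
  note [measurable] = A(5,7) surv_measurable
  \<comment> \<open>Extension by 0 to the labels above \<open>s\<close>, not yet born at time
    \<open>s\<close>, makes translation on the whole line meaningful.\<close>
  define R where "R = (\<lambda>s y. indicat_real {..s} y * (wt b y * surv G s y))"
  have Rm[measurable]: "R s \<in> borel_measurable borel" for s unfolding R_def by measurable
  have Ri: "integrable lborel (R s)" if "s \<le> T" for s
    using integrand_integrable[OF a quad_growth_const that] by (simp add: R_def set_integrable_def)
  have Rb: "\<bar>R s y\<bar> \<le> indicat_real {..T} y *\<^sub>R dom B M y" if "s \<le> T" for s y
    using integrand_bound[OF a quad_growth_const, of y s] dom_nonneg[OF A(1), of M y] that
    by (auto simp: R_def indicator_def)
  have XT: "X n \<le> T" for n using X(1)[of n] by simp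
  have tT: "t \<le> T" using t by simp
  define e where "e = (\<lambda>n. (\<integral>y. \<bar>R (X n) y - R t y\<bar> \<partial>lborel))"
  have di: "integrable lborel (\<lambda>y. indicat_real {..T} y *\<^sub>R dom B M y)"
    using dom_integrable[OF A(1,2), of T] by (simp add: set_integrable_def)
  have e0: "e \<longlonglongrightarrow> 0"
  proof -
    have "(\<lambda>n. (\<integral>y. \<bar>R (X n) y - R t y\<bar> \<partial>lborel)) \<longlonglongrightarrow> (\<integral>y. 0 \<partial>(lborel :: real measure))"
    proof (rule integral_dominated_convergence[where w="\<lambda>y. 2 * (indicat_real {..T} y *\<^sub>R dom B M y)"])
      show "integrable lborel (\<lambda>y. 2 * (indicat_real {..T} y *\<^sub>R dom B M y))" using di by (rule integrable_mult_right)
      show "AE y in lborel. (\<lambda>n. \<bar>R (X n) y - R t y\<bar>) \<longlonglongrightarrow> 0"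
        \<comment> \<open>At the label \<open>y = t\<close> the cut-off may jump with
          \<open>X n\<close>; every other label is eventually on one side of
          \<open>X n\<close>.\<close>
        using AE_lborel_singleton[of t]
      proof eventually_elim
        fix y assume "y \<noteq> t"
        have "(\<lambda>n. R (X n) y) \<longlonglongrightarrow> R t y"
        proof (cases "y < t")
          case True
          have ev: "\<forall>\<^sub>F n in sequentially. X n \<in> {max y 0..T}"
            using order_tendstoD(1)[OF X(2) True] by eventually_elim (use X(1) in auto)
          have "((\<lambda>n. surv G (X n) y) \<longlongrightarrow> surv G t y) sequentially"
            by (rule continuous_on_tendsto_compose[OF surv_continuous[OF A(3), of y T] X(2) _ ev]) (use True t in auto)
          then have "(\<lambda>n. wt b y * surv G (X n) y) \<longlonglongrightarrow> R t y"
            using True by (auto simp: R_def intro!: tendsto_intros)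
          moreover have "\<forall>\<^sub>F n in sequentially. wt b y * surv G (X n) y = R (X n) y"
            using ev by eventually_elim (auto simp: R_def)
          ultimately show ?thesis by (rule Lim_transform_eventually)
        next
          case False
          then have ty: "t < y" using \<open>y \<noteq> t\<close> by simp
          have "\<forall>\<^sub>F n in sequentially. R (X n) y = R t y"
            using order_tendstoD(2)[OF X(2) ty] by eventually_elim (use ty in \<open>auto simp: R_def\<close>)
          then show ?thesis by (rule tendsto_eventually)
        qed
        then have "(\<lambda>n. \<bar>R (X n) y - R t y\<bar>) \<longlonglongrightarrow> \<bar>R t y - R t y\<bar>" by (intro tendsto_intros)
        then show "(\<lambda>n. \<bar>R (X n) y - R t y\<bar>) \<longlonglongrightarrow> 0" by simp
      qed
      show "AE y in lborel. norm \<bar>R (X n) y - R t y\<bar> \<le> 2 * (indicat_real {..T} y *\<^sub>R dom B M y)" for n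
      proof (rule AE_I2)
        fix y show "norm \<bar>R (X n) y - R t y\<bar> \<le> 2 * (indicat_real {..T} y *\<^sub>R dom B M y)"
          using Rb[OF XT, of n y] Rb[OF tT, of y] unfolding real_norm_def by linarith
      qed
    qed measurable
    then show ?thesis by (simp add: e_def)
  qed
  have o0: "(\<lambda>n. translation_osc (R t) (X n - t)) \<longlonglongrightarrow> 0"
    by (rule translation_osc_tendsto[OF Ri[OF tT]]) (use tendsto_diff[OF X(2) tendsto_const[of t]] in simp)
  have le: "(LINT a|lebesgue_on {0..}. \<bar>wt b (s - \<epsilon> * a) * surv G s (s - \<epsilon> * a) - wt b (t - \<epsilon> * a) * surv G t (t - \<epsilon> * a)\<bar>)
      \<le> ((\<integral>y. \<bar>R s y - R t y\<bar> \<partial>lborel) + translation_osc (R t) (s - t)) / \<epsilon>" if s: "s \<le> T" for s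
  proof -
    let ?f = "\<lambda>a. \<bar>wt b (s - \<epsilon> * a) * surv G s (s - \<epsilon> * a) - wt b (t - \<epsilon> * a) * surv G t (t - \<epsilon> * a)\<bar>"
    have fm: "?f \<in> borel_measurable borel" by measurable
    define P where "P = (\<lambda>y. \<bar>R s y - R t y\<bar>)"
    define Q where "Q = (\<lambda>y. \<bar>R t (y + (s - t)) - R t y\<bar>)"
    have Pi: "integrable lborel P" unfolding P_def using Ri[OF s] Ri[OF tT] by auto
    have Qi: "integrable lborel Q" unfolding Q_def using Ri[OF tT] integrable_translate[of "R t" "s - t"] by auto
    have aff: "integrable lborel (\<lambda>a. H (c - \<epsilon> * a))" "(\<integral>a. H (c - \<epsilon> * a) \<partial>lborel) = (\<integral>y. H y \<partial>lborel) / \<epsilon>"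
      if "integrable lborel H" for H :: "real \<Rightarrow> real" and c
      using lborel_integrable_real_affine[OF that, of "- \<epsilon>" c] lborel_integral_real_affine[of "- \<epsilon>" H c] eps by simp_all
    have "(LINT a|lebesgue_on {0..}. ?f a) = (LBINT a:{0..}. ?f a)"
      by (rule lebesgue_on_cong_AE(3)[OF _ fm]) auto
    also have "\<dots> \<le> (\<integral>a. P (s - \<epsilon> * a) + Q (t - \<epsilon> * a) \<partial>lborel)"
      unfolding set_lebesgue_integral_def
    proof (rule integral_mono')
      show "integrable lborel (\<lambda>a. P (s - \<epsilon> * a) + Q (t - \<epsilon> * a))" by (intro Bochner_Integration.integrable_add aff Pi Qi)
      fix a
      show "indicat_real {0..} a *\<^sub>R ?f a \<le> P (s - \<epsilon> * a) + Q (t - \<epsilon> * a)"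
      proof (cases "0 \<le> a")
        case True
        then have "wt b (s - \<epsilon> * a) * surv G s (s - \<epsilon> * a) = R s (s - \<epsilon> * a)" "wt b (t - \<epsilon> * a) * surv G t (t - \<epsilon> * a) = R t (t - \<epsilon> * a)"
          using eps by (auto simp: R_def)
        moreover have "t - \<epsilon> * a + (s - t) = s - \<epsilon> * a" by simp
        ultimately show ?thesis using True by (simp add: P_def Q_def)
      qed (simp add: P_def Q_def)
      show "0 \<le> P (s - \<epsilon> * a) + Q (t - \<epsilon> * a)" by (simp add: P_def Q_def)
    qed
    also have "\<dots> = (\<integral>y. P y \<partial>lborel) / \<epsilon> + (\<integral>y. Q y \<partial>lborel) / \<epsilon>"
      using aff[OF Pi, of s] aff[OF Qi, of t] by simp
    finally show ?thesis by (simp add: P_def Q_def translation_osc_def add_divide_distrib)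
  qed
  show ?thesis
  proof (rule Lim_null_comparison)
    show "(\<lambda>n. (e n + translation_osc (R t) (X n - t)) / \<epsilon>) \<longlonglongrightarrow> 0"
      using tendsto_divide[OF tendsto_add[OF e0 o0] tendsto_const[of \<epsilon>]] eps by simp
    show "\<forall>\<^sub>F n in sequentially. norm (LINT a|lebesgue_on {0..}. \<bar>wt b (X n - \<epsilon> * a) * surv G (X n) (X n - \<epsilon> * a) - wt b (t - \<epsilon> * a) * surv G t (t - \<epsilon> * a)\<bar>)
       \<le> (e n + translation_osc (R t) (X n - t)) / \<epsilon>"
      using le[OF XT] by (intro always_eventually allI) (simp add: e_def abs_of_nonneg)
  qed
qed

section \<open>From the Volterra system to a solution\<close>

lemma char_solution_of_system:
  assumes a: "admissible B M G b" and b: "\<And>s. s \<in> {0..T} \<Longrightarrow> b s = \<beta> s * (1 - \<mu> s)"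
    and \<mu>c: "continuous_on UNIV \<mu>" and m: "0 < m" "\<And>s. m \<le> \<mu> s"
    and \<mu>: "\<And>t. t \<in> {0..T} \<Longrightarrow> \<mu> t = mom (\<lambda>_. 1) G b t"
    and G: "\<And>t. t \<in> {0..T} \<Longrightarrow> G t = (LBINT s:{0..t}. (D s + mom kk G b s / \<epsilon>) / \<mu> s)"
    and h0: "\<And>x. x \<le> 0 \<Longrightarrow> \<bar>h0 x\<bar> \<le> C * (1 - x / \<epsilon>)" and C: "0 \<le> C"
  shows "char_solution \<epsilon> T \<zeta> \<beta> f \<rho>I vI (\<lambda>t a. wt b (t - \<epsilon> * a) * surv G t (t - \<epsilon> * a)) (\<lambda>t a. vel G t (t - \<epsilon> * a))"
proof -
  note A = admissibleD[OF a]
  define \<rho> where "\<rho> = (\<lambda>t a. wt b (t - \<epsilon> * a) * surv G t (t - \<epsilon> * a))"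
  define v where "v = (\<lambda>t a. vel G t (t - \<epsilon> * a))"
  note [measurable] = A(5,7) mom_borel[OF A(7,5)] borel_measurable_continuous_onI[OF \<mu>c] surv_measurable vel_measurable
  have kkm[measurable]: "mom kk G b \<in> borel_measurable borel" by measurable
  define \<sigma> where "\<sigma> = (\<lambda>s. (D s + mom kk G b s / \<epsilon>) / \<mu> s)"
  have \<sigma>m[measurable]: "\<sigma> \<in> borel_measurable borel" unfolding \<sigma>_def by measurable
  have \<sigma>i: "set_integrable lborel {0..T} \<sigma>"
  proof (rule set_integrable_bounded_borel[OF \<sigma>m])
    fix s assume s: "s \<in> {0..T}"
    have "\<bar>mom kk G b s\<bar> / \<epsilon> \<le> Z * J B M / \<epsilon> / \<epsilon>"
      using mom_bound[OF a quad_growth_kk, of s] s eps by (intro divide_right_mono) auto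
    then have "\<bar>D s + mom kk G b s / \<epsilon>\<bar> \<le> Dm + Z * J B M / \<epsilon> / \<epsilon>"
      using D_bound[of s] abs_triangle_ineq[of "D s" "mom kk G b s / \<epsilon>"] eps by (simp add: abs_divide)
    then show "\<bar>\<sigma> s\<bar> \<le> (Dm + Z * J B M / \<epsilon> / \<epsilon>) / m"
      unfolding \<sigma>_def abs_divide using m(1) m(2)[of s] by (intro frac_le) auto
  qed
  have mu: "mu0 \<rho> t = \<mu> t" and \<rho>i: "integrable (lebesgue_on {0..}) (\<rho> t)" if t: "t \<in> {0..T}" for t
    using integral_over_ages[OF a quad_growth_const, of t "\<rho> t"] t \<mu>[OF t] by (auto simp: mu0_def \<rho>_def)
  have k: "(LINT a|lebesgue_on {0..}. \<zeta> (v t a) * v t a * \<rho> t a) = mom kk G b t"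
    and ki: "integrable (lebesgue_on {0..}) (\<lambda>a. \<zeta> (v t a) * v t a * \<rho> t a)" if t: "t \<in> {0..T}" for t
    using integral_over_ages[OF a quad_growth_kk, of t "\<lambda>a. \<zeta> (v t a) * v t a * \<rho> t a"] t
    by (auto simp: v_def \<rho>_def mult_ac)
  have src: "AE s in lborel. s \<in> {0<..<T} \<longrightarrow> v_source \<epsilon> f \<zeta> \<rho> v s = \<epsilon> * \<sigma> s"
    using D_deriv
  proof eventually_elim
    fix s assume d: "s \<in> {0<..<T} \<longrightarrow> D s = deriv f s"
    show "s \<in> {0<..<T} \<longrightarrow> v_source \<epsilon> f \<zeta> \<rho> v s = \<epsilon> * \<sigma> s"
    proof
      assume s: "s \<in> {0<..<T}"
      then have "s \<in> {0..T}" by auto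
      then show "v_source \<epsilon> f \<zeta> \<rho> v s = \<epsilon> * \<sigma> s"
        unfolding v_source_def using d s eps by (simp add: k mu \<sigma>_def distrib_left add_divide_distrib)
    qed
  qed
  \<comment> \<open>The linear growth in age comes from the initial labels; the estimate serves both
    on compact sets and in the weighted norm.\<close>
  have vb: "\<bar>v t a\<bar> \<le> (2 * M + C) * (1 + a)" if "0 \<le> t" "0 \<le> a" for t a
  proof -
    have p: "0 \<le> M * a" "0 \<le> C * a" using A(2) C that by auto
    have "\<bar>lab G (t - \<epsilon> * a)\<bar> \<le> M + C * (1 + a)"
    proof (cases "0 < t - \<epsilon> * a")
      case True then show ?thesis using A(4)[of "t - \<epsilon> * a"] p C by (simp add: lab_def algebra_simps)
    next
      case False
      have "\<bar>h0 (t - \<epsilon> * a)\<bar> \<le> C * (1 - (t - \<epsilon> * a) / \<epsilon>)" using False by (intro h0) simp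
      also have "\<dots> \<le> C * (1 + a)" using that eps C by (intro mult_left_mono) (auto simp: field_simps)
      finally show ?thesis using False A(2) by (simp add: lab_def)
    qed
    then show ?thesis using A(4)[of t] p by (simp add: v_def vel_def algebra_simps)
  qed
  have XT: "XT T v"
    unfolding XT_def
  proof
    have vm: "(\<lambda>(t, a). v t a) \<in> borel_measurable borel"
      unfolding v_def case_prod_beta' borel_prod[symmetric] by measurable
    then have vm': "(\<lambda>(t, a). v t a) \<in> borel_measurable (lebesgue_on K)" for K
      by (intro measurable_restrict_space1 measurable_completion) simp
    show "Linf_loc ({0<..<T} \<times> {0..}) (\<lambda>(t, a). v t a)"
      unfolding Linf_loc_def
    proof (intro conjI allI impI vm')
      fix K :: "(real \<times> real) set" assume K: "compact K \<and> K \<subseteq> {0<..<T} \<times> {0..}"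
      then obtain r where r: "\<And>p. p \<in> K \<Longrightarrow> norm p \<le> r"
        using compact_imp_bounded bounded_iff by metis
      have sp: "\<bar>v t a\<bar> \<le> (2 * M + C) * (1 + r)" if "(t, a) \<in> K" for t a
      proof -
        have "0 \<le> t" "0 \<le> a" using that K by auto
        moreover have "a \<le> r" using r[OF that] norm_snd_le[of a t] by simp
        ultimately show ?thesis using vb[of t a] A(2) C mult_left_mono[of "1 + a" "1 + r" "2 * M + C"] by linarith
      qed
      show "Linf K (\<lambda>(t, a). v t a)"
        by (rule Linf_I[OF vm', of "(2 * M + C) * (1 + r)"]) (rule AE_I2, use sp in auto)
    qed
    have "XT_norm T v \<le> ereal (2 * M + C)"
      unfolding XT_norm_def
    proof (rule SUP_least)
      fix t assume t: "t \<in> {0<..<T}"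
      show "esssup (lebesgue_on {0..}) (\<lambda>a. ereal \<bar>v t a * omega a\<bar>) \<le> ereal (2 * M + C)"
      proof (rule esssup_I)
        have "(\<lambda>a. ereal \<bar>v t a * omega a\<bar>) \<in> borel_measurable lborel"
          unfolding v_def omega_def by measurable
        then show "(\<lambda>a. ereal \<bar>v t a * omega a\<bar>) \<in> borel_measurable (lebesgue_on {0..})"
          by (intro measurable_restrict_space1 measurable_completion)
        show "AE a in lebesgue_on {0..}. ereal \<bar>v t a * omega a\<bar> \<le> ereal (2 * M + C)"
          by (rule AE_I2) (use vb[of t] t in \<open>auto simp: omega_def abs_mult pos_divide_le_eq\<close>)
      qed
    qed
    then show "XT_norm T v < \<infinity>" by (rule order.strict_trans1) simp
  qed
  have CL: "C_L1 T \<rho>"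
    unfolding C_L1_def
  proof (intro conjI ballI \<rho>i)
    fix t assume t: "t \<in> {0..T}"
    show "((\<lambda>s. LINT a|lebesgue_on {0..}. \<bar>\<rho> s a - \<rho> t a\<bar>) \<longlongrightarrow> 0) (at t within {0..T})"
      unfolding tendsto_at_iff_sequentially o_def \<rho>_def
      by (intro allI impI density_time_continuous[OF a t]) auto
  qed
  have "char_solution \<epsilon> T \<zeta> \<beta> f \<rho>I vI \<rho> v"
    unfolding char_solution_def
  proof (intro conjI ballI CL XT)
    show "mu0 \<rho> t \<noteq> 0" if "t \<in> {0<..<T}" for t using mu[of t] m(1) m(2)[of t] that by auto
    show "integrable (lebesgue_on {0..}) (\<lambda>a. \<zeta> (v t a) * v t a * \<rho> t a)" if "t \<in> {0<..<T}" for t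
      using ki[of t] that by auto
    show "integrable (lebesgue_on {0<..<T}) (v_source \<epsilon> f \<zeta> \<rho> v)"
    proof (subst lebesgue_on_cong_AE(2)[OF _ _ src])
      show "set_integrable lborel {0<..<T} (\<lambda>s. \<epsilon> * \<sigma> s)"
        by (rule set_integrable_mult_right, rule set_integrable_subset[OF \<sigma>i]) auto
    qed measurable
    show "AE a in lebesgue_on {0..}. \<rho> t a = rho_char \<epsilon> \<beta> \<zeta> \<rho>I \<rho> v t a" if t: "t \<in> {0..T}" for t
    proof -
      have "AE x in lborel. AE \<tau> in lborel. \<tau> \<in> {0<..<T} \<and> x \<le> \<tau> \<longrightarrow> v \<tau> ((\<tau> - x) / \<epsilon>) = vel G \<tau> x"
        using eps by (simp add: v_def)
      then have "AE a in lborel. 0 \<le> a \<longrightarrow> rho_char \<epsilon> \<beta> \<zeta> \<rho>I \<rho> v t a = wt b (t - \<epsilon> * a) * surv G t (t - \<epsilon> * a)"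
        by (rule AE_rho_char[OF A(3) t]) (simp add: b mu)
      then show ?thesis unfolding AE_lebesgue_on_iff[OF borel_closed[OF closed_atLeast]]
        by eventually_elim (simp add: \<rho>_def)
    qed
    show "AE a in lebesgue_on {0..}. v t a = v_char \<epsilon> vI (v_source \<epsilon> f \<zeta> \<rho> v) t a" if t: "t \<in> {0<..<T}" for t
    proof -
      have "t \<in> {0..T}" using t by auto
      then have "AE a in lborel. 0 \<le> a \<longrightarrow> v_char \<epsilon> vI (v_source \<epsilon> f \<zeta> \<rho> v) t a = vel G t (t - \<epsilon> * a)"
        by (intro AE_v_char[OF \<sigma>m \<sigma>i src]) (simp add: G \<sigma>_def)
      then show ?thesis unfolding AE_lebesgue_on_iff[OF borel_closed[OF closed_atLeast]]
        by eventually_elim (simp add: v_def)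
    qed
  qed
  then show ?thesis unfolding \<rho>_def v_def .
qed

text \<open>
  A velocity given almost everywhere in age at each time is given almost everywhere along almost
  every characteristic: shear the exceptional set, which is null by Fubini's theorem.
\<close>

lemma AE_along_characteristics:
  assumes vm: "(\<lambda>(t, a). v t a) \<in> borel_measurable (lebesgue_on ({0<..<T} \<times> {0..}))"
    and G[measurable]: "G \<in> borel_measurable borel"
    and v: "\<And>t. t \<in> {0<..<T} \<Longrightarrow> AE a in lborel. 0 \<le> a \<longrightarrow> v t a = vel G t (t - \<epsilon> * a)"
  shows "AE x in lborel. AE t in lborel. t \<in> {0<..<T} \<and> x \<le> t \<longrightarrow> v t ((t - x) / \<epsilon>) = vel G t x"
proof -
  note [measurable] = vel_measurable
  let ?S = "{0<..<T} \<times> {0::real..}"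
  have S: "?S \<in> sets borel" unfolding borel_prod[symmetric] by (intro pair_measureI) auto
  obtain V where V: "V \<in> borel_measurable borel" "AE p in lborel. p \<in> ?S \<longrightarrow> (case p of (t, a) \<Rightarrow> v t a) = V p"
    by (rule lebesgue_on_borel_rep[OF S vm])
  obtain N where N0: "\<And>p. p \<in> space lborel - N \<Longrightarrow> p \<in> ?S \<longrightarrow> (case p of (t, a) \<Rightarrow> v t a) = V p"
    and N1: "N \<in> null_sets lborel"
  proof (rule AE_E3[OF V(2)])
    fix N assume 1: "\<And>p. p \<in> space lborel - N \<Longrightarrow> p \<in> ?S \<longrightarrow> (case p of (t, a) \<Rightarrow> v t a) = V p"
      and 2: "N \<in> null_sets lborel"
    show thesis by (rule that[OF 1 2])
  qed
  have N0': "p \<in> ?S \<longrightarrow> (case p of (t, a) \<Rightarrow> v t a) = V p" if "p \<notin> N" for p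
    by (rule N0) (use that in simp)
  note N = N1 N0'
  have [measurable]: "N \<in> sets (borel \<Otimes>\<^sub>M borel)" unfolding borel_prod using null_setsD2[OF N(1)] by simp
  have [measurable]: "V \<in> borel_measurable (borel \<Otimes>\<^sub>M borel)" unfolding borel_prod by (rule V(1))
  \<comment> \<open>\<open>V\<close> and \<open>N\<close> stand in for \<open>v\<close> to make the
    condition jointly Borel, as the exchange of the two almost everywhere quantifiers requires;
    avoiding \<open>N\<close> is carried along in order to return to \<open>v\<close> at the
    end.\<close>
  define Q where "Q = (\<lambda>t x. 0 < t \<and> t < T \<and> x \<le> t \<longrightarrow> (t, (t - x) / \<epsilon>) \<notin> N \<and> V (t, (t - x) / \<epsilon>) = vel G t x)"
  have "AE p in lborel \<Otimes>\<^sub>M lborel. p \<notin> N" unfolding lborel_prod by (rule AE_not_in[OF N(1)])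
  then have "AE t in lborel. AE a in lborel. (t, a) \<notin> N" by (rule lborel_pair.AE_pair)
  then have "AE t in lborel. AE x in lborel. Q t x"
  proof eventually_elim
    fix t assume n: "AE a in lborel. (t, a) \<notin> N"
    show "AE x in lborel. Q t x"
    proof (cases "t \<in> {0<..<T}")
      case True
      have "AE a in lborel. (t, a) \<notin> N \<and> (0 \<le> a \<longrightarrow> v t a = vel G t (t - \<epsilon> * a))"
        using n v[OF True] by eventually_elim auto
      then have "AE x in lborel. (t, t / \<epsilon> + (- 1 / \<epsilon>) * x) \<notin> N \<and>
          (0 \<le> t / \<epsilon> + (- 1 / \<epsilon>) * x \<longrightarrow> v t (t / \<epsilon> + (- 1 / \<epsilon>) * x) = vel G t (t - \<epsilon> * (t / \<epsilon> + (- 1 / \<epsilon>) * x)))"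
        by (rule AE_lborel_affine[rotated]) (use eps in simp)
      then show ?thesis
      proof eventually_elim
        fix x assume 1: "(t, t / \<epsilon> + (- 1 / \<epsilon>) * x) \<notin> N \<and>
          (0 \<le> t / \<epsilon> + (- 1 / \<epsilon>) * x \<longrightarrow> v t (t / \<epsilon> + (- 1 / \<epsilon>) * x) = vel G t (t - \<epsilon> * (t / \<epsilon> + (- 1 / \<epsilon>) * x)))"
        have e: "t / \<epsilon> + (- 1 / \<epsilon>) * x = (t - x) / \<epsilon>" by (simp add: diff_divide_distrib)
        have e2: "t - \<epsilon> * ((t - x) / \<epsilon>) = x" using eps by simp
        have 2: "(t, (t - x) / \<epsilon>) \<notin> N \<and> (0 \<le> (t - x) / \<epsilon> \<longrightarrow> v t ((t - x) / \<epsilon>) = vel G t x)"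
          using 1 unfolding e e2 .
        show "Q t x"
          unfolding Q_def
        proof (intro impI conjI)
          assume t: "0 < t \<and> t < T \<and> x \<le> t"
          show n: "(t, (t - x) / \<epsilon>) \<notin> N" using 2 by blast
          have p: "0 \<le> (t - x) / \<epsilon>" using t eps by simp
          then have "v t ((t - x) / \<epsilon>) = vel G t x" using 2 by blast
          then show "V (t, (t - x) / \<epsilon>) = vel G t x" using N(2)[OF n] True p by simp
        qed
      qed
    qed (auto simp: Q_def)
  qed
  moreover have "{p \<in> space (lborel \<Otimes>\<^sub>M lborel). Q (fst p) (snd p)} \<in> sets (lborel \<Otimes>\<^sub>M lborel)"
    unfolding Q_def by measurable
  ultimately have "AE x in lborel. AE t in lborel. Q t x" using lborel_pair.AE_commute[of Q] by simp
  then show ?thesis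
  proof eventually_elim
    fix x assume "AE t in lborel. Q t x"
    then show "AE t in lborel. t \<in> {0<..<T} \<and> x \<le> t \<longrightarrow> v t ((t - x) / \<epsilon>) = vel G t x"
    proof eventually_elim
      fix t assume q: "Q t x"
      show "t \<in> {0<..<T} \<and> x \<le> t \<longrightarrow> v t ((t - x) / \<epsilon>) = vel G t x"
        using q N(2)[of "(t, (t - x) / \<epsilon>)"] eps by (auto simp: Q_def)
    qed
  qed
qed

section \<open>From a solution to the Volterra system, and uniqueness\<close>

lemma C_L1_mu0_continuous:
  assumes "C_L1 T \<rho>"
  shows "continuous_on {0..T} (mu0 \<rho>)"
  unfolding continuous_on_def
proof
  fix t assume t: "t \<in> {0..T}"
  have i: "integrable (lebesgue_on {0..}) (\<rho> s)" if "s \<in> {0..T}" for s using assms that by (auto simp: C_L1_def)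
  have "((\<lambda>s. mu0 \<rho> s - mu0 \<rho> t) \<longlongrightarrow> 0) (at t within {0..T})"
  proof (rule Lim_null_comparison)
    show "((\<lambda>s. LINT a|lebesgue_on {0..}. \<bar>\<rho> s a - \<rho> t a\<bar>) \<longlongrightarrow> 0) (at t within {0..T})"
      using assms t by (auto simp: C_L1_def)
    show "\<forall>\<^sub>F s in at t within {0..T}. norm (mu0 \<rho> s - mu0 \<rho> t) \<le> (LINT a|lebesgue_on {0..}. \<bar>\<rho> s a - \<rho> t a\<bar>)"
      unfolding eventually_at_filter
    proof (intro always_eventually allI impI)
      fix s assume "s \<in> {0..T}"
      then have "mu0 \<rho> s - mu0 \<rho> t = (LINT a|lebesgue_on {0..}. \<rho> s a - \<rho> t a)"
        unfolding mu0_def using i t by simp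
      then show "norm (mu0 \<rho> s - mu0 \<rho> t) \<le> (LINT a|lebesgue_on {0..}. \<bar>\<rho> s a - \<rho> t a\<bar>)"
        using integral_abs_bound[of "lebesgue_on {0..}" "\<lambda>a. \<rho> s a - \<rho> t a"] by simp
    qed
  qed
  then show "(mu0 \<rho> \<longlongrightarrow> mu0 \<rho> t) (at t within {0..T})" by (simp add: LIM_zero_iff)
qed

text \<open>The source is only known to be integrable; hence \<open>G\<close> is built as a
  continuous primitive, and the bounds for \<open>G\<close> and \<open>b\<close> follow from
  compactness of the time interval after clamping.\<close>

lemma system_of_char_solution:
  assumes sol: "char_solution \<epsilon> T \<zeta> \<beta> f \<rho>I vI \<rho> v"
  obtains G \<mu> b B M where "admissible B M G b" "b = (\<lambda>s. \<beta> (cl s) * (1 - \<mu> s))"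
    "continuous_on UNIV \<mu>" "\<And>t. t \<in> {0<..<T} \<Longrightarrow> \<mu> t \<noteq> 0"
    "\<And>t. t \<in> {0..T} \<Longrightarrow> \<mu> t = mom (\<lambda>_. 1) G b t"
    "\<And>t. t \<in> {0..T} \<Longrightarrow> G t = (LBINT s:{0..t}. (D s + mom kk G b s / \<epsilon>) / \<mu> s)"
    "\<And>t. t \<in> {0..T} \<Longrightarrow> AE a in lebesgue_on {0..}. \<rho> t a = wt b (t - \<epsilon> * a) * surv G t (t - \<epsilon> * a)"
    "\<And>t. t \<in> {0<..<T} \<Longrightarrow> AE a in lebesgue_on {0..}. v t a = vel G t (t - \<epsilon> * a)"
proof -
  let ?g = "v_source \<epsilon> f \<zeta> \<rho> v"
  have CL: "C_L1 T \<rho>" and XT: "XT T v" and nz: "\<And>t. t \<in> {0<..<T} \<Longrightarrow> mu0 \<rho> t \<noteq> 0"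
    and gi: "integrable (lebesgue_on {0<..<T}) ?g"
    and \<rho>: "\<And>t. t \<in> {0..T} \<Longrightarrow> AE a in lebesgue_on {0..}. \<rho> t a = rho_char \<epsilon> \<beta> \<zeta> \<rho>I \<rho> v t a"
    and v: "\<And>t. t \<in> {0<..<T} \<Longrightarrow> AE a in lebesgue_on {0..}. v t a = v_char \<epsilon> vI ?g t a"
    using sol unfolding char_solution_def by auto
  define \<mu> where "\<mu> = (\<lambda>s. mu0 \<rho> (cl s))"
  have \<mu>c: "continuous_on UNIV \<mu>" unfolding \<mu>_def by (rule continuous_cl_compose[OF C_L1_mu0_continuous[OF CL]])
  have \<mu>e: "\<mu> t = mu0 \<rho> t" if "t \<in> {0..T}" for t using that by (simp add: \<mu>_def cl_id)
  define b where "b = (\<lambda>s. \<beta> (cl s) * (1 - \<mu> s))"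
  have bc: "continuous_on UNIV b" unfolding b_def by (intro continuous_intros \<mu>c continuous_cl_compose beta_cont)
  have bcl: "b s = b (cl s)" for s by (simp add: b_def \<mu>_def cl_idem)
  obtain h where h[measurable]: "h \<in> borel_measurable borel" and hg: "AE s in lborel. s \<in> {0<..<T} \<longrightarrow> ?g s = h s"
    by (rule lebesgue_on_borel_rep[OF _ borel_measurable_integrable[OF gi]]) auto
  define \<sigma> where "\<sigma> = (\<lambda>s. if s \<in> {0<..<T} then h s / \<epsilon> else 0)"
  have \<sigma>m[measurable]: "\<sigma> \<in> borel_measurable borel" unfolding \<sigma>_def by measurable
  have g\<sigma>: "AE s in lborel. s \<in> {0<..<T} \<longrightarrow> ?g s = \<epsilon> * \<sigma> s"
    using hg by eventually_elim (use eps in \<open>auto simp: \<sigma>_def\<close>)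
  have \<sigma>i: "set_integrable lborel {0..T} \<sigma>"
  proof -
    have "set_integrable lborel {0<..<T} h"
      using lebesgue_on_cong_AE(2)[OF _ h hg] gi by simp
    then have "set_integrable lborel {0<..<T} (\<lambda>s. h s / \<epsilon>)" by simp
    moreover have "indicat_real {0<..<T} s *\<^sub>R (h s / \<epsilon>) = indicat_real {0..T} s *\<^sub>R \<sigma> s" for s
      by (auto simp: \<sigma>_def indicator_def)
    ultimately show ?thesis unfolding set_integrable_def by simp
  qed
  define G where "G = (\<lambda>t. LBINT s:{0..cl t}. \<sigma> s)"
  have Gcl: "G t = G (cl t)" for t by (simp add: G_def cl_idem)
  have Ge: "G t = (LBINT s:{0..t}. \<sigma> s)" if "t \<in> {0..T}" for t using that by (simp add: G_def cl_id)
  have Gc: "continuous_on UNIV G"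
  proof -
    have "continuous_on {0..T} (\<lambda>t. integral {0..t} \<sigma>)"
      by (rule indefinite_integral_continuous_1[OF set_borel_integral_eq_integral(1)[OF \<sigma>i]])
    moreover have "integral {0..t} \<sigma> = (LBINT s:{0..t}. \<sigma> s)" if "t \<in> {0..T}" for t
      by (rule set_borel_integral_eq_integral(2)[symmetric], rule set_integrable_subset[OF \<sigma>i]) (use that in auto)
    ultimately have "continuous_on {0..T} (\<lambda>t. LBINT s:{0..t}. \<sigma> s)" by (rule continuous_on_eq)
    then show ?thesis unfolding G_def by (rule continuous_cl_compose)
  qed
  have bnd: "\<exists>K. 0 \<le> K \<and> (\<forall>s. \<bar>u s\<bar> \<le> K)" if uc: "continuous_on UNIV u" and ucl: "\<And>s. u s = u (cl s)" for u :: "real \<Rightarrow> real"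
  proof -
    have "compact (u ` {0..T})" by (intro compact_continuous_image continuous_on_subset[OF uc]) auto
    then obtain K where K: "\<And>s. s \<in> {0..T} \<Longrightarrow> \<bar>u s\<bar> \<le> K"
      by (metis compact_imp_bounded bounded_iff image_eqI real_norm_def)
    have "\<bar>u s\<bar> \<le> K" for s using K[OF cl_in[of s]] ucl[of s] by simp
    then show ?thesis using order_trans[OF abs_ge_zero K[of 0]] T by auto
  qed
  obtain M where M: "0 \<le> M" "\<And>s. \<bar>G s\<bar> \<le> M" using bnd[OF Gc Gcl] by blast
  obtain B where B: "0 \<le> B" "\<And>s. \<bar>b s\<bar> \<le> B" using bnd[OF bc bcl] by blast
  have a: "admissible B M G b"
    unfolding admissible_def using M B Gc bc by (auto intro: borel_measurable_continuous_onI)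
  have v': "AE a in lborel. 0 \<le> a \<longrightarrow> v t a = vel G t (t - \<epsilon> * a)" if t: "t \<in> {0<..<T}" for t
  proof -
    have "t \<in> {0..T}" using t by auto
    then have "AE a in lborel. 0 \<le> a \<longrightarrow> v_char \<epsilon> vI ?g t a = vel G t (t - \<epsilon> * a)"
      by (intro AE_v_char[OF \<sigma>m \<sigma>i g\<sigma>] Ge)
    from this v[OF t, unfolded AE_lebesgue_on_iff[OF borel_closed[OF closed_atLeast]]]
    show ?thesis by eventually_elim auto
  qed
  have vm: "(\<lambda>(t, a). v t a) \<in> borel_measurable (lebesgue_on ({0<..<T} \<times> {0..}))"
    using XT by (simp add: XT_def Linf_loc_def)
  have along: "AE x in lborel. AE t in lborel. t \<in> {0<..<T} \<and> x \<le> t \<longrightarrow> v t ((t - x) / \<epsilon>) = vel G t x"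
    by (rule AE_along_characteristics[OF vm admissibleD(7)[OF a] v'])
  have \<rho>': "AE a in lborel. 0 \<le> a \<longrightarrow> \<rho> t a = wt b (t - \<epsilon> * a) * surv G t (t - \<epsilon> * a)" if t: "t \<in> {0..T}" for t
  proof -
    have "b s = \<beta> s * (1 - mu0 \<rho> s)" if "s \<in> {0..T}" for s using that by (simp add: b_def \<mu>e cl_id)
    then have "AE a in lborel. 0 \<le> a \<longrightarrow> rho_char \<epsilon> \<beta> \<zeta> \<rho>I \<rho> v t a = wt b (t - \<epsilon> * a) * surv G t (t - \<epsilon> * a)"
      by (intro AE_rho_char[OF Gc t along])
    from this \<rho>[OF t, unfolded AE_lebesgue_on_iff[OF borel_closed[OF closed_atLeast]]]
    show ?thesis by eventually_elim auto
  qed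
  have \<mu>: "\<mu> t = mom (\<lambda>_. 1) G b t" if t: "t \<in> {0..T}" for t
    using integral_over_ages(2)[OF a quad_growth_const, of t "\<rho> t"] t \<rho>'[OF t] \<mu>e[OF t]
    by (auto simp: AE_lebesgue_on_iff mu0_def)
  have k: "(LINT a|lebesgue_on {0..}. \<zeta> (v t a) * v t a * \<rho> t a) = mom kk G b t" if t: "t \<in> {0<..<T}" for t
  proof (rule integral_over_ages(2)[OF a quad_growth_kk])
    have tT: "t \<in> {0..T}" using t by auto
    show "AE a in lebesgue_on {0..}. \<zeta> (v t a) * v t a * \<rho> t a
        = wt b (t - \<epsilon> * a) * surv G t (t - \<epsilon> * a) * kk (vel G t (t - \<epsilon> * a))"
      unfolding AE_lebesgue_on_iff[OF borel_closed[OF closed_atLeast]]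
      using v'[OF t] \<rho>'[OF tT] by eventually_elim (auto simp: mult_ac)
  qed (use t in auto)
  have \<sigma>eq: "AE s in lborel. s \<in> {0<..<T} \<longrightarrow> \<sigma> s = (D s + mom kk G b s / \<epsilon>) / \<mu> s"
    using g\<sigma> D_deriv
  proof eventually_elim
    fix s assume 1: "s \<in> {0<..<T} \<longrightarrow> ?g s = \<epsilon> * \<sigma> s" and 2: "s \<in> {0<..<T} \<longrightarrow> D s = deriv f s"
    show "s \<in> {0<..<T} \<longrightarrow> \<sigma> s = (D s + mom kk G b s / \<epsilon>) / \<mu> s"
    proof
      assume s: "s \<in> {0<..<T}"
      have "\<mu> s = mu0 \<rho> s" using s by (intro \<mu>e) auto
      then have "?g s = (\<epsilon> * D s + mom kk G b s) / \<mu> s"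
        using s 2 by (simp add: v_source_def k)
      then have "\<epsilon> * \<sigma> s = (\<epsilon> * D s + mom kk G b s) / \<mu> s" using 1 s by simp
      also have "\<epsilon> * D s + mom kk G b s = \<epsilon> * (D s + mom kk G b s / \<epsilon>)" using eps by (simp add: distrib_left)
      finally have "\<epsilon> * \<sigma> s = \<epsilon> * ((D s + mom kk G b s / \<epsilon>) / \<mu> s)"
        unfolding times_divide_eq_right .
      then show "\<sigma> s = (D s + mom kk G b s / \<epsilon>) / \<mu> s" using eps by (metis less_irrefl mult_left_cancel)
    qed
  qed
  have Geq: "G t = (LBINT s:{0..t}. (D s + mom kk G b s / \<epsilon>) / \<mu> s)" if t: "t \<in> {0..T}" for t
    unfolding Ge[OF t] set_lebesgue_integral_def
  proof (rule integral_cong_AE)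
    note [measurable] = mom_borel[OF admissibleD(7,5)[OF a], of kk] borel_measurable_continuous_onI[OF \<mu>c]
    show "(\<lambda>x. indicat_real {0..t} x *\<^sub>R ((D x + mom kk G b x / \<epsilon>) / \<mu> x)) \<in> borel_measurable lborel" by measurable
    show "AE x in lborel. indicat_real {0..t} x *\<^sub>R \<sigma> x = indicat_real {0..t} x *\<^sub>R ((D x + mom kk G b x / \<epsilon>) / \<mu> x)"
      using \<sigma>eq AE_lborel_singleton[of 0] AE_lborel_singleton[of T]
      by eventually_elim (use t in \<open>auto simp: indicator_def\<close>)
  qed measurable
  show ?thesis
  proof (rule that[OF a b_def \<mu>c _ \<mu> Geq])
    show "\<mu> t \<noteq> 0" if "t \<in> {0<..<T}" for t using nz[OF that] \<mu>e[of t] that by auto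
  qed (use \<rho>' v' in \<open>auto simp: AE_lebesgue_on_iff\<close>)
qed


lemma admissible_mono:
  assumes "admissible B M G b" "B \<le> B'" "M \<le> M'"
  shows "admissible B' M' G b"
  using assms unfolding admissible_def by (meson order_trans)

text \<open>A priori the mass \<open>\<mu>2\<close> may vanish at \<open>T\<close>, so
  \<open>system_unique\<close> does not apply directly. On shorter intervals its modulus has a
  positive minimum, the value at 0 being fixed by the initial data; agreement on
  \<open>{0..<T}\<close> extends to \<open>T\<close> by continuity.\<close>

lemma systems_agree:
  assumes R0: "0 < (LBINT x:{..0}. r0 x)"
    and a1: "admissible B1 M1 G1 b1" and b1: "b1 = (\<lambda>s. \<beta> (cl s) * (1 - \<mu>1 s))"
    and \<mu>1: "continuous_on UNIV \<mu>1" "0 < m" "\<And>s. m \<le> \<mu>1 s"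
    and e1: "\<And>t. t \<in> {0..T} \<Longrightarrow> \<mu>1 t = mom (\<lambda>_. 1) G1 b1 t"
      "\<And>t. t \<in> {0..T} \<Longrightarrow> G1 t = (LBINT s:{0..t}. (D s + mom kk G1 b1 s / \<epsilon>) / \<mu>1 s)"
    and a2: "admissible B2 M2 G2 b2" and b2: "b2 = (\<lambda>s. \<beta> (cl s) * (1 - \<mu>2 s))"
    and \<mu>2: "continuous_on UNIV \<mu>2" "\<And>t. t \<in> {0<..<T} \<Longrightarrow> \<mu>2 t \<noteq> 0"
    and e2: "\<And>t. t \<in> {0..T} \<Longrightarrow> \<mu>2 t = mom (\<lambda>_. 1) G2 b2 t"
      "\<And>t. t \<in> {0..T} \<Longrightarrow> G2 t = (LBINT s:{0..t}. (D s + mom kk G2 b2 s / \<epsilon>) / \<mu>2 s)"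
    and t: "t \<in> {0..T}"
  shows "G1 t = G2 t \<and> \<mu>1 t = \<mu>2 t"
proof -
  note A2 = admissibleD[OF a2]
  have \<mu>20: "\<mu>2 0 \<noteq> 0"
    using e2(1)[of 0] mom_initial[OF A2(3), of b2] R0 eps T by auto
  have agree: "G1 t = G2 t \<and> \<mu>1 t = \<mu>2 t" if t: "t \<in> {0..<T}" for t
  proof -
    define T' where "T' = (t + T) / 2"
    have T': "0 < T'" "T' < T" "t \<le> T'" using t T by (auto simp: T'_def)
    \<comment> \<open>\<open>admissible\<close> and \<open>mom\<close> do not involve the horizon,
      so the facts on the given systems carry over to the shorter interval.\<close>
    interpret S: age_transport \<epsilon> T' L \<zeta> h0 r0
      by unfold_locales (use T' eps zeta_lip zeta_nonneg r0_nonneg r0_int in auto)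
    \<comment> \<open>Freezing the second system after \<open>T'\<close> keeps its mass away from 0
      on the whole line.\<close>
    define c where "c = (\<lambda>s::real. max 0 (min T' s))"
    have cin: "c s \<in> {0..T'}" for s using T' by (auto simp: c_def)
    have cid: "c s = s" if "s \<in> {0..T'}" for s using that by (auto simp: c_def)
    have cc: "continuous_on UNIV c" unfolding c_def by (intro continuous_intros)
    have \<mu>2n: "\<mu>2 s \<noteq> 0" if "s \<in> {0..T'}" for s using \<mu>2(2)[of s] \<mu>20 that T' by (cases "s = 0") auto
    have "continuous_on {0..T'} (\<lambda>s. \<bar>\<mu>2 s\<bar>)" by (intro continuous_intros continuous_on_subset[OF \<mu>2(1)]) auto
    then obtain s0 where s0: "s0 \<in> {0..T'}" "\<And>s. s \<in> {0..T'} \<Longrightarrow> \<bar>\<mu>2 s0\<bar> \<le> \<bar>\<mu>2 s\<bar>"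
      using continuous_attains_inf[of "{0..T'}" "\<lambda>s. \<bar>\<mu>2 s\<bar>"] T' by auto
    define m' where "m' = min m \<bar>\<mu>2 s0\<bar>"
    have m': "0 < m'" using \<mu>1(2) \<mu>2n[OF s0(1)] by (simp add: m'_def)
    have "compact (\<beta> ` {0..T})" by (intro compact_continuous_image beta_cont) auto
    then obtain K where K: "\<And>s. s \<in> {0..T} \<Longrightarrow> \<bar>\<beta> s\<bar> \<le> K"
      by (metis compact_imp_bounded bounded_iff image_eqI real_norm_def)
    define B where "B = max K (max B1 B2)"
    define M where "M = max M1 M2"
    have a1': "admissible B M G1 b1" by (rule admissible_mono[OF a1]) (auto simp: B_def M_def)
    have "continuous_on UNIV (\<lambda>s. G2 (c s))" by (rule continuous_on_compose2[OF A2(3) cc]) auto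
    moreover have "(\<lambda>s. b2 (c s)) \<in> borel_measurable borel"
      using A2(5) borel_measurable_continuous_onI[OF cc] by (rule measurable_compose[rotated])
    ultimately have "admissible B2 M2 (\<lambda>s. G2 (c s)) (\<lambda>s. b2 (c s))"
      using A2 unfolding admissible_def by auto
    then have a2': "admissible B M (\<lambda>s. G2 (c s)) (\<lambda>s. b2 (c s))"
      by (rule admissible_mono) (auto simp: B_def M_def)
    have mc: "mom \<phi> (\<lambda>s. G2 (c s)) (\<lambda>s. b2 (c s)) s = mom \<phi> G2 b2 s" if "s \<in> {0..T'}" for \<phi> s
      by (rule mom_cong) (use that cid in auto)
    have "G1 t = G2 (c t) \<and> \<mu>1 t = \<mu>2 (c t)"
    proof (rule S.system_unique[OF a1' a2' \<mu>1(1) _ _ m' _ _ D_borel D_bound])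
      show "continuous_on UNIV (\<lambda>s. \<mu>2 (c s))" by (rule continuous_on_compose2[OF \<mu>2(1) cc]) auto
      show "\<bar>b1 s - b2 (c s)\<bar> \<le> B * \<bar>\<mu>1 s - \<mu>2 (c s)\<bar>" if s: "s \<in> {0..T'}" for s
      proof -
        have "\<bar>b1 s - b2 (c s)\<bar> = \<bar>\<beta> (cl s)\<bar> * \<bar>\<mu>1 s - \<mu>2 (c s)\<bar>"
          unfolding b1 b2 cid[OF s] abs_mult[symmetric] by (simp add: algebra_simps abs_minus_commute)
        also have "\<dots> \<le> B * \<bar>\<mu>1 s - \<mu>2 (c s)\<bar>"
          using K[OF cl_in[of s]] by (intro mult_right_mono) (auto simp: B_def)
        finally show ?thesis .
      qed
      show "m' \<le> \<bar>\<mu>1 s\<bar>" for s using \<mu>1(2) \<mu>1(3)[of s] by (simp add: m'_def)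
      show "m' \<le> \<bar>\<mu>2 (c s)\<bar>" for s using s0(2)[OF cin[of s]] by (simp add: m'_def)
      show "\<mu>1 s = mom (\<lambda>_. 1) G1 b1 s" "G1 s = (LBINT s:{0..s}. (D s + mom kk G1 b1 s / \<epsilon>) / \<mu>1 s)" if "s \<in> {0..T'}" for s
        using e1[of s] that T' by auto
      show "\<mu>2 (c s) = mom (\<lambda>_. 1) (\<lambda>s. G2 (c s)) (\<lambda>s. b2 (c s)) s" if s: "s \<in> {0..T'}" for s
        using e2(1)[of s] s T' by (simp add: mc[OF s] cid[OF s])
      show "G2 (c s) = (LBINT r:{0..s}. (D r + mom kk (\<lambda>s. G2 (c s)) (\<lambda>s. b2 (c s)) r / \<epsilon>) / \<mu>2 (c r))" if s: "s \<in> {0..T'}" for s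
      proof -
        have "(LBINT r:{0..s}. (D r + mom kk (\<lambda>s. G2 (c s)) (\<lambda>s. b2 (c s)) r / \<epsilon>) / \<mu>2 (c r)) = (LBINT r:{0..s}. (D r + mom kk G2 b2 r / \<epsilon>) / \<mu>2 r)"
          by (intro set_lebesgue_integral_cong) (use s in \<open>auto simp: mc cid\<close>)
        then show ?thesis using e2(2)[of s] s T' cid[OF s] by simp
      qed
      show "t \<in> {0..T'}" using t T' by auto
    qed
    then show ?thesis using cid[of t] t T' by simp
  qed
  have "{0..<T} \<subseteq> {t. G1 t = G2 t} \<inter> {t. \<mu>1 t = \<mu>2 t}" using agree by auto
  moreover have "closed ({t. G1 t = G2 t} \<inter> {t. \<mu>1 t = \<mu>2 t})"
    by (intro closed_Int closed_Collect_eq admissibleD(3)[OF a1] A2(3) \<mu>1(1) \<mu>2(1))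
  ultimately have "closure {0..<T} \<subseteq> {t. G1 t = G2 t} \<inter> {t. \<mu>1 t = \<mu>2 t}" by (rule closure_minimal)
  then show ?thesis using t T by auto
qed

end

theorem theorem6p2:
  fixes \<epsilon> T \<zeta>min \<zeta>Lip \<beta>min \<beta>max :: real
    and \<zeta> \<beta> f \<rho>I vI :: "real \<Rightarrow> real"
  assumes "\<epsilon> > 0" and "T > 0"
    and "A1 \<zeta> \<zeta>min \<zeta>Lip"
    and "A2 \<rho>I"
    and "Linf_omega vI"
    and "\<exists>L. L-lipschitz_on {0<..<T} f"
    and "A3 T \<beta> \<beta>min \<beta>max"
    and "\<beta>min > zeta_breve \<zeta> \<zeta>Lip vI \<rho>I f T"
  shows "\<exists>\<rho> v. char_solution \<epsilon> T \<zeta> \<beta> f \<rho>I vI \<rho> v \<and>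
           (\<forall>\<rho>' v'. char_solution \<epsilon> T \<zeta> \<beta> f \<rho>I vI \<rho>' v' \<longrightarrow>
              (\<forall>t\<in>{0..T}. AE a in lebesgue_on {0..}. \<rho>' t a = \<rho> t a) \<and>
              (\<forall>t\<in>{0<..<T}. AE a in lebesgue_on {0..}. v' t a = v t a))"
proof -
  note eps = assms(1) and T = assms(2)
  have S: "{0::real..} \<in> sets borel" by simp
  obtain L where zL: "L-lipschitz_on UNIV \<zeta>" and zmin: "0 < \<zeta>min" "\<And>u. \<zeta>min \<le> \<zeta> u"
    and zd: "\<And>u. \<zeta> differentiable (at u) \<Longrightarrow> \<bar>deriv \<zeta> u\<bar> \<le> \<zeta>Lip"
    using assms(3) unfolding A1_def by blast
  have z0: "0 \<le> \<zeta> u" for u using zmin(1) zmin(2)[of u] by simp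
  have zlip: "\<bar>\<zeta> u - \<zeta> 0\<bar> \<le> \<zeta>Lip * \<bar>u\<bar>" for u using lipschitz_deriv_bound[OF zL zd, of u 0] by simp
  obtain Lf where Lf: "Lf-lipschitz_on {0<..<T} f" using assms(6) by blast
  obtain D where D: "D \<in> borel_measurable borel" "\<And>s. \<bar>D s\<bar> \<le> Lf"
      "AE s in lborel. s \<in> {0<..<T} \<longrightarrow> D s = deriv f s"
    by (rule lipschitz_deriv_borel[OF Lf]) (rule that)
  have \<beta>: "continuous_on {0..T} \<beta>" "0 < \<beta>min" "\<And>s. s \<in> {0..T} \<Longrightarrow> \<beta>min \<le> \<beta> s \<and> \<beta> s \<le> \<beta>max"
    using assms(7) unfolding A3_def by auto
  have \<rho>m: "\<rho>I \<in> borel_measurable (lebesgue_on {0..})" and \<rho>0: "AE a in lborel. a \<in> {0..} \<longrightarrow> 0 \<le> \<rho>I a"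
    and \<rho>i: "integrable (lebesgue_on {0..}) \<rho>I" "0 < (LINT a|lebesgue_on {0..}. \<rho>I a)" "(LINT a|lebesgue_on {0..}. \<rho>I a) < 1"
      "integrable (lebesgue_on {0..}) (\<lambda>a. a * \<rho>I a)" "integrable (lebesgue_on {0..}) (\<lambda>a. a\<^sup>2 * \<rho>I a)"
    using assms(4) unfolding A2_def Linf_def by (auto simp: AE_lebesgue_on_iff[OF S])
  obtain R' where R': "R' \<in> borel_measurable borel" "AE a in lborel. a \<in> {0..} \<longrightarrow> \<rho>I a = R' a"
    by (rule lebesgue_on_borel_rep[OF S \<rho>m])
  \<comment> \<open>A version that is nonnegative everywhere, as the locale requires.\<close>
  define R where "R = (\<lambda>a. max 0 (R' a))"
  have Rm[measurable]: "R \<in> borel_measurable borel" unfolding R_def using R'(1) by measurable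
  have R0: "0 \<le> R a" for a by (simp add: R_def)
  have \<rho>R: "AE a in lborel. a \<in> {0..} \<longrightarrow> \<rho>I a = R a"
    using R'(2) \<rho>0 by eventually_elim (auto simp: R_def)
  obtain Cw where Cw: "0 \<le> Cw" "AE a in lebesgue_on {0..}. \<bar>vI a * omega a\<bar> \<le> Cw"
    by (rule Linf_AE_bound[OF assms(5)[unfolded Linf_omega_def]])
  have "(\<lambda>a. vI a * omega a) \<in> borel_measurable (lebesgue_on {0..})"
    using assms(5) unfolding Linf_omega_def Linf_def by simp
  then obtain w' where w': "w' \<in> borel_measurable borel" "AE a in lborel. a \<in> {0..} \<longrightarrow> vI a * omega a = w' a"
    by (rule lebesgue_on_borel_rep[OF S])
  \<comment> \<open>The clip makes the weighted bound hold at every age instead of almost every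
    one.\<close>
  define w where "w = (\<lambda>a. clip Cw (w' a) * (1 + a))"
  have wm[measurable]: "w \<in> borel_measurable borel" unfolding w_def using w'(1) by measurable
  have vw: "AE a in lborel. a \<in> {0..} \<longrightarrow> vI a = w a"
    using w'(2) Cw(2)[unfolded AE_lebesgue_on_iff[OF S]]
  proof eventually_elim
    fix a assume 1: "a \<in> {0..} \<longrightarrow> vI a * omega a = w' a" and 2: "a \<in> {0..} \<longrightarrow> \<bar>vI a * omega a\<bar> \<le> Cw"
    show "a \<in> {0..} \<longrightarrow> vI a = w a"
    proof
      assume a: "a \<in> {0..}"
      then have "clip Cw (w' a) = vI a * omega a" using 1 2 by (simp add: clip_simps(3))
      then show "vI a = w a" using a by (simp add: w_def omega_def)
    qed
  qed
  have wb: "\<bar>w a\<bar> \<le> Cw * (1 + a)" if "0 \<le> a" for a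
    using clip_simps(1)[OF Cw(1), of "w' a"] that unfolding w_def abs_mult by (intro mult_mono) auto
  define h0 where "h0 = (\<lambda>x. - w (- x / \<epsilon>))"
  define r0 where "r0 = (\<lambda>x. R (- x / \<epsilon>))"
  have [measurable]: "h0 \<in> borel_measurable borel" "r0 \<in> borel_measurable borel"
    unfolding h0_def r0_def by measurable
  have h0e: "h0 (0 - \<epsilon> * a) = - w a" and r0e: "r0 (0 - \<epsilon> * a) = R a" for a
    using eps by (simp_all add: h0_def r0_def)
  have Ri: "set_integrable lborel {0..} R" "(LINT a|lebesgue_on {0..}. \<rho>I a) = (LBINT a:{0..}. R a)"
    using lebesgue_on_cong_AE(2,3)[OF S Rm \<rho>R] \<rho>i(1) by auto
  have Rp: "integrable (lebesgue_on {0..}) (\<lambda>a. a ^ p * \<rho>I a) \<longleftrightarrow> set_integrable lborel {0..} (\<lambda>a. a ^ p * R a)" for p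
  proof (rule lebesgue_on_cong_AE(2)[OF S])
    show "AE a in lborel. a \<in> {0..} \<longrightarrow> a ^ p * \<rho>I a = a ^ p * R a"
      using \<rho>R by eventually_elim auto
  qed measurable
  have Ri1: "set_integrable lborel {0..} (\<lambda>a. a * R a)" using Rp[of 1] \<rho>i(4) by simp
  have Ri2: "set_integrable lborel {0..} (\<lambda>a. a\<^sup>2 * R a)" using Rp[of 2] \<rho>i(5) by simp
  have rint: "set_integrable lborel {..0} (\<lambda>x. r0 x * (1 + \<bar>h0 x\<bar>)\<^sup>2)"
    unfolding age_substitution(2)[OF eps] h0e r0e
  proof (rule set_integrable_bound)
    show "set_integrable lborel {0..} (\<lambda>a. (1 + Cw)\<^sup>2 * (R a + 2 * (a * R a) + a\<^sup>2 * R a))"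
      by (intro set_integrable_mult_right set_integral_add(1) Ri Ri1 Ri2)
    show "set_borel_measurable lborel {0..} (\<lambda>a. R a * (1 + \<bar>- w a\<bar>)\<^sup>2)"
      unfolding set_borel_measurable_def by measurable
    show "AE a in lborel. a \<in> {0..} \<longrightarrow> norm (R a * (1 + \<bar>- w a\<bar>)\<^sup>2) \<le> norm ((1 + Cw)\<^sup>2 * (R a + 2 * (a * R a) + a\<^sup>2 * R a))"
    proof (intro AE_I2 impI)
      fix a :: real assume "a \<in> {0..}"
      then have a: "0 \<le> a" by simp
      \<comment> \<open>The square of this linear growth is what calls for the second moment of
        \<open>\<rho>I\<close> in (A2).\<close>
      have "1 + \<bar>- w a\<bar> \<le> (1 + Cw) * (1 + a)" using wb[OF a] a by (simp add: algebra_simps)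
      then have "(1 + \<bar>- w a\<bar>)\<^sup>2 \<le> ((1 + Cw) * (1 + a))\<^sup>2" by (intro power_mono) auto
      then have "R a * (1 + \<bar>- w a\<bar>)\<^sup>2 \<le> R a * ((1 + Cw) * (1 + a))\<^sup>2" using R0 by (intro mult_left_mono)
      also have "\<dots> = (1 + Cw)\<^sup>2 * (R a + 2 * (a * R a) + a\<^sup>2 * R a)" by (simp add: power2_eq_square algebra_simps)
      finally have "R a * (1 + \<bar>- w a\<bar>)\<^sup>2 \<le> (1 + Cw)\<^sup>2 * (R a + 2 * (a * R a) + a\<^sup>2 * R a)" .
      moreover have "0 \<le> R a * (1 + \<bar>- w a\<bar>)\<^sup>2" using R0 by simp
      ultimately show "norm (R a * (1 + \<bar>- w a\<bar>)\<^sup>2) \<le> norm ((1 + Cw)\<^sup>2 * (R a + 2 * (a * R a) + a\<^sup>2 * R a))"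
        unfolding real_norm_def by linarith
    qed
  qed
  have mass: "(LBINT x:{..0}. r0 x) = \<epsilon> * (LINT a|lebesgue_on {0..}. \<rho>I a)"
    unfolding age_substitution(1)[OF eps] r0e Ri(2) ..
  have vmass: "(LBINT x:{..0}. r0 x * \<bar>h0 x\<bar>) = \<epsilon> * (LINT a|lebesgue_on {0..}. \<bar>vI a\<bar> * \<rho>I a)"
  proof -
    have "AE a in lborel. a \<in> {0..} \<longrightarrow> \<bar>vI a\<bar> * \<rho>I a = R a * \<bar>- w a\<bar>"
      using vw \<rho>R by eventually_elim auto
    then have "(LINT a|lebesgue_on {0..}. \<bar>vI a\<bar> * \<rho>I a) = (LBINT a:{0..}. R a * \<bar>- w a\<bar>)"
      by (intro lebesgue_on_cong_AE(3)[OF S]) measurable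
    then show ?thesis unfolding age_substitution(1)[OF eps] r0e h0e by simp
  qed
  have Dint: "(LINT s|lebesgue_on {0<..<T}. \<bar>deriv f s\<bar>) = (LBINT s:{0..T}. \<bar>D s\<bar>)"
  proof -
    have "(LINT s|lebesgue_on {0<..<T}. \<bar>deriv f s\<bar>) = (LBINT s:{0<..<T}. \<bar>D s\<bar>)"
      by (rule lebesgue_on_cong_AE(3)) (use D in \<open>auto elim: eventually_mono\<close>)
    also have "\<dots> = (LBINT s:{0..T}. \<bar>D s\<bar>)"
      unfolding set_lebesgue_integral_def
    proof (rule integral_cong_AE)
      show "AE s in lborel. indicat_real {0<..<T} s *\<^sub>R \<bar>D s\<bar> = indicat_real {0..T} s *\<^sub>R \<bar>D s\<bar>"
        using AE_lborel_singleton[of 0] AE_lborel_singleton[of T] by eventually_elim (auto simp: indicator_def)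
    qed (use D(1) in measurable)
    finally show ?thesis .
  qed
  interpret coupled_system \<epsilon> T L \<zeta> h0 r0 \<beta> f \<rho>I vI D Lf
  proof unfold_locales
    show "AE a in lborel. 0 \<le> a \<longrightarrow> vI a = - h0 (- \<epsilon> * a)"
      using vw by eventually_elim (use h0e in auto)
    show "AE a in lborel. 0 \<le> a \<longrightarrow> \<rho>I a = r0 (- \<epsilon> * a)"
      using \<rho>R by eventually_elim (use r0e in auto)
    show "0 \<le> r0 x" for x by (simp add: r0_def R0)
  qed (use eps T zL z0 rint D \<beta> in auto)
  have R0pos: "0 < (LBINT x:{..0}. r0 x)" "(LBINT x:{..0}. r0 x) < \<epsilon>"
    unfolding mass using eps \<rho>i(2,3) by (simp_all add: mult_less_cancel_left2)
  \<comment> \<open>By \<open>vmass\<close> and \<open>Dint\<close> the left side is the value of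
    \<open>zeta_breve\<close> minus \<open>\<zeta> 0\<close>.\<close>
  have small: "\<zeta>Lip * ((LBINT x:{..0}. r0 x * \<bar>h0 x\<bar>) / \<epsilon> + (LBINT s:{0..T}. \<bar>D s\<bar>)) < \<beta>min"
    using assms(8) z0[of 0] eps unfolding zeta_breve_def vmass Dint by simp
  obtain G \<mu> b M m where a: "admissible \<beta>max M G b" and b: "b = (\<lambda>s. \<beta> (cl s) * (1 - \<mu> s))"
    and \<mu>c: "continuous_on UNIV \<mu>" and m: "0 < m" "\<And>s. m \<le> \<mu> s"
    and \<mu>: "\<And>t. t \<in> {0..T} \<Longrightarrow> \<mu> t = mom (\<lambda>_. 1) G b t"
    and G: "\<And>t. t \<in> {0..T} \<Longrightarrow> G t = (LBINT s:{0..t}. (D s + mom kk G b s / \<epsilon>) / \<mu> s)"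
    by (rule system_exists[OF \<beta>(1,3,2) D(1,2) zlip R0pos small]) (assumption | rule that)+
  define \<rho> where "\<rho> = (\<lambda>t a. wt b (t - \<epsilon> * a) * surv G t (t - \<epsilon> * a))"
  define v where "v = (\<lambda>t a. vel G t (t - \<epsilon> * a))"
  have sol: "char_solution \<epsilon> T \<zeta> \<beta> f \<rho>I vI \<rho> v"
    unfolding \<rho>_def v_def
  proof (rule char_solution_of_system[OF a _ \<mu>c m \<mu> G _ Cw(1)])
    show "b s = \<beta> s * (1 - \<mu> s)" if "s \<in> {0..T}" for s using that by (simp add: b cl_id)
    show "\<bar>h0 x\<bar> \<le> Cw * (1 - x / \<epsilon>)" if "x \<le> 0" for x
      using wb[of "- x / \<epsilon>"] that eps by (simp add: h0_def divide_nonpos_pos)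
  qed
  show ?thesis
  proof (rule exI[of _ \<rho>], rule exI[of _ v], intro conjI allI impI)
    show "char_solution \<epsilon> T \<zeta> \<beta> f \<rho>I vI \<rho> v" by (rule sol)
  next
    fix \<rho>' v' assume "char_solution \<epsilon> T \<zeta> \<beta> f \<rho>I vI \<rho>' v'"
    then obtain G2 \<mu>2 b2 B2 M2 where a2: "admissible B2 M2 G2 b2" and b2: "b2 = (\<lambda>s. \<beta> (cl s) * (1 - \<mu>2 s))"
      and \<mu>2: "continuous_on UNIV \<mu>2" "\<And>t. t \<in> {0<..<T} \<Longrightarrow> \<mu>2 t \<noteq> 0"
      and e2: "\<And>t. t \<in> {0..T} \<Longrightarrow> \<mu>2 t = mom (\<lambda>_. 1) G2 b2 t"
        "\<And>t. t \<in> {0..T} \<Longrightarrow> G2 t = (LBINT s:{0..t}. (D s + mom kk G2 b2 s / \<epsilon>) / \<mu>2 s)"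
      and \<rho>': "\<And>t. t \<in> {0..T} \<Longrightarrow> AE a in lebesgue_on {0..}. \<rho>' t a = wt b2 (t - \<epsilon> * a) * surv G2 t (t - \<epsilon> * a)"
      and v': "\<And>t. t \<in> {0<..<T} \<Longrightarrow> AE a in lebesgue_on {0..}. v' t a = vel G2 t (t - \<epsilon> * a)"
      by (rule system_of_char_solution) (rule that)
    have eq: "G t = G2 t \<and> \<mu> t = \<mu>2 t" if "t \<in> {0..T}" for t
      by (rule systems_agree[OF R0pos(1) a b \<mu>c m \<mu> G a2 b2 \<mu>2 e2 that])
    have xt: "t - \<epsilon> * a \<le> t" if "0 \<le> a" for t a using eps that by simp
    show "\<forall>t\<in>{0..T}. AE a in lebesgue_on {0..}. \<rho>' t a = \<rho> t a"
    proof
      fix t assume t: "t \<in> {0..T}"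
      show "AE a in lebesgue_on {0..}. \<rho>' t a = \<rho> t a"
        using \<rho>'[OF t] unfolding AE_lebesgue_on_iff[OF S]
      proof eventually_elim
        fix a assume 1: "a \<in> {0..} \<longrightarrow> \<rho>' t a = wt b2 (t - \<epsilon> * a) * surv G2 t (t - \<epsilon> * a)"
        show "a \<in> {0..} \<longrightarrow> \<rho>' t a = \<rho> t a"
        proof
          assume a: "a \<in> {0..}"
          then have x: "t - \<epsilon> * a \<le> t" using xt by auto
          have "surv G2 t (t - \<epsilon> * a) = surv G t (t - \<epsilon> * a)"
            by (rule surv_cong[OF _ x]) (use eq t in auto)
          moreover have "wt b2 (t - \<epsilon> * a) = wt b (t - \<epsilon> * a)"
            using eq[of "t - \<epsilon> * a"] x t by (auto simp: wt_def b b2 cl_id)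
          ultimately show "\<rho>' t a = \<rho> t a" using 1 a by (simp add: \<rho>_def)
        qed
      qed
    qed
    show "\<forall>t\<in>{0<..<T}. AE a in lebesgue_on {0..}. v' t a = v t a"
    proof
      fix t assume t: "t \<in> {0<..<T}"
      show "AE a in lebesgue_on {0..}. v' t a = v t a"
        using v'[OF t] unfolding AE_lebesgue_on_iff[OF S]
      proof eventually_elim
        fix a assume 1: "a \<in> {0..} \<longrightarrow> v' t a = vel G2 t (t - \<epsilon> * a)"
        show "a \<in> {0..} \<longrightarrow> v' t a = v t a"
        proof
          assume a: "a \<in> {0..}"
          then have x: "t - \<epsilon> * a \<le> t" using xt by auto
          have "vel G2 t (t - \<epsilon> * a) = vel G t (t - \<epsilon> * a)"
            by (rule vel_cong[OF _ _ x]) (use eq t in auto)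
          then show "v' t a = v t a" using 1 a by (simp add: v_def)
        qed
      qed
    qed
  qed
qed

end
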